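(* Let $\pi \in I_\mathbb{Z}$. Then $\mathfrak{ib}_\pi$ is an isomorphism of $\mathfrak{q}_n$-crystals $\displaystyle\bigsqcup_{\sigma\in I_\mathbb{Z}} \mathcal{R}^{\mathsf{O}}_n(\sigma) \to \bigsqcup_{\sigma\in I_\mathbb{Z}} \mathcal{R}^{\mathsf{O}}_n(\sigma)$.
   Context: Fix a positive integer $n$. Let $S_\mathbb{Z}$ be the permutations of $\mathbb{Z}$ fixing all but finitely many integers, $s_i=(i,i+1)$, $I_\mathbb{Z}$ the involutions in $S_\mathbb{Z}$. With the Demazure product ($\pi\circ s_i=\pi s_i$ if $\pi(i)<\pi(i+1)$, else $\pi$), an involution word for $\pi\in I_\mathbb{Z}$ is a minimal-length word $i_1\cdots i_l$ with $\pi=s_{i_l}\circ\cdots\circ s_{i_1}\circ1\circ s_{i_1}\circ\cdots\circ s_{i_l}$; $\mathcal{R}^{\mathsf{O}}(\pi)$ is the set of these, and $\mathcal{R}^{\mathsf{O}}_n(\pi)$ is the set of $n$-tuples of strictly increasing words whose concatenation lies in $\mathcal{R}^{\mathsf{O}}(\pi)$. This set carries Hiroshima's $\mathfrak{q}_n$-crystal structure: weight = factor lengths; $e_i,f_i$ ($i\in[n-1]$) are the Morse–Schilling operators (pair letters of $w^{i+1}$, from largest to smallest, with the smallest unpaired larger letter of $w^i$; $f_i$ removes the largest unpaired letter $x$ of $w^i$ and adds to $w^{i+1}$ the smallest $y\ge x$ not already present, or gives $0$ if none is unpaired; $e_i$ removes the smallest unpaired letter $y$ of $w^{i+1}$ and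 adds to $w^i$ the largest $x\le y$ not already present, or gives $0$); $f_{\overline1}$ moves the first letter of $w^1$ to $w^2$ if it is smaller than all letters of $w^2$ (else $0$), and $e_{\overline1}$ moves the first letter of $w^2$ to $w^1$ if it is smaller than all letters of $w^1$ (else $0$). Involution Little bumps: for $\pi\in I_\mathbb{Z}$, a $\pi$-marked involution word is a pair $(w,i)$ such that deleting the $i$th letter of $w$ gives an involution word for $\pi$; it is inv-reduced if $w$ itself is an involution word (for some element of $I_\mathbb{Z}$). If $(w,i)$ is not inv-reduced there is a unique $j\neq i$ such that $(w,j)$ is also a $\pi$-marked involution word; set $j=i$ if $(w,i)$ is inv-reduced, and define $\textsf{ipush}(w,i)=(v,j)$ where $v$ is $w$ with its $j$th letter increased by one. For an involution word $w$, if some (necessarily unique) $i$ makes $(w,i)$ a $\pi$-marked involution word, let $N>0$ be minimal with $\textsf{ipush}^N(w,i)=(v,j)$ inv-reduced and set $\mathfrak{ib}_\pi(w)=v$; otherwise $\mathfrak{ib}_\pi(w)=w$. Since $\mathfrak{ib}_\pi$ preserves the descent set of words, it is extended to factorizations: $\mathfrak{ib}_\pi(w^1,\dots,w^n)=(v^1,\dots,v^n)$ where $v^1\cdots v^n=\mathfrak{ib}_\pi(w^1\cdots w^n)$ and $\ell(v^i)=\ell(w^i)$ (each $v^i$ is again strictly increasing). *)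

theory Defs
  imports Main
begin

definition sZ :: "int \<Rightarrow> int \<Rightarrow> int" where
  "sZ i = (\<lambda>x. if x = i then i + 1 else if x = i + 1 then i else x)"

definition perm_Z :: "(int \<Rightarrow> int) \<Rightarrow> bool" where
  "perm_Z \<pi> \<longleftrightarrow> bij \<pi> \<and> finite {x. \<pi> x \<noteq> x}"

definition I_Z :: "(int \<Rightarrow> int) set" where
  "I_Z = {\<pi>. perm_Z \<pi> \<and> \<pi> \<circ> \<pi> = id}"

text \<open>Demazure product: right multiplication  pi o s_i  and left multiplication  s_i o pi.
  Products of permutations are composition of functions (pi s_i means: apply s_i first).\<close>

definition demR :: "(int \<Rightarrow> int) \<Rightarrow> int \<Rightarrow> (int \<Rightarrow> int)" where
  "demR \<pi> i = (if \<pi> i < \<pi> (i + 1) then \<pi> \<circ> sZ i else \<pi>)"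

definition demL :: "int \<Rightarrow> (int \<Rightarrow> int) \<Rightarrow> (int \<Rightarrow> int)" where
  "demL i \<pi> = (if inv \<pi> i < inv \<pi> (i + 1) then sZ i \<circ> \<pi> else \<pi>)"

text \<open>For a word i_1 ... i_l this computes
  s_{i_l} o ... o s_{i_1} o 1 o s_{i_1} o ... o s_{i_l}  (innermost first; the Demazure product is associative).\<close>

definition demword :: "int list \<Rightarrow> (int \<Rightarrow> int)" where
  "demword w = fold (\<lambda>a \<sigma>. demL a (demR \<sigma> a)) w id"

definition inv_word :: "int list \<Rightarrow> (int \<Rightarrow> int) \<Rightarrow> bool" where
  "inv_word w \<pi> \<longleftrightarrow> demword w = \<pi> \<and> (\<forall>v. demword v = \<pi> \<longrightarrow> length w \<le> length v)"

definition RO :: "(int \<Rightarrow> int) \<Rightarrow> int list set" where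
  "RO \<pi> = {w. inv_word w \<pi>}"

definition RO_n :: "nat \<Rightarrow> (int \<Rightarrow> int) \<Rightarrow> int list list set" where
  "RO_n n \<pi> = {ws. length ws = n \<and> (\<forall>w\<in>set ws. sorted_wrt (<) w) \<and> concat ws \<in> RO \<pi>}"

text \<open>The (disjoint, since sigma is determined by the concatenation) union over sigma in I_Z.\<close>

definition crystal_X :: "nat \<Rightarrow> int list list set" where
  "crystal_X n = (\<Union>\<sigma>\<in>I_Z. RO_n n \<sigma>)"

section \<open>The q_n-crystal operators (None plays the role of 0)\<close>

text \<open>Pairing: letters y of the second word are processed from largest to smallest, each paired with
  the smallest still unpaired letter x > y of the first word (set A = unpaired letters of the first word).
  Result: (unpaired letters of first word, unpaired letters of second word).\<close>

fun pair_aux :: "int list \<Rightarrow> int set \<Rightarrow> int set \<times> int set" where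
  "pair_aux [] A = (A, {})"
| "pair_aux (y # ys) A =
     (let C = {x \<in> A. y < x} in
      if C = {} then (let (A', U) = pair_aux ys A in (A', insert y U))
      else pair_aux ys (A - {Min C}))"

definition unpaired :: "int list \<Rightarrow> int list \<Rightarrow> int set \<times> int set" where
  "unpaired a b = pair_aux (rev (sort b)) (set a)"

text \<open>Operators f_i, e_i for 1 <= i <= n-1 act on factors w^i = ws!(i-1) and w^{i+1} = ws!i.\<close>

definition f_op :: "nat \<Rightarrow> int list list \<Rightarrow> int list list option" where
  "f_op i ws =
    (let a = ws ! (i - 1); b = ws ! i; UA = fst (unpaired a b) in
     if UA = {} then None
     else (let x = Max UA; y = (LEAST y. x \<le> y \<and> y \<notin> set b) in
           Some (ws[i - 1 := remove1 x a, i := insort y b])))"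

definition e_op :: "nat \<Rightarrow> int list list \<Rightarrow> int list list option" where
  "e_op i ws =
    (let a = ws ! (i - 1); b = ws ! i; UB = snd (unpaired a b) in
     if UB = {} then None
     else (let y = Min UB; x = (GREATEST x. x \<le> y \<and> x \<notin> set a) in
           Some (ws[i := remove1 y b, i - 1 := insort x a])))"

definition f_bar1 :: "int list list \<Rightarrow> int list list option" where
  "f_bar1 ws =
    (let a = ws ! 0; b = ws ! 1 in
     if a \<noteq> [] \<and> (\<forall>z\<in>set b. hd a < z) then Some (ws[0 := tl a, 1 := hd a # b]) else None)"

definition e_bar1 :: "int list list \<Rightarrow> int list list option" where
  "e_bar1 ws =
    (let a = ws ! 0; b = ws ! 1 in
     if b \<noteq> [] \<and> (\<forall>z\<in>set a. hd b < z) then Some (ws[1 := tl b, 0 := hd b # a]) else None)"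

definition weight :: "int list list \<Rightarrow> nat list" where
  "weight ws = map length ws"

text \<open>Positions in words are 0-based here.\<close>

definition del_at :: "int list \<Rightarrow> nat \<Rightarrow> int list" where
  "del_at w i = take i w @ drop (Suc i) w"

definition marked :: "(int \<Rightarrow> int) \<Rightarrow> int list \<Rightarrow> nat \<Rightarrow> bool" where
  "marked \<pi> w i \<longleftrightarrow> i < length w \<and> inv_word (del_at w i) \<pi>"

definition inv_reduced :: "int list \<Rightarrow> bool" where
  "inv_reduced w \<longleftrightarrow> inv_word w (demword w)"

definition ipush :: "(int \<Rightarrow> int) \<Rightarrow> int list \<times> nat \<Rightarrow> int list \<times> nat" where
  "ipush \<pi> wi =
    (let w = fst wi; i = snd wi;
         j = (if inv_reduced w then i else (THE j. j \<noteq> i \<and> marked \<pi> w j))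
     in (w[j := w ! j + 1], j))"

definition ib :: "(int \<Rightarrow> int) \<Rightarrow> int list \<Rightarrow> int list" where
  "ib \<pi> w =
    (if \<exists>i. marked \<pi> w i then
       (let i = (THE i. marked \<pi> w i);
            N = (LEAST N. 0 < N \<and> inv_reduced (fst ((ipush \<pi> ^^ N) (w, i))))
        in fst ((ipush \<pi> ^^ N) (w, i)))
     else w)"

fun split_lens :: "nat list \<Rightarrow> 'a list \<Rightarrow> 'a list list" where
  "split_lens [] v = []"
| "split_lens (k # ks) v = take k v # split_lens ks (drop k v)"

definition ib_fact :: "(int \<Rightarrow> int) \<Rightarrow> int list list \<Rightarrow> int list list" where
  "ib_fact \<pi> ws = split_lens (map length ws) (ib \<pi> (concat ws))"

end

theory Submission
  imports Defs
begin

text \<open>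
  The conjugated Demazure action on involutions is monotone for the Bruhat order, which on rank tables
  is a pointwise comparison, and the length of the involution weak order is strictly monotone. This
  yields the exchange property, hence the unique second marked position of a non-reduced marked word,
  so pushing is a bijection on marked words. Non-reduced marked words only use letters from a finite
  set, while each push raises the letter sum by one: the bump terminates in both directions and is a
  bijection. A push that creates two equal neighbours is followed by a push of the other one, so
  descents are preserved.

  Static commutation and braid moves respect markings, and tracking a Coxeter--Knuth triple through
  one or two pushes shows that the bump commutes with all Coxeter--Knuth operators and with the swap of
  the first two letters. The queer operators are fixed sequences of such operators. For
  the remaining ones, repeated row insertion of the second factor into the first (again a
  sequence of Coxeter--Knuth operators, governed by descents alone) has the same result before and
  after applying \<open>f\<^sub>i\<close>, and the number of bumps decides whether \<open>f\<^sub>i\<close> is defined.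
\<close>

section \<open>Rank tables and the Bruhat order\<close>

text \<open>A bump takes a number of pushes not known in advance and keeps hardly more than the
  descents of a word, whereas the pairing and the search for the new letter in \<open>f_op\<close>
  compare letter values. No operator can therefore be followed through a bump directly. The way out
  is a characterization that a bump cannot disturb: Coxeter--Knuth operators are involutions, so a
  fixed insertion procedure together with its number of insertions determines the word it started
  from. Two words that rectify alike coincide, which turns an identity of rectified words into an
  identity of factorizations.

  Reducedness enters beyond bookkeeping. It controls how common runs of letters in neighbouring
  factors may end, and this is what makes \<open>f_op\<close> and \<open>e_op\<close> mutually
  inverse and the insertion of a letter already present well behaved. Once the operators are inverse
  to each other and the bump is a bijection, only the lowering operators have to be compared with
  it.\<close>

declare id_apply [simp del] \<comment> \<open>rewriting an eta-expanded \<open>id\<close> would hide it from rules stated for \<open>id\<close>\<close>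

section \<open>Adjacent transpositions and finitely supported permutations\<close>

lemma sZ_simps [simp]: "sZ c c = c + 1" "sZ c (c + 1) = c" "sZ c (sZ c x) = x"
  "x \<noteq> c \<Longrightarrow> x \<noteq> c + 1 \<Longrightarrow> sZ c x = x"
  by (auto simp: sZ_def)

lemma sZ_comp_self [simp]: "sZ c \<circ> sZ c = id"
  by (auto simp: id_apply)

lemma bij_sZ: "bij (sZ c)"
  by (rule o_bij[where g = "sZ c"]) simp_all

lemma perm_Z_bij: "perm_Z z \<Longrightarrow> bij z"
  by (simp add: perm_Z_def)

lemma perm_Z_sZ: "perm_Z (sZ c)"
proof -
  have "{x. sZ c x \<noteq> x} \<subseteq> {c, c + 1}" by (auto simp: sZ_def)
  then show ?thesis unfolding perm_Z_def using bij_sZ finite_subset by blast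
qed

lemma perm_Z_id: "perm_Z id"
  by (simp add: perm_Z_def id_apply)

lemma perm_Z_comp:
  assumes "perm_Z y" "perm_Z z" shows "perm_Z (y \<circ> z)"
proof -
  have "{x. (y \<circ> z) x \<noteq> x} \<subseteq> {x. z x \<noteq> x} \<union> {x. y x \<noteq> x}" by auto
  then show ?thesis using assms unfolding perm_Z_def
    by (meson bij_comp finite_UnI finite_subset)
qed

lemma perm_Z_inv:
  assumes "perm_Z z" shows "perm_Z (inv z)"
proof -
  have b: "bij z" using assms perm_Z_bij by blast
  have "{x. inv z x \<noteq> x} \<subseteq> {x. z x \<noteq> x}"
    using b by (auto simp: bij_def) (metis inv_f_f)
  then show ?thesis using assms b unfolding perm_Z_def
    by (meson bij_imp_bij_inv finite_subset)
qed

lemma inv_sZ_comp: "bij z \<Longrightarrow> inv (sZ c \<circ> z) = inv z \<circ> sZ c"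
  by (metis bij_sZ o_inv_distrib sZ_comp_self inv_unique_comp)

lemma inv_comp_sZ: "bij z \<Longrightarrow> inv (z \<circ> sZ c) = sZ c \<circ> inv z"
  by (metis bij_sZ o_inv_distrib sZ_comp_self inv_unique_comp)

text \<open>Corner counts of the permutation matrix; the entries grow with the Bruhat order. The
  quadrant is finite because all but finitely many points are fixed. Integer values allow free
  subtraction in the update formulas.\<close>

definition rk :: "(int \<Rightarrow> int) \<Rightarrow> int \<Rightarrow> int \<Rightarrow> int" where
  "rk z p q = int (card {x. x \<le> p \<and> q < z x})"

lemma finite_rk: assumes "perm_Z z" shows "finite {x. x \<le> p \<and> q < z x}"
proof -
  have "{x. x \<le> p \<and> q < z x} \<subseteq> {x. z x \<noteq> x} \<union> {q<..p}" by auto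
  then show ?thesis using assms unfolding perm_Z_def by (meson finite_UnI finite_greaterThanAtMost_int finite_subset)
qed

lemma rk_row:
  assumes "perm_Z z"
  shows "rk z p q = rk z (p - 1) q + (if q < z p then 1 else 0)"
proof -
  have eq: "{x. x \<le> p \<and> q < z x} = {x. x \<le> p - 1 \<and> q < z x} \<union> (if q < z p then {p} else {})"
  proof (rule set_eqI)
    fix x show "x \<in> {x. x \<le> p \<and> q < z x} \<longleftrightarrow> x \<in> {x. x \<le> p - 1 \<and> q < z x} \<union> (if q < z p then {p} else {})"
      by (cases "x = p") auto
  qed
  show ?thesis unfolding rk_def eq using finite_rk[OF assms, of "p - 1" q] by (auto simp: card_insert_if)
qed

lemma rk_col:
  assumes "perm_Z z"
  shows "rk z p (q - 1) = rk z p q + (if inv z q \<le> p then 1 else 0)"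
proof -
  have b: "bij z" using assms perm_Z_bij by blast
  have eq: "{x. x \<le> p \<and> q - 1 < z x} = {x. x \<le> p \<and> q < z x} \<union> (if inv z q \<le> p then {inv z q} else {})"
  proof (rule set_eqI)
    fix x show "x \<in> {x. x \<le> p \<and> q - 1 < z x} \<longleftrightarrow> x \<in> {x. x \<le> p \<and> q < z x} \<union> (if inv z q \<le> p then {inv z q} else {})"
    proof (cases "z x = q")
      case True
      then have "inv z q = x" using b by (metis bij_inv_eq_iff)
      then show ?thesis using True by auto
    next
      case False
      then have "inv z q \<noteq> x" using b by (metis bij_inv_eq_iff)
      then show ?thesis using False by auto
    qed
  qed
  have "z (inv z q) = q" using b by (metis bij_inv_eq_iff)
  then show ?thesis unfolding rk_def eq by (simp add: finite_rk[OF assms] card_insert_if)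
qed

text \<open>For a cut other than the one at \<open>c\<close>, the transposition permutes the
  positions up to the cut among themselves.\<close>

lemma rk_comp_sZ:
  assumes "perm_Z z" "p \<noteq> c"
  shows "rk (z \<circ> sZ c) p q = rk z p q"
proof -
  have le: "sZ c x \<le> p \<longleftrightarrow> x \<le> p" for x using assms(2) by (auto simp: sZ_def)
  have "{x. x \<le> p \<and> q < (z \<circ> sZ c) x} = sZ c ` {x. x \<le> p \<and> q < z x}"
  proof (intro set_eqI iffI)
    fix x assume "x \<in> {x. x \<le> p \<and> q < (z \<circ> sZ c) x}"
    then have "sZ c x \<in> {x. x \<le> p \<and> q < z x}" by (simp add: le)
    then show "x \<in> sZ c ` {x. x \<le> p \<and> q < z x}" by (rule image_eqI[rotated]) simp
  qed (auto simp: le)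
  moreover have "inj_on (sZ c) {x. x \<le> p \<and> q < z x}"
    by (rule inj_on_inverseI[where g = "sZ c"]) simp
  ultimately show ?thesis unfolding rk_def by (simp only: card_image)
qed

lemma rk_sZ_comp:
  assumes "q \<noteq> c"
  shows "rk (sZ c \<circ> z) p q = rk z p q"
proof -
  have "{x. x \<le> p \<and> q < (sZ c \<circ> z) x} = {x. x \<le> p \<and> q < z x}"
    using assms by (auto simp: sZ_def split: if_splits)
  then show ?thesis unfolding rk_def by simp
qed

lemma rk_comp_sZ_at:
  assumes "perm_Z z"
  shows "rk (z \<circ> sZ c) c q = rk z (c - 1) q + (if q < z (c + 1) then 1 else 0)"
  using rk_row[OF perm_Z_comp[OF assms perm_Z_sZ], of c c q] rk_comp_sZ[OF assms, of "c - 1" c q]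
  by simp

lemma rk_sZ_comp_at:
  assumes "perm_Z z"
  shows "rk (sZ c \<circ> z) p c = rk z p (c + 1) + (if inv z c \<le> p then 1 else 0)"
  using rk_col[OF perm_Z_comp[OF perm_Z_sZ assms], of c p "c + 1"] rk_sZ_comp[of "c + 1" c z p]
    perm_Z_bij[OF assms]
  by (simp add: inv_sZ_comp)

text \<open>The jump from row \<open>x - 1\<close> to row \<open>x\<close> is the indicator of
  \<open>q < z x\<close>, which recovers \<open>z x\<close>. Identities of Demazure products can
  thus be checked on tables.\<close>

lemma rk_inject:
  assumes "perm_Z y" "perm_Z z" "rk y = rk z" shows "y = z"
proof
  fix x
  have "(q < y x) = (q < z x)" for q
    using rk_row[OF assms(1), of x q] rk_row[OF assms(2), of x q] assms(3) by (auto split: if_splits)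
  then show "y x = z x" by (metis linorder_neq_iff order.irrefl)
qed

text \<open>On rank tables the one-sided Demazure products become tropical updates of a single row or
  column; this makes their monotonicity and the braid relations computations with min and max.\<close>

definition Rup :: "int \<Rightarrow> (int \<Rightarrow> int \<Rightarrow> int) \<Rightarrow> int \<Rightarrow> int \<Rightarrow> int" where
  "Rup c f p q = (if p = c then min (f (c - 1) q + 1) (f (c + 1) q) else f p q)"
definition Cup :: "int \<Rightarrow> (int \<Rightarrow> int \<Rightarrow> int) \<Rightarrow> int \<Rightarrow> int \<Rightarrow> int" where
  "Cup c f p q = (if q = c then min (f p (c + 1) + 1) (f p (c - 1)) else f p q)"
definition Rdn :: "int \<Rightarrow> (int \<Rightarrow> int \<Rightarrow> int) \<Rightarrow> int \<Rightarrow> int \<Rightarrow> int" where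
  "Rdn c f p q = (if p = c then max (f (c - 1) q) (f (c + 1) q - 1) else f p q)"
definition Cdn :: "int \<Rightarrow> (int \<Rightarrow> int \<Rightarrow> int) \<Rightarrow> int \<Rightarrow> int \<Rightarrow> int" where
  "Cdn c f p q = (if q = c then max (f p (c + 1)) (f p (c - 1) - 1) else f p q)"

definition lowR :: "(int \<Rightarrow> int) \<Rightarrow> int \<Rightarrow> (int \<Rightarrow> int)" where
  "lowR z c = (if z c < z (c + 1) then z else z \<circ> sZ c)"
definition lowL :: "int \<Rightarrow> (int \<Rightarrow> int) \<Rightarrow> (int \<Rightarrow> int)" where
  "lowL c z = (if inv z c < inv z (c + 1) then z else sZ c \<circ> z)"

lemma perm_demR: "perm_Z z \<Longrightarrow> perm_Z (demR z c)"
  by (simp add: demR_def perm_Z_comp perm_Z_sZ)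
lemma perm_demL: "perm_Z z \<Longrightarrow> perm_Z (demL c z)"
  by (simp add: demL_def perm_Z_comp perm_Z_sZ)
lemma perm_lowR: "perm_Z z \<Longrightarrow> perm_Z (lowR z c)"
  by (simp add: lowR_def perm_Z_comp perm_Z_sZ)

lemma rk_demR: assumes "perm_Z z" shows "rk (demR z c) = Rup c (rk z)"
proof (intro ext)
  fix p q
  have "z c \<noteq> z (c + 1)" using perm_Z_bij[OF assms] by (simp add: bij_def inj_eq)
  then show "rk (demR z c) p q = Rup c (rk z) p q"
    using rk_row[OF assms, of c q] rk_row[OF assms, of "c + 1" q] rk_comp_sZ[OF assms, of p c q]
      rk_comp_sZ_at[OF assms, of c q]
    by (cases "p = c") (auto simp: demR_def Rup_def min_def)
qed

lemma rk_lowR: assumes "perm_Z z" shows "rk (lowR z c) = Rdn c (rk z)"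
proof (intro ext)
  fix p q
  have "z c \<noteq> z (c + 1)" using perm_Z_bij[OF assms] by (simp add: bij_def inj_eq)
  then show "rk (lowR z c) p q = Rdn c (rk z) p q"
    using rk_row[OF assms, of c q] rk_row[OF assms, of "c + 1" q] rk_comp_sZ[OF assms, of p c q]
      rk_comp_sZ_at[OF assms, of c q]
    by (cases "p = c") (auto simp: lowR_def Rdn_def max_def)
qed

lemma inv_neq: "perm_Z z \<Longrightarrow> inv z c \<noteq> inv z (c + 1)"
  using perm_Z_bij[OF perm_Z_inv] by (fastforce simp: bij_def inj_eq)

lemma rk_demL: assumes "perm_Z z" shows "rk (demL c z) = Cup c (rk z)"
proof (intro ext)
  fix p q
  show "rk (demL c z) p q = Cup c (rk z) p q"
    using inv_neq[OF assms, of c] rk_col[OF assms, of p c] rk_col[OF assms, of p "c + 1"] rk_sZ_comp[of q c z p]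
      rk_sZ_comp_at[OF assms, of c p]
    by (cases "q = c") (auto simp: demL_def Cup_def min_def)
qed

lemma rk_lowL: assumes "perm_Z z" shows "rk (lowL c z) = Cdn c (rk z)"
proof (intro ext)
  fix p q
  show "rk (lowL c z) p q = Cdn c (rk z) p q"
    using inv_neq[OF assms, of c] rk_col[OF assms, of p c] rk_col[OF assms, of p "c + 1"] rk_sZ_comp[of q c z p]
      rk_sZ_comp_at[OF assms, of c p]
    by (cases "q = c") (auto simp: lowL_def Cdn_def max_def)
qed

section \<open>Demazure conjugation and its monotonicity\<close>

definition bruhat_le :: "(int \<Rightarrow> int) \<Rightarrow> (int \<Rightarrow> int) \<Rightarrow> bool" where
  "bruhat_le y z \<longleftrightarrow> (\<forall>p q. rk y p q \<le> rk z p q)"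

text \<open>The action of one letter, with the factors in the order used by \<open>demword\<close>.
  On involutions \<open>down\<close> undoes it at an ascent, so words can be peeled off from the
  right.\<close>

definition step :: "(int \<Rightarrow> int) \<Rightarrow> int \<Rightarrow> (int \<Rightarrow> int)" where
  "step z c = demL c (demR z c)"
definition down :: "(int \<Rightarrow> int) \<Rightarrow> int \<Rightarrow> (int \<Rightarrow> int)" where
  "down z c = lowL c (lowR z c)"

lemma rk_step: "perm_Z z \<Longrightarrow> rk (step z c) = Cup c (Rup c (rk z))"
  by (simp add: step_def rk_demL rk_demR perm_demR)
lemma rk_down: "perm_Z z \<Longrightarrow> rk (down z c) = Cdn c (Rdn c (rk z))"
  by (simp add: down_def rk_lowL rk_lowR perm_lowR)
lemma perm_step: "perm_Z z \<Longrightarrow> perm_Z (step z c)"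
  by (simp add: step_def perm_demR perm_demL)

lemma bruhat_trans: "bruhat_le x y \<Longrightarrow> bruhat_le y z \<Longrightarrow> bruhat_le x z"
  unfolding bruhat_le_def by (meson order_trans)

lemma tropical_mono:
  assumes "\<And>p q. f p q \<le> g p q"
  shows "Rup c f p q \<le> Rup c g p q" "Cup c f p q \<le> Cup c g p q"
    "Rdn c f p q \<le> Rdn c g p q" "Cdn c f p q \<le> Cdn c g p q"
  using assms[of p q] assms[of "c - 1" q] assms[of "c + 1" q] assms[of p "c - 1"] assms[of p "c + 1"]
  by (auto simp: Rup_def Cup_def Rdn_def Cdn_def)

lemma step_mono: "perm_Z y \<Longrightarrow> perm_Z z \<Longrightarrow> bruhat_le y z \<Longrightarrow> bruhat_le (step y c) (step z c)"
  unfolding bruhat_le_def by (simp add: rk_step tropical_mono)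

lemma down_mono: "perm_Z y \<Longrightarrow> perm_Z z \<Longrightarrow> bruhat_le y z \<Longrightarrow> bruhat_le (down y c) (down z c)"
  unfolding bruhat_le_def by (simp add: rk_down tropical_mono)

lemma rk_row_bounds: "perm_Z z \<Longrightarrow> rk z (p - 1) q \<le> rk z p q \<and> rk z p q \<le> rk z (p - 1) q + 1"
  using rk_row[of z p q] by auto

lemma rk_col_bounds: "perm_Z z \<Longrightarrow> rk z p q \<le> rk z p (q - 1) \<and> rk z p (q - 1) \<le> rk z p q + 1"
  using rk_col[of z p q] by auto

lemma demR_ge: assumes "perm_Z z" shows "bruhat_le z (demR z c)"
  unfolding bruhat_le_def rk_demR[OF assms] Rup_def
  using rk_row_bounds[OF assms, of c] rk_row_bounds[OF assms, of "c + 1"] by auto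

lemma demL_ge: assumes "perm_Z z" shows "bruhat_le z (demL c z)"
  unfolding bruhat_le_def rk_demL[OF assms] Cup_def
  using rk_col_bounds[OF assms, of _ c] rk_col_bounds[OF assms, of _ "c + 1"] by auto

lemma step_ge: "perm_Z z \<Longrightarrow> bruhat_le z (step z c)"
  unfolding step_def using demR_ge demL_ge perm_demR bruhat_trans by blast

text \<open>Both updates consist of minima and shifts by one, which distribute over each other. Left
  and right multiplications therefore separate on tables.\<close>

lemma Rup_Cup: "Rup c (Cup d f) = Cup d (Rup c f)"
  by (intro ext) (auto simp: Rup_def Cup_def)

lemma Rup_commute: "\<bar>c - d\<bar> \<ge> 2 \<Longrightarrow> Rup c (Rup d f) = Rup d (Rup c f)"
  by (intro ext) (auto simp: Rup_def)

lemma Cup_commute: "\<bar>c - d\<bar> \<ge> 2 \<Longrightarrow> Cup c (Cup d f) = Cup d (Cup c f)"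
  by (intro ext) (auto simp: Cup_def)

text \<open>Both sides put the minimum of row \<open>c - 1\<close> plus 1 and row
  \<open>c + 2\<close> into row \<open>c\<close>, and the minimum of row \<open>c - 1\<close> plus 2
  and row \<open>c + 2\<close> into row \<open>c + 1\<close>. This relies on consecutive rows
  growing by 0 or 1; for arbitrary tables the two sides differ.\<close>

lemma Rup_braid:
  assumes "perm_Z z"
  shows "Rup c (Rup (c + 1) (Rup c (rk z))) = Rup (c + 1) (Rup c (Rup (c + 1) (rk z)))"
proof (intro ext)
  fix p q
  show "Rup c (Rup (c + 1) (Rup c (rk z))) p q = Rup (c + 1) (Rup c (Rup (c + 1) (rk z))) p q"
    using rk_row_bounds[OF assms, of c q] rk_row_bounds[OF assms, of "c + 1" q] rk_row_bounds[OF assms, of "c + 2" q]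
    by (auto simp: Rup_def add.commute)
qed

lemma Cup_braid:
  assumes "perm_Z z"
  shows "Cup c (Cup (c + 1) (Cup c (rk z))) = Cup (c + 1) (Cup c (Cup (c + 1) (rk z)))"
proof (intro ext)
  fix p q
  show "Cup c (Cup (c + 1) (Cup c (rk z))) p q = Cup (c + 1) (Cup c (Cup (c + 1) (rk z))) p q"
    using rk_col_bounds[OF assms, of p c] rk_col_bounds[OF assms, of p "c + 1"] rk_col_bounds[OF assms, of p "c + 2"]
    by (auto simp: Cup_def add.commute)
qed

lemma step_commute:
  assumes "perm_Z z" "\<bar>c - d\<bar> \<ge> 2"
  shows "step (step z c) d = step (step z d) c"
  by (rule rk_inject)
    (use assms in \<open>simp_all add: perm_step rk_step Rup_Cup Rup_commute[of c d] Cup_commute[of c d]\<close>)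

lemma step_braid:
  assumes "perm_Z z"
  shows "step (step (step z c) (c + 1)) c = step (step (step z (c + 1)) c) (c + 1)"
proof (rule rk_inject)
  \<comment> \<open>The row part is realized by an actual permutation, so that its table has the
    unit steps required by the braid identity for columns.\<close>
  let ?y = "demR (demR (demR z c) (c + 1)) c"
  have y: "perm_Z ?y" using assms by (simp add: perm_demR)
  have "rk (step (step (step z c) (c + 1)) c)
      = Cup c (Cup (c + 1) (Cup c (Rup c (Rup (c + 1) (Rup c (rk z))))))"
    using assms by (simp add: perm_step rk_step Rup_Cup)
  also have "\<dots> = Cup c (Cup (c + 1) (Cup c (rk ?y)))"
    using assms by (simp add: rk_demR perm_demR)
  also have "\<dots> = Cup (c + 1) (Cup c (Cup (c + 1) (rk ?y)))" by (rule Cup_braid[OF y])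
  also have "\<dots> = Cup (c + 1) (Cup c (Cup (c + 1) (Rup (c + 1) (Rup c (Rup (c + 1) (rk z))))))"
    using assms by (simp add: rk_demR perm_demR Rup_braid)
  also have "\<dots> = rk (step (step (step z (c + 1)) c) (c + 1))"
    using assms by (simp add: perm_step rk_step Rup_Cup)
  finally show "rk (step (step (step z c) (c + 1)) c) = rk (step (step (step z (c + 1)) c) (c + 1))" .
qed (use assms in \<open>auto simp: perm_step\<close>)

section \<open>The involution weak order\<close>

lemma I_Z_perm: "z \<in> I_Z \<Longrightarrow> perm_Z z"
  by (simp add: I_Z_def)
lemma I_Z_invol: "z \<in> I_Z \<Longrightarrow> z (z x) = x"
  by (simp add: I_Z_def pointfree_idE)
lemma I_Z_I: "perm_Z z \<Longrightarrow> (\<And>x. z (z x) = x) \<Longrightarrow> z \<in> I_Z"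
  by (auto simp: I_Z_def id_apply)
lemma id_I_Z: "id \<in> I_Z"
  by (simp add: I_Z_def perm_Z_id)
lemma I_Z_inv [simp]: assumes "z \<in> I_Z" shows "inv z = z"
  using assms inv_unique_comp by (auto simp: I_Z_def)
lemma I_Z_inj: "z \<in> I_Z \<Longrightarrow> z x = z y \<longleftrightarrow> x = y"
  by (metis I_Z_invol)

lemma step_descent: 
  assumes "z \<in> I_Z" "\<not> z c < z (c + 1)" shows "step z c = z"
  using assms by (simp add: step_def demR_def demL_def)

text \<open>Plain conjugation would return \<open>z\<close>, which commutes with the transposition.
  After the right factor has created the two-cycle, the left factor meets a descent and stays
  idle.\<close>

lemma step_fixed:
  assumes "z \<in> I_Z" "z c = c" "z (c + 1) = c + 1" shows "step z c = z \<circ> sZ c"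
  using assms perm_Z_bij[OF I_Z_perm[OF assms(1)]]
  by (simp add: step_def demR_def demL_def inv_comp_sZ)

lemma step_conj:
  assumes "z \<in> I_Z" "z c < z (c + 1)" "\<not> (z c = c \<and> z (c + 1) = c + 1)"
  shows "step z c = sZ c \<circ> z \<circ> sZ c"
proof -
  \<comment> \<open>A transposition of neighbours reverses the order of no pair of values except
    \<open>c\<close> and \<open>c + 1\<close> themselves.\<close>
  have "sZ c (z c) < sZ c (z (c + 1))"
  proof (rule ccontr)
    assume "\<not> ?thesis"
    then have "z c = c \<and> z (c + 1) = c + 1"
      using assms(2) by (auto simp: sZ_def split: if_splits)
    then show False using assms(3) by blast
  qed
  then show ?thesis
    using assms perm_Z_bij[OF I_Z_perm[OF assms(1)]]
    by (simp add: step_def demR_def demL_def inv_comp_sZ comp_assoc)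
qed

lemma down_ascent: 
  assumes "z \<in> I_Z" "z c < z (c + 1)" shows "down z c = z"
  using assms by (simp add: down_def lowR_def lowL_def)

lemma down_cycle:
  assumes "z \<in> I_Z" "z c = c + 1" shows "down z c = z \<circ> sZ c"
proof -
  have "z (c + 1) = c" using assms by (metis I_Z_invol)
  then show ?thesis
    using assms perm_Z_bij[OF I_Z_perm[OF assms(1)]]
    by (simp add: down_def lowR_def lowL_def inv_comp_sZ)
qed

lemma down_conj:
  assumes "z \<in> I_Z" "\<not> z c < z (c + 1)" "z c \<noteq> c + 1"
  shows "down z c = sZ c \<circ> z \<circ> sZ c"
proof -
  have "z c \<noteq> z (c + 1)" using assms(1) by (simp add: I_Z_inj)
  moreover have "z (c + 1) \<noteq> c" using assms by (metis I_Z_invol)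
  ultimately have "\<not> sZ c (z c) < sZ c (z (c + 1))"
    using assms by (auto simp: sZ_def)
  then show ?thesis
    using assms perm_Z_bij[OF I_Z_perm[OF assms(1)]]
    by (simp add: down_def lowR_def lowL_def inv_comp_sZ comp_assoc)
qed

lemma comp_sZ_fixed_I_Z:
  assumes "z \<in> I_Z" "z c = c \<and> z (c + 1) = c + 1 \<or> z c = c + 1" shows "z \<circ> sZ c \<in> I_Z"
proof (rule I_Z_I)
  show "perm_Z (z \<circ> sZ c)" using assms(1) by (simp add: I_Z_perm perm_Z_comp perm_Z_sZ)
  fix x
  have zz: "z (c + 1) = c" if "z c = c + 1" using assms(1) that by (metis I_Z_invol)
  have "z (sZ c x) = sZ c (z x)"
  proof (cases "x = c \<or> x = c + 1")
    case True
    then show ?thesis using assms(2) zz by auto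
  next
    case False
    then have "z x \<noteq> z c" "z x \<noteq> z (c + 1)" using I_Z_inj[OF assms(1)] by blast+
    then have "z x \<noteq> c" "z x \<noteq> c + 1" using assms(2) zz by auto
    then show ?thesis using False by simp
  qed
  then show "(z \<circ> sZ c) ((z \<circ> sZ c) x) = x"
    by (simp add: I_Z_invol[OF assms(1)])
qed

lemma conj_sZ_I_Z:
  assumes "z \<in> I_Z" shows "sZ c \<circ> z \<circ> sZ c \<in> I_Z"
  by (rule I_Z_I) (use assms in \<open>simp_all add: I_Z_perm perm_Z_comp perm_Z_sZ I_Z_invol[OF assms]\<close>)

lemma step_I_Z: assumes "z \<in> I_Z" shows "step z c \<in> I_Z"
  using assms step_descent[OF assms] step_fixed[OF assms] step_conj[OF assms]
    comp_sZ_fixed_I_Z[OF assms] conj_sZ_I_Z[OF assms] by metis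

lemma down_I_Z: assumes "z \<in> I_Z" shows "down z c \<in> I_Z"
  using assms down_ascent[OF assms] down_cycle[OF assms] down_conj[OF assms]
    comp_sZ_fixed_I_Z[OF assms] conj_sZ_I_Z[OF assms] by metis

lemma step_has_descent:
  assumes "z \<in> I_Z" shows "\<not> step z c c < step z c (c + 1)"
proof (cases "z c < z (c + 1)")
  case asc: True
  show ?thesis
  proof (cases "z c = c \<and> z (c + 1) = c + 1")
    case True
    then show ?thesis using step_fixed[OF assms] by simp
  next
    case False
    then show ?thesis using step_conj[OF assms asc False] asc by (auto simp: sZ_def)
  qed
qed (simp add: step_descent[OF assms])

text \<open>A created two-cycle is removed again and a conjugation is conjugated back. What has to
  be excluded is that a conjugated involution contains the cycle of \<open>c\<close> and
  \<open>c + 1\<close>, since \<open>down\<close> would then take the wrong branch.\<close>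

lemma down_step:
  assumes "z \<in> I_Z" "z c < z (c + 1)" shows "down (step z c) c = z"
proof (cases "z c = c \<and> z (c + 1) = c + 1")
  case True
  then have s: "step z c = z \<circ> sZ c" using step_fixed[OF assms(1)] by simp
  then have "step z c c = c + 1" using True by simp
  then have "down (step z c) c = step z c \<circ> sZ c" by (rule down_cycle[OF step_I_Z[OF assms(1)]])
  then show ?thesis by (simp add: s comp_assoc)
next
  case False
  have s: "step z c = sZ c \<circ> z \<circ> sZ c" by (rule step_conj[OF assms False])
  have "step z c c \<noteq> c + 1"
  proof
    assume "step z c c = c + 1"
    then have "sZ c (z (c + 1)) = c + 1" by (simp add: s)
    then have zc: "z (c + 1) = c" by (auto simp: sZ_def split: if_splits)
    then have "z c = c + 1" using assms(1) by (metis I_Z_invol)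
    then show False using zc assms(2) by simp
  qed
  then have "down (step z c) c = sZ c \<circ> step z c \<circ> sZ c"
    using down_conj[of "step z c" c] step_I_Z[OF assms(1)] step_has_descent[OF assms(1)] by auto
  then show ?thesis by (auto simp: s)
qed

lemma down_has_ascent:
  assumes "z \<in> I_Z" shows "down z c c < down z c (c + 1)"
proof (cases "z c < z (c + 1)")
  case desc: False
  show ?thesis
  proof (cases "z c = c + 1")
    case True
    moreover have "z (c + 1) = c" using assms True by (metis I_Z_invol)
    ultimately show ?thesis using down_cycle[OF assms] by simp
  next
    case False
    have "z c \<noteq> z (c + 1)" using assms by (simp add: I_Z_inj)
    moreover have "z (c + 1) \<noteq> c" using assms False by (metis I_Z_invol)
    ultimately show ?thesis using down_conj[OF assms desc False] desc False by (auto simp: sZ_def)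
  qed
qed (simp add: down_ascent[OF assms])

lemma step_down:
  assumes "z \<in> I_Z" "\<not> z c < z (c + 1)" shows "step (down z c) c = z"
proof (cases "z c = c + 1")
  case True
  have "z (c + 1) = c" using assms True by (metis I_Z_invol)
  moreover have d: "down z c = z \<circ> sZ c" by (rule down_cycle[OF assms(1) True])
  ultimately have "step (down z c) c = down z c \<circ> sZ c"
    using step_fixed[OF down_I_Z[OF assms(1)], of c c] True by simp
  then show ?thesis by (simp add: d comp_assoc)
next
  case False
  have d: "down z c = sZ c \<circ> z \<circ> sZ c" by (rule down_conj[OF assms False])
  have "z (c + 1) \<noteq> z c" using assms by (simp add: I_Z_inj)
  then have "\<not> (down z c c = c \<and> down z c (c + 1) = c + 1)"
    using d assms by (auto simp: sZ_def split: if_splits)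
  then have "step (down z c) c = sZ c \<circ> down z c \<circ> sZ c"
    using step_conj[of "down z c" c] down_I_Z[OF assms(1)] down_has_ascent[OF assms(1)] by auto
  then show ?thesis by (auto simp: d)
qed

section \<open>Inversions and the length of the involution weak order\<close>

definition inversions :: "(int \<Rightarrow> int) \<Rightarrow> (int \<times> int) set" where
  "inversions z = {(i, j). i < j \<and> z j < z i}"

text \<open>An inversion contains a moved point. If only one of its entries moves, the other is
  confined between that point and its image.\<close>

lemma finite_inversions:
  assumes "perm_Z z" shows "finite (inversions z)"
proof -
  let ?S = "{x. z x \<noteq> x}"
  have fin: "finite ?S" using assms by (simp add: perm_Z_def)
  have "inversions z \<subseteq> (?S \<times> ?S) \<union> (\<Union>i\<in>?S. {i} \<times> {i..z i}) \<union> (\<Union>j\<in>?S. {z j..j} \<times> {j})"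
    unfolding inversions_def by auto
  moreover have "finite \<dots>" using fin by auto
  ultimately show ?thesis by (rule finite_subset)
qed

text \<open>Applying the transposition to both entries matches the old inversions with the new ones
  other than \<open>(c, c + 1)\<close>, because it reverses the order of no other pair.\<close>

lemma card_inversions_comp_sZ:
  assumes "perm_Z z" "z c < z (c + 1)"
  shows "card (inversions (z \<circ> sZ c)) = card (inversions z) + 1"
proof -
  let ?f = "map_prod (sZ c) (sZ c)"
  have "inversions (z \<circ> sZ c) = insert (c, c + 1) (?f ` inversions z)"
  proof (intro set_eqI iffI)
    fix ij assume "ij \<in> inversions (z \<circ> sZ c)"
    then obtain i j where ij: "ij = (i, j)" "i < j" "z (sZ c j) < z (sZ c i)" by (auto simp: inversions_def)
    show "ij \<in> insert (c, c + 1) (?f ` inversions z)"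
    proof (cases "i = c \<and> j = c + 1")
      case False
      then have "sZ c i < sZ c j" using ij(2) by (auto simp: sZ_def)
      then have "(sZ c i, sZ c j) \<in> inversions z" using ij(3) by (simp add: inversions_def)
      then have "?f (sZ c i, sZ c j) \<in> ?f ` inversions z" by (rule imageI)
      then show ?thesis by (simp add: ij)
    qed (simp add: ij)
  next
    fix ij assume "ij \<in> insert (c, c + 1) (?f ` inversions z)"
    then consider "ij = (c, c + 1)" | i j where "ij = (sZ c i, sZ c j)" "i < j" "z j < z i"
      by (auto simp: inversions_def)
    then show "ij \<in> inversions (z \<circ> sZ c)"
    proof cases
      case 2
      then have "\<not> (i = c \<and> j = c + 1)" using assms(2) by auto
      then have "sZ c i < sZ c j" using 2(2) by (auto simp: sZ_def)
      then show ?thesis using 2 by (simp add: inversions_def)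
    qed (use assms(2) in \<open>simp add: inversions_def\<close>)
  qed
  moreover have "(c, c + 1) \<notin> ?f ` inversions z"
  proof
    assume "(c, c + 1) \<in> ?f ` inversions z"
    then obtain i j where "c = sZ c i" "c + 1 = sZ c j" "i < j" by (auto simp: inversions_def)
    then show False by (auto simp: sZ_def split: if_splits)
  qed
  moreover have "inj_on ?f (inversions z)"
    by (rule inj_on_inverseI[where g = ?f]) auto
  ultimately show ?thesis
    using finite_inversions[OF assms(1)] by (simp add: card_image)
qed

lemma card_inversions_inv:
  assumes "bij z" shows "card (inversions (inv z)) = card (inversions z)"
proof -
  have "bij_betw (\<lambda>(i, j). (z j, z i)) (inversions z) (inversions (inv z))"
    by (rule bij_betw_byWitness[where f' = "\<lambda>(i, j). (inv z j, inv z i)"])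
      (use assms in \<open>auto simp: inversions_def bij_def surj_f_inv_f\<close>)
  then show ?thesis by (simp add: bij_betw_same_card)
qed

text \<open>Four times the length function of the involution weak order.\<close>

definition H :: "(int \<Rightarrow> int) \<Rightarrow> nat" where
  "H z = 2 * card (inversions z) + card {x. z x \<noteq> x}"

lemma H_id [simp]: "H id = 0"
proof -
  have "inversions id = {}" by (auto simp: inversions_def id_apply)
  then show ?thesis by (simp add: H_def id_apply)
qed

text \<open>The weights in \<open>H\<close> balance the two cases: a new two-cycle brings one
  inversion and two moved points, a conjugation brings two inversions and keeps the number of moved
  points.\<close>

lemma H_step:
  assumes "z \<in> I_Z" "z c < z (c + 1)" shows "H (step z c) = H z + 4"
proof (cases "z c = c \<and> z (c + 1) = c + 1")
  case True
  have fin: "finite {x. z x \<noteq> x}" using assms(1) by (simp add: I_Z_def perm_Z_def)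
  have s: "step z c = z \<circ> sZ c" using True step_fixed assms(1) by blast
  have "{x. step z c x \<noteq> x} = insert c (insert (c + 1) {x. z x \<noteq> x})"
  proof (rule set_eqI)
    fix x show "x \<in> {x. step z c x \<noteq> x} \<longleftrightarrow> x \<in> insert c (insert (c + 1) {x. z x \<noteq> x})"
      using True s by (cases "x = c"; cases "x = c + 1") auto
  qed
  then have "card {x. step z c x \<noteq> x} = card {x. z x \<noteq> x} + 2"
    using True fin by simp
  then show ?thesis using card_inversions_comp_sZ[OF I_Z_perm[OF assms(1)] assms(2)] s
    by (simp add: H_def)
next
  case False
  let ?y = "z \<circ> sZ c"
  have s: "step z c = sZ c \<circ> ?y" using step_conj[OF assms False] by (simp add: comp_assoc)
  have py: "perm_Z ?y" using assms(1) by (simp add: I_Z_perm perm_Z_comp perm_Z_sZ)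
  have iy: "inv ?y = sZ c \<circ> z"
    using inv_comp_sZ[OF perm_Z_bij[OF I_Z_perm[OF assms(1)]], of c] assms(1) by simp
  have "sZ c (z c) < sZ c (z (c + 1))"
  proof (rule ccontr)
    assume "\<not> ?thesis"
    then have "z c = c \<and> z (c + 1) = c + 1"
      using assms(2) by (auto simp: sZ_def split: if_splits)
    then show False using False by blast
  qed
  then have "card (inversions (inv ?y \<circ> sZ c)) = card (inversions (inv ?y)) + 1"
    using card_inversions_comp_sZ[OF perm_Z_inv[OF py], of c] by (simp add: iy)
  moreover have "inv ?y \<circ> sZ c = step z c" using s by (simp add: iy comp_assoc)
  ultimately have 1: "card (inversions (step z c)) = card (inversions z) + 2"
    using card_inversions_inv[OF perm_Z_bij[OF py]]
      card_inversions_comp_sZ[OF I_Z_perm[OF assms(1)] assms(2)] by simp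
  have eq: "step z c x = sZ c (z (sZ c x))" for x using s by simp
  have "bij_betw (sZ c) {x. step z c x \<noteq> x} {x. z x \<noteq> x}"
    by (rule bij_betw_byWitness[where f' = "sZ c"]) (auto simp: eq, (metis sZ_simps(3))+)
  then have "card {x. step z c x \<noteq> x} = card {x. z x \<noteq> x}" by (rule bij_betw_same_card)
  then show ?thesis using 1 by (simp add: H_def)
qed

lemma H_down:
  assumes "z \<in> I_Z" "\<not> z c < z (c + 1)" shows "H z = H (down z c) + 4"
  using H_step[OF down_I_Z[OF assms(1)] down_has_ascent[OF assms(1)]] step_down[OF assms] by metis

text \<open>A strictly increasing map of the integers grows at least as fast as its argument. Fixed
  points far to the left and far to the right then squeeze every value.\<close>

lemma no_descent_imp_id:
  assumes "perm_Z z" "\<And>c. z c < z (c + 1)" shows "z = id"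
proof
  fix x
  let ?S = "{x. z x \<noteq> x}"
  have fin: "finite ?S" using assms(1) by (simp add: perm_Z_def)
  have up: "z a + int k \<le> z (a + int k)" for a k
  proof (induction k)
    case (Suc k)
    then show ?case using assms(2)[of "a + int k"] by (simp add: algebra_simps)
  qed simp
  obtain B where B: "\<And>x. x \<in> ?S \<Longrightarrow> \<bar>x\<bar> < B"
  proof -
    have "finite (abs ` ?S)" using fin by simp
    then have "\<forall>y\<in>abs ` ?S. y < Max (abs ` ?S) + 1" by (metis Max_ge zle_add1_eq_le)
    then show ?thesis using that by blast
  qed
  have hi: "z (\<bar>B\<bar> + \<bar>x\<bar>) = \<bar>B\<bar> + \<bar>x\<bar>" using B[of "\<bar>B\<bar> + \<bar>x\<bar>"] by force
  have lo: "z (- \<bar>B\<bar> - \<bar>x\<bar>) = - \<bar>B\<bar> - \<bar>x\<bar>" using B[of "- \<bar>B\<bar> - \<bar>x\<bar>"] by force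
  have "int (nat (\<bar>B\<bar> + \<bar>x\<bar> - x)) = \<bar>B\<bar> + \<bar>x\<bar> - x" by linarith
  then have "z x \<le> x" using up[of x "nat (\<bar>B\<bar> + \<bar>x\<bar> - x)"] hi by simp
  moreover have "int (nat (x + \<bar>B\<bar> + \<bar>x\<bar>)) = x + \<bar>B\<bar> + \<bar>x\<bar>" by linarith
  then have "x \<le> z x" using up[of "- \<bar>B\<bar> - \<bar>x\<bar>" "nat (x + \<bar>B\<bar> + \<bar>x\<bar>)"] lo by simp
  ultimately show "z x = id x" by (simp add: id_apply)
qed

lemma rk_pos_iff:
  assumes "perm_Z z" shows "rk z p q \<ge> 1 \<longleftrightarrow> (\<exists>x\<le>p. q < z x)"
proof -
  have "rk z p q \<ge> 1 \<longleftrightarrow> card {x. x \<le> p \<and> q < z x} \<noteq> 0" unfolding rk_def by linarith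
  also have "\<dots> \<longleftrightarrow> {x. x \<le> p \<and> q < z x} \<noteq> {}" using finite_rk[OF assms, of p q] by simp
  finally show ?thesis by auto
qed

text \<open>A point raised by \<open>y\<close> produces a positive diagonal entry, so nothing is
  raised; an involution that raises nothing lowers nothing either.\<close>

lemma bruhat_le_id:
  assumes "y \<in> I_Z" "bruhat_le y id" shows "y = id"
proof
  fix x
  have le: "y x \<le> x" for x
  proof (rule ccontr)
    assume "\<not> y x \<le> x"
    then have "rk y x x \<ge> 1" using rk_pos_iff[OF I_Z_perm[OF assms(1)]] by force
    then have "rk id x x \<ge> 1" using assms(2) unfolding bruhat_le_def by (meson order_trans)
    then show False using rk_pos_iff[OF perm_Z_id] by (auto simp: id_apply)
  qed
  then show "y x = id x" using le[of "y x"] I_Z_invol[OF assms(1)] by (simp add: order_antisym id_apply)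
qed

text \<open>Apply \<open>down\<close> to both elements at a descent of the larger one. This costs
  the larger element exactly 4 and the smaller one 0 or 4, and in the latter case
  \<open>step\<close> restores an equality obtained by induction.\<close>

lemma bruhat_H:
  assumes "y \<in> I_Z" "z \<in> I_Z" "bruhat_le y z"
  shows "H y \<le> H z \<and> (H y = H z \<longrightarrow> y = z)"
  using assms
proof (induction "H z" arbitrary: y z rule: less_induct)
  case less
  show ?case
  proof (cases "\<exists>c. \<not> z c < z (c + 1)")
    case False
    then have "z = id" using no_descent_imp_id I_Z_perm less.prems(2) by blast
    moreover have "y = id" using bruhat_le_id less.prems \<open>z = id\<close> by blast
    ultimately show ?thesis by blast
  next
    case True
    then obtain c where c: "\<not> z c < z (c + 1)" by blast
    have Hz: "H z = H (down z c) + 4" by (rule H_down[OF less.prems(2) c])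
    have "bruhat_le (down y c) (down z c)" using down_mono I_Z_perm less.prems by blast
    then have IH: "H (down y c) \<le> H (down z c) \<and> (H (down y c) = H (down z c) \<longrightarrow> down y c = down z c)"
      using less.hyps[of "down z c" "down y c"] Hz down_I_Z less.prems by simp
    show ?thesis
    proof (cases "y c < y (c + 1)")
      case True
      then show ?thesis using IH Hz down_ascent[OF less.prems(1)] by auto
    next
      case False
      have "y = z" if "down y c = down z c"
        using that step_down[OF less.prems(1) False] step_down[OF less.prems(2) c] by metis
      then show ?thesis using IH Hz H_down[OF less.prems(1) False] by linarith
    qed
  qed
qed

section \<open>Involution words\<close>

definition act :: "(int \<Rightarrow> int) \<Rightarrow> int list \<Rightarrow> (int \<Rightarrow> int)" where
  "act z w = fold (\<lambda>a \<sigma>. step \<sigma> a) w z"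

lemma act_simps [simp]: "act z [] = z" "act z (a # w) = act (step z a) w"
  "act z (u @ v) = act (act z u) v"
  by (simp_all add: act_def id_apply)

lemma demword_act: "demword w = act id w"
  by (simp add: demword_def act_def step_def)

lemma act_I_Z: "z \<in> I_Z \<Longrightarrow> act z w \<in> I_Z"
  by (induction w arbitrary: z) (auto simp: step_I_Z)

lemma demword_I_Z: "demword w \<in> I_Z"
  by (simp add: demword_act act_I_Z id_I_Z)

text \<open>A local substitute for the minimality over all words in \<open>inv_word\<close>: every
  letter must be an ascent of the involution built so far.\<close>

primrec ascending :: "(int \<Rightarrow> int) \<Rightarrow> int list \<Rightarrow> bool" where
  "ascending z [] = True"
| "ascending z (a # w) = (z a < z (a + 1) \<and> ascending (step z a) w)"

lemma ascending_append [simp]: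
  "ascending z (u @ v) \<longleftrightarrow> ascending z u \<and> ascending (act z u) v"
  by (induction u arbitrary: z) auto

lemma H_act:
  assumes "z \<in> I_Z"
  shows "H (act z w) \<le> H z + 4 * length w \<and> (ascending z w \<longleftrightarrow> H (act z w) = H z + 4 * length w)"
  using assms
proof (induction w arbitrary: z)
  case (Cons a w)
  show ?case
  proof (cases "z a < z (a + 1)")
    case True
    then show ?thesis using Cons.IH[OF step_I_Z[OF Cons.prems], of a] H_step[OF Cons.prems True] by auto
  next
    case False
    then show ?thesis using Cons.IH[OF Cons.prems] step_descent[OF Cons.prems False] by auto
  qed
qed simp

lemma not_ascending_shorten:
  assumes "z \<in> I_Z" "\<not> ascending z w"
  shows "\<exists>v. length v < length w \<and> act z v = act z w"
  using assms
proof (induction w arbitrary: z)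
  case (Cons a w)
  show ?case
  proof (cases "z a < z (a + 1)")
    case True
    then obtain v where "length v < length w" "act (step z a) v = act (step z a) w"
      using Cons.IH[OF step_I_Z[OF Cons.prems(1)], of a] Cons.prems by auto
    then show ?thesis by (intro exI[of _ "a # v"]) simp
  next
    case False
    then show ?thesis using step_descent[OF Cons.prems(1) False] by (intro exI[of _ w]) simp
  qed
qed simp

lemma inv_word_iff_ascending: "inv_word w \<pi> \<longleftrightarrow> demword w = \<pi> \<and> ascending id w"
proof (intro iffI conjI)
  assume *: "demword w = \<pi> \<and> ascending id w"
  have "length w \<le> length v" if "demword v = \<pi>" for v
    using H_act[OF id_I_Z, of w] H_act[OF id_I_Z, of v] * that by (auto simp: demword_act)
  then show "inv_word w \<pi>" using * by (simp add: inv_word_def)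
next
  assume *: "inv_word w \<pi>"
  then show "demword w = \<pi>" by (simp add: inv_word_def)
  show "ascending id w"
  proof (rule ccontr)
    assume "\<not> ?thesis"
    then obtain v where "length v < length w" "demword v = demword w"
      using not_ascending_shorten[OF id_I_Z] by (metis demword_act)
    then show False using * unfolding inv_word_def by force
  qed
qed

text \<open>A purely numerical criterion: reducedness depends only on the length of the word and on
  its involution, so it passes along any relation preserving both.\<close>

lemma inv_word_iff_H: "inv_word w \<pi> \<longleftrightarrow> demword w = \<pi> \<and> H \<pi> = 4 * length w"
  using H_act[OF id_I_Z, of w] by (auto simp: inv_word_iff_ascending demword_act)

lemma inv_reduced_iff_ascending: "inv_reduced w \<longleftrightarrow> ascending id w"
  by (simp add: inv_reduced_def inv_word_iff_ascending)

lemma inv_reduced_iff_H: "inv_reduced w \<longleftrightarrow> H (demword w) = 4 * length w"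
  by (simp add: inv_reduced_def inv_word_iff_H)

section \<open>Marked words and the exchange property\<close>

lemma length_del_at [simp]: "i < length w \<Longrightarrow> length (del_at w i) = length w - 1"
  by (simp add: del_at_def)

lemma marked_iff_H:
  "marked \<pi> w i \<longleftrightarrow> i < length w \<and> demword (del_at w i) = \<pi> \<and> H \<pi> + 4 = 4 * length w"
  by (auto simp: marked_def inv_word_iff_H)

lemma marked_iff_ascending:
  "marked \<pi> w i \<longleftrightarrow> i < length w \<and> demword (del_at w i) = \<pi> \<and> ascending id (del_at w i)"
  by (auto simp: marked_def inv_word_iff_ascending)

lemma del_at_append [simp]:
  "i < length u \<Longrightarrow> del_at (u @ v) i = del_at u i @ v"
  "\<not> i < length u \<Longrightarrow> del_at (u @ v) i = u @ del_at v (i - length u)"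
  by (auto simp: del_at_def Suc_diff_le)

lemma del_at_Cons [simp]: "del_at (a # u) 0 = u" "del_at (a # u) (Suc i) = a # del_at u i"
  by (auto simp: del_at_def)

lemma act_mono:
  assumes "y \<in> I_Z" "z \<in> I_Z" "bruhat_le y z" shows "bruhat_le (act y w) (act z w)"
  using assms by (induction w arbitrary: y z) (auto simp: step_mono step_I_Z I_Z_perm)

lemma act_del_le:
  assumes "i < length w" shows "bruhat_le (demword (del_at w i)) (demword w)"
proof -
  have w: "w = take i w @ w ! i # drop (Suc i) w" using assms by (rule id_take_nth_drop)
  let ?z = "act id (take i w)"
  have z: "?z \<in> I_Z" by (simp add: act_I_Z id_I_Z)
  have "bruhat_le (act ?z (drop (Suc i) w)) (act (step ?z (w ! i)) (drop (Suc i) w))"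
    using act_mono[OF z step_I_Z[OF z] step_ge[OF I_Z_perm[OF z]]] .
  then show ?thesis by (subst (2) w) (simp add: demword_act del_at_def)
qed

text \<open>Peel off the last letter \<open>c\<close>. If \<open>x\<close> has an ascent at
  \<open>c\<close>, it lies below the product of the prefix and has the same length, so deleting
  \<open>c\<close> gives it. Otherwise induction treats \<open>down x c\<close>, and reading
  \<open>c\<close> restores \<open>x\<close>.\<close>

lemma exchange:
  assumes "ascending id w" "x \<in> I_Z" "bruhat_le x (demword w)" "H x + 4 = H (demword w)"
  shows "\<exists>k<length w. demword (del_at w k) = x"
  using assms
proof (induction w arbitrary: x rule: rev_induct)
  case (snoc c w)
  let ?y = "demword w"
  have y: "?y \<in> I_Z" "demword (w @ [c]) = step ?y c" by (rule demword_I_Z) (simp add: demword_act)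
  have asc: "ascending id w" "?y c < ?y (c + 1)" using snoc.prems(1) by (simp_all add: demword_act)
  have le: "bruhat_le (down x c) ?y"
    using down_mono[OF I_Z_perm[OF snoc.prems(2)] I_Z_perm[OF demword_I_Z] snoc.prems(3), of c]
      down_step[OF y(1) asc(2)] y(2) by simp
  have Hy: "H (demword (w @ [c])) = H ?y + 4" using H_step[OF y(1) asc(2)] y(2) by simp
  show ?case
  proof (cases "x c < x (c + 1)")
    case True
    then have "x = ?y" using bruhat_H[OF snoc.prems(2) y(1)] le down_ascent[OF snoc.prems(2) True] Hy snoc.prems(4)
      by simp
    then show ?thesis by (intro exI[of _ "length w"]) simp
  next
    case False
    then obtain k where k: "k < length w" "demword (del_at w k) = down x c"
      using snoc.IH[OF asc(1) down_I_Z[OF snoc.prems(2)] le] H_down[OF snoc.prems(2) False] Hy snoc.prems(4) by auto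
    then have "demword (del_at (w @ [c]) k) = x"
      using step_down[OF snoc.prems(2) False] by (simp add: demword_act)
    then show ?thesis using k(1) by (intro exI[of _ k]) simp
  qed
qed (simp add: demword_act)

lemma act_cancel:
  assumes "y \<in> I_Z" "z \<in> I_Z" "ascending y w" "ascending z w" "act y w = act z w" shows "y = z"
  using assms
proof (induction w arbitrary: y z)
  case (Cons a w)
  then have "step y a = step z a" by (metis act_simps(2) ascending.simps(2) step_I_Z)
  then show ?case using Cons.prems down_step by (metis ascending.simps(2))
qed simp

text \<open>Cancelling the tail \<open>C\<close> shows that \<open>A @ B @ [y]\<close> and
  \<open>A @ x # B\<close> have the same product. The first form exhibits a descent at
  \<open>y\<close>, so \<open>y\<close> cannot be an ascending continuation of the second.\<close>

lemma double_deletion_False: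
  assumes "ascending id (A @ x # B @ [y])" "ascending id (A @ B @ y # C)" "ascending id (A @ x # B @ C)"
    "demword (A @ B @ y # C) = demword (A @ x # B @ C)"
  shows False
proof -
  have "act id (A @ B @ [y]) = act id (A @ x # B)"
    by (rule act_cancel[where w = C]) (use assms in \<open>simp_all add: demword_act act_I_Z id_I_Z step_I_Z\<close>)
  moreover have "\<not> act id (A @ B @ [y]) y < act id (A @ B @ [y]) (y + 1)"
    by (simp add: step_has_descent act_I_Z id_I_Z)
  ultimately show False using assms(1) by simp
qed

text \<open>Reducedness is only required up to the later mark, because the search for the second
  mark applies this to words that fail to be reduced further to the right.\<close>

lemma marked_unique_before:
  assumes "marked \<pi> w i" "marked \<pi> w j" "ascending id (take (Suc j) w)" "i < j" shows False
proof -
  have j: "j < length w" using assms(2) by (simp add: marked_def)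
  define A where "A = take i w"
  define B where "B = drop (Suc i) (take j w)"
  have tj: "take j w = A @ w ! i # B"
    using id_take_nth_drop[of i "take j w"] assms(4) j by (simp add: A_def B_def min_def)
  have w: "w = (A @ w ! i # B) @ w ! j # drop (Suc j) w" using id_take_nth_drop[OF j] tj by simp
  have lA: "length A = i" using assms(4) j by (simp add: A_def)
  have lB: "length (A @ w ! i # B) = j" using tj j by (metis length_take min.absorb4)
  have tS: "take (Suc j) w = A @ w ! i # B @ [w ! j]" using tj j by (simp add: take_Suc_conv_app_nth)
  have di: "del_at w i = A @ B @ w ! j # drop (Suc j) w" by (subst w) (simp add: lA)
  have dj: "del_at w j = A @ w ! i # B @ drop (Suc j) w" 
    using tj by (simp add: del_at_def)
  show False
    by (rule double_deletion_False[of A "w ! i" B "w ! j" "drop (Suc j) w"])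
      (use assms di dj tS in \<open>simp_all add: marked_iff_ascending\<close>)
qed

lemma marked_unique:
  assumes "marked \<pi> w i" "marked \<pi> w j" "inv_reduced w" shows "i = j"
proof -
  have "ascending id (take k w)" for k
    using assms(3) ascending_append[of id "take k w" "drop k w"] by (simp add: inv_reduced_iff_ascending)
  then show ?thesis using marked_unique_before assms by (metis linorder_neq_iff)
qed

lemma not_ascending_split:
  assumes "\<not> ascending z w"
  shows "\<exists>P a Q. w = P @ a # Q \<and> ascending z P \<and> \<not> act z P a < act z P (a + 1)"
  using assms
proof (induction w arbitrary: z)
  case (Cons a w)
  show ?case
  proof (cases "z a < z (a + 1)")
    case True
    then obtain P b Q where "w = P @ b # Q" "ascending (step z a) P"
      "\<not> act (step z a) P b < act (step z a) P (b + 1)" using Cons.IH[of "step z a"] Cons.prems by auto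
    then show ?thesis using True by (intro exI[of _ "a # P"] exI[of _ b] exI[of _ Q]) simp
  next
    case False
    then show ?thesis by (intro exI[of _ "[]"] exI[of _ a] exI[of _ w]) simp
  qed
qed simp

text \<open>The letter at which a marked word first fails to be reduced is always marked; exchange supplies
  the second marked position, which lies before it.\<close>

lemma partner_ex1:
  assumes m: "marked \<pi> w i" and nr: "\<not> inv_reduced w"
  shows "\<exists>!j. j \<noteq> i \<and> marked \<pi> w j"
proof -
  obtain P a Q where w: "w = P @ a # Q" and P: "ascending id P"
    and d: "\<not> act id P a < act id P (a + 1)"
    using nr not_ascending_split unfolding inv_reduced_iff_ascending by blast
  let ?y = "act id P"
  have y: "?y \<in> I_Z" by (simp add: act_I_Z id_I_Z)
  \<comment> \<open>Deleting a letter to the right of the failure would leave the failing prefix in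
    place.\<close>
  have le: "k \<le> length P" if "marked \<pi> w k" for k
  proof (rule ccontr)
    assume "\<not> k \<le> length P"
    then obtain l where "k = Suc (length P + l)" by (metis less_imp_Suc_add not_le)
    then have "del_at w k = P @ a # del_at Q l" by (simp add: w)
    then show False using that d by (simp add: marked_iff_ascending)
  qed
  have before: "k = l" if "marked \<pi> w k" "marked \<pi> w l" "k < length P" "l < length P" for k l
  proof -
    have "ascending id (take (Suc m) w)" if "m < length P" for m
      using P ascending_append[of id "take (Suc m) P" "drop (Suc m) P"] that by (simp add: w)
    then show ?thesis using marked_unique_before that by (metis linorder_neq_iff)
  qed
  have at: "marked \<pi> w (length P)"
  proof (cases "i = length P")
    case False
    then have i: "i < length P" using le[OF m] by simp
    let ?x = "act id (del_at P i)"
    have di: "del_at w i = del_at P i @ a # Q" using i by (simp add: w)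
    then have asc: "ascending id (del_at P i @ [a])" using m by (simp add: marked_iff_ascending)
    have "bruhat_le (step ?x a) (step ?y a)"
      using act_del_le[OF i] by (intro step_mono) (simp_all add: demword_act I_Z_perm act_I_Z id_I_Z)
    moreover have "H (step ?x a) = H ?y"
      using H_act[OF id_I_Z, of "del_at P i @ [a]"] asc H_act[OF id_I_Z, of P] P i by simp
    \<comment> \<open>Comparable elements of equal length coincide, so the failing letter may be
      deleted in place of the letter at \<open>i\<close>.\<close>
    ultimately have "step ?x a = ?y"
      using bruhat_H[OF step_I_Z y, of ?x a] step_descent[OF y d] act_I_Z[OF id_I_Z] by metis
    then show ?thesis using m di by (simp add: marked_iff_H w demword_act)
  qed (use m in simp)
  have "\<exists>k<length P. marked \<pi> w k"
  proof -
    have "down ?y a \<in> I_Z" "bruhat_le (down ?y a) (demword P)" "H (down ?y a) + 4 = H (demword P)"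
      using y H_down[OF y d] step_ge[OF I_Z_perm[OF down_I_Z[OF y]], of a a] step_down[OF y d]
      by (simp_all add: down_I_Z demword_act)
    then obtain k where k: "k < length P" "act id (del_at P k) = down ?y a"
      using exchange[OF P] by (auto simp: demword_act)
    then have "demword (del_at w k) = \<pi>"
      using at step_down[OF y d] by (simp add: marked_iff_H demword_act w)
    then show ?thesis using k(1) at by (auto simp: marked_iff_H w)
  qed
  then obtain k where k: "k < length P" "marked \<pi> w k" by blast
  show ?thesis
  proof (cases "i = length P")
    case True
    then show ?thesis using k before le by (intro ex1I[of _ k]) (auto simp: le_less)
  next
    case False
    then have "i < length P" using le[OF m] by simp
    then show ?thesis using m before le at
      by (intro ex1I[of _ "length P"]) (auto simp: le_less)
  qed
qed

text \<open>If no point up to \<open>c\<close> were sent beyond \<open>c\<close>, the involution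
  would preserve both sides of this cut and have an ascent at \<open>c\<close>. Reading
  \<open>c\<close> produces a descent there, and later letters only increase the table. The letters
  of all reduced words for one involution thus lie in the finite set of its positive diagonal
  entries.\<close>

lemma letter_rk:
  assumes "ascending id w" "c \<in> set w" shows "rk (demword w) c c \<ge> 1"
proof -
  obtain A B where w: "w = A @ c # B" using assms(2) by (meson split_list)
  let ?z = "step (act id A) c"
  have z: "?z \<in> I_Z" by (simp add: step_I_Z act_I_Z id_I_Z)
  have d: "\<not> ?z c < ?z (c + 1)" by (simp add: step_has_descent act_I_Z id_I_Z)
  have "rk ?z c c \<ge> 1"
  proof (rule ccontr)
    assume "\<not> ?thesis"
    then have "?z x \<le> c" if "x \<le> c" for x
      using rk_pos_iff[OF I_Z_perm[OF z], of c c] that by force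
    then have "?z c \<le> c" "\<not> ?z (c + 1) \<le> c" using I_Z_invol[OF z, of "c + 1"] by force+
    then show False using d by linarith
  qed
  moreover have le: "bruhat_le ?z (act ?z B)" for B
  proof (induction B rule: rev_induct)
    case Nil
    then show ?case by (simp add: bruhat_le_def)
  next
    case (snoc b B)
    show ?case using bruhat_trans[OF snoc step_ge[OF I_Z_perm[OF act_I_Z[OF z]]]] by simp
  qed
  ultimately have "1 \<le> rk (act ?z B) c c" unfolding bruhat_le_def by (meson order_trans)
  then show ?thesis by (simp add: w demword_act)
qed

lemma finite_rk_diag: assumes "perm_Z z" shows "finite {c. rk z c c \<ge> 1}"
proof -
  have "{c. rk z c c \<ge> 1} \<subseteq> (\<Union>x\<in>{x. z x \<noteq> x}. {x..z x})"
  proof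
    fix c assume "c \<in> {c. rk z c c \<ge> 1}"
    then obtain x where "x \<le> c" "c < z x" using rk_pos_iff[OF assms, of c c] by auto
    then have "z x \<noteq> x" "c \<in> {x..z x}" by auto
    then show "c \<in> (\<Union>x\<in>{x. z x \<noteq> x}. {x..z x})" by blast
  qed
  moreover have "finite (\<Union>x\<in>{x. z x \<noteq> x}. {x..z x})" using assms by (simp add: perm_Z_def)
  ultimately show ?thesis by (rule finite_subset)
qed

section \<open>Involution Little bumps\<close>

declare id_apply [simp]

section \<open>Pushes as a bijection on marked words\<close>

definition push_pos :: "(int \<Rightarrow> int) \<Rightarrow> int list \<Rightarrow> nat \<Rightarrow> nat" where
  "push_pos \<pi> w i = (if inv_reduced w then i else (THE j. j \<noteq> i \<and> marked \<pi> w j))"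

lemma ipush_eq: "ipush \<pi> (w, i) = (w[push_pos \<pi> w i := w ! push_pos \<pi> w i + 1], push_pos \<pi> w i)"
  by (simp add: ipush_def push_pos_def Let_def)

lemma push_pos_reduced: "inv_reduced w \<Longrightarrow> push_pos \<pi> w i = i"
  by (simp add: push_pos_def)

lemma push_pos_nonreduced:
  assumes "marked \<pi> w i" "\<not> inv_reduced w"
  shows "push_pos \<pi> w i \<noteq> i \<and> marked \<pi> w (push_pos \<pi> w i)"
  unfolding push_pos_def using theI'[OF partner_ex1[OF assms]] assms(2) by simp

lemma push_pos_eqI:
  assumes "marked \<pi> w i" "marked \<pi> w j" "j \<noteq> i" shows "push_pos \<pi> w i = j"
proof -
  have nr: "\<not> inv_reduced w" using marked_unique assms by blast
  show ?thesis using partner_ex1[OF assms(1) nr] push_pos_nonreduced[OF assms(1) nr] assms by blast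
qed

lemma push_pos_marked: "marked \<pi> w i \<Longrightarrow> marked \<pi> w (push_pos \<pi> w i)"
  by (metis push_pos_nonreduced push_pos_reduced)

lemma push_pos_invol: "marked \<pi> w i \<Longrightarrow> push_pos \<pi> w (push_pos \<pi> w i) = i"
  by (metis push_pos_eqI push_pos_nonreduced push_pos_reduced)

lemma del_at_update [simp]: "del_at (w[j := x]) j = del_at w j"
  by (simp add: del_at_def)

lemma marked_update [simp]: "marked \<pi> (w[j := x]) j \<longleftrightarrow> marked \<pi> w j"
  by (simp add: marked_def)

lemma marked_length: "marked \<pi> w i \<Longrightarrow> i < length w"
  by (simp add: marked_def)

definition is_marked :: "(int \<Rightarrow> int) \<Rightarrow> int list \<times> nat \<Rightarrow> bool" where
  "is_marked \<pi> P = marked \<pi> (fst P) (snd P)"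
definition is_reduced :: "int list \<times> nat \<Rightarrow> bool" where
  "is_reduced P = inv_reduced (fst P)"

lemma is_marked_ipush: "is_marked \<pi> P \<Longrightarrow> is_marked \<pi> (ipush \<pi> P)"
  by (cases P) (simp add: is_marked_def ipush_eq push_pos_marked)

lemma is_marked_ipush_pow: "is_marked \<pi> P \<Longrightarrow> is_marked \<pi> ((ipush \<pi> ^^ k) P)"
  by (induction k) (auto simp: is_marked_ipush)

text \<open>A push is the involution that switches the mark, followed by raising the letter now
  marked. Being marked does not depend on the value of that letter, so both factors are invertible
  on marked words.\<close>

lemma ipush_inj:
  assumes "is_marked \<pi> P" "is_marked \<pi> Q" "ipush \<pi> P = ipush \<pi> Q" shows "P = Q"
proof -
  obtain w i v j where PQ: "P = (w, i)" "Q = (v, j)" by fastforce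
  let ?k = "push_pos \<pi> w i"
  have m: "marked \<pi> w i" "marked \<pi> v j" using assms PQ by (simp_all add: is_marked_def)
  have k: "push_pos \<pi> v j = ?k" and u: "w[?k := w ! ?k + 1] = v[?k := v ! ?k + 1]"
    using assms(3) PQ by (auto simp: ipush_eq)
  have l: "?k < length w" "?k < length v" using push_pos_marked m k marked_length by metis+
  have "w ! ?k + 1 = v ! ?k + 1" using u l by (metis nth_list_update_eq)
  then have "w = v" using u l
    by (metis add_right_cancel list_update_id list_update_overwrite)
  moreover have "i = j" using push_pos_invol m k calculation by metis
  ultimately show ?thesis by (simp add: PQ)
qed

lemma ipush_surj:
  assumes "is_marked \<pi> Q" shows "\<exists>P. is_marked \<pi> P \<and> ipush \<pi> P = Q"
proof -
  obtain v j where Q: "Q = (v, j)" by fastforce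
  define w where "w = v[j := v ! j - 1]"
  have m: "marked \<pi> w j" using assms Q by (simp add: is_marked_def w_def)
  then have j: "j < length v" using marked_length by (fastforce simp: w_def)
  have "ipush \<pi> (w, push_pos \<pi> w j) = (v, j)"
    using push_pos_invol[OF m] j by (simp add: ipush_eq w_def)
  then show ?thesis using push_pos_marked[OF m] Q by (intro exI[of _ "(w, push_pos \<pi> w j)"]) (simp add: is_marked_def)
qed

lemma length_ipush [simp]: "length (fst (ipush \<pi> P)) = length (fst P)"
  by (cases P) (simp add: ipush_eq)

lemma length_ipush_pow [simp]: "length (fst ((ipush \<pi> ^^ k) P)) = length (fst P)"
  by (induction k) auto

lemma sum_list_update_int:
  "k < length w \<Longrightarrow> sum_list (w[k := x]) = sum_list w + x - (w ! k :: int)"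
  by (induction w arbitrary: k) (auto split: nat.split)

lemma sum_ipush:
  assumes "is_marked \<pi> P" shows "sum_list (fst (ipush \<pi> P)) = sum_list (fst P) + 1"
proof -
  obtain w i where P: "P = (w, i)" by fastforce
  have "push_pos \<pi> w i < length w" using assms P push_pos_marked marked_length by (fastforce simp: is_marked_def)
  then show ?thesis by (simp add: P ipush_eq sum_list_update_int)
qed

lemma sum_ipush_pow: "is_marked \<pi> P \<Longrightarrow> sum_list (fst ((ipush \<pi> ^^ k) P)) = sum_list (fst P) + int k"
  by (induction k) (auto simp: sum_ipush is_marked_ipush_pow)

text \<open>With two marked positions, every letter survives in one of the two deletions, and each
  deletion is a reduced word for \<open>\<pi>\<close>.\<close>

lemma nonreduced_letters:
  assumes "marked \<pi> w i" "\<not> inv_reduced w" shows "set w \<subseteq> {c. rk \<pi> c c \<ge> 1}"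
proof
  fix c assume "c \<in> set w"
  then obtain k where k: "k < length w" "w ! k = c" by (auto simp: in_set_conv_nth)
  obtain j where j: "j \<noteq> k" "marked \<pi> w j"
    using push_pos_nonreduced[OF assms] assms(1) by metis
  have "c \<in> set (del_at w j)"
  proof (cases "k < j")
    case True
    then have "c \<in> set (take j w)" using k by (metis in_set_conv_nth length_take min_less_iff_conj nth_take)
    then show ?thesis by (simp add: del_at_def)
  next
    case False
    then have "drop (Suc j) w ! (k - Suc j) = c" "k - Suc j < length (drop (Suc j) w)" using k j by auto
    then have "c \<in> set (drop (Suc j) w)" by (metis nth_mem)
    then show ?thesis by (simp add: del_at_def)
  qed
  then show "c \<in> {c. rk \<pi> c c \<ge> 1}" using letter_rk[of "del_at w j" c] j(2) by (simp add: marked_iff_ascending)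
qed

lemma sum_list_bound:
  assumes "\<And>x. x \<in> set w \<Longrightarrow> \<bar>x\<bar> \<le> (B::int)" shows "\<bar>sum_list w\<bar> \<le> int (length w) * B"
  using assms
proof (induction w)
  case (Cons a w)
  then have "\<bar>sum_list w\<bar> \<le> int (length w) * B" "\<bar>a\<bar> \<le> B" by simp_all
  then show ?case by (simp add: algebra_simps)
qed simp

text \<open>The length of a marked word is determined by \<open>H \<pi>\<close>, so a bound on the
  letters bounds their sum.\<close>

lemma nonreduced_sum_bound:
  assumes "\<pi> \<in> I_Z"
  shows "\<exists>K. \<forall>P. is_marked \<pi> P \<longrightarrow> \<not> is_reduced P \<longrightarrow> \<bar>sum_list (fst P)\<bar> \<le> K"
proof -
  let ?L = "abs ` {c. rk \<pi> c c \<ge> 1}"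
  have fin: "finite ?L" using finite_rk_diag[OF I_Z_perm[OF assms]] by simp
  show ?thesis
  proof (intro exI allI impI)
    fix P assume P: "is_marked \<pi> P" "\<not> is_reduced P"
    have "set (fst P) \<subseteq> {c. rk \<pi> c c \<ge> 1}" using nonreduced_letters P by (auto simp: is_marked_def is_reduced_def)
    then have "\<bar>x\<bar> \<le> Max ?L" if "x \<in> set (fst P)" for x using fin that by (meson Max_ge image_eqI subsetD)
    then have "\<bar>sum_list (fst P)\<bar> \<le> int (length (fst P)) * Max ?L" by (rule sum_list_bound)
    moreover have "length (fst P) = (H \<pi> + 4) div 4" using P(1) by (simp add: is_marked_def marked_iff_H)
    ultimately show "\<bar>sum_list (fst P)\<bar> \<le> int ((H \<pi> + 4) div 4) * Max ?L" by simp
  qed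
qed

text \<open>A first-return relation. The start is allowed to be nonreduced, so that a run can be
  unfolded push by push; the number of pushes is kept for induction.\<close>

definition returns :: "(int \<Rightarrow> int) \<Rightarrow> nat \<Rightarrow> int list \<times> nat \<Rightarrow> int list \<times> nat \<Rightarrow> bool" where
  "returns \<pi> N P Q \<longleftrightarrow> 0 < N \<and> (ipush \<pi> ^^ N) P = Q \<and> is_reduced Q \<and> (\<forall>k. 0 < k \<longrightarrow> k < N \<longrightarrow> \<not> is_reduced ((ipush \<pi> ^^ k) P))"

lemma returns_det: "returns \<pi> N P Q \<Longrightarrow> returns \<pi> N' P Q' \<Longrightarrow> N = N' \<and> Q = Q'"
  unfolding returns_def by (metis linorder_neqE_nat)

lemma returns_exists:
  assumes "\<pi> \<in> I_Z" "is_marked \<pi> P" shows "\<exists>N Q. returns \<pi> N P Q"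
proof -
  obtain K where K: "\<And>P. is_marked \<pi> P \<Longrightarrow> \<not> is_reduced P \<Longrightarrow> \<bar>sum_list (fst P)\<bar> \<le> K"
    using nonreduced_sum_bound[OF assms(1)] by blast
  let ?R = "\<lambda>N. 0 < N \<and> is_reduced ((ipush \<pi> ^^ N) P)"
  have "\<exists>N. ?R N"
  proof (rule ccontr)
    assume "\<not> ?thesis"
    then have *: "\<not> is_reduced ((ipush \<pi> ^^ Suc k) P)" for k by blast
    \<comment> \<open>The number of pushes is chosen so that the letter sum ends up above the bound
      \<open>K\<close>.\<close>
    show False
      using K[OF is_marked_ipush_pow[OF assms(2)] *[of "nat (K - sum_list (fst P))"]]
        sum_ipush_pow[OF assms(2), of "Suc (nat (K - sum_list (fst P)))"]
      by linarith
  qed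
  then have "?R (LEAST N. ?R N)" by (rule LeastI_ex)
  moreover have "\<not> ?R k" if "k < (LEAST N. ?R N)" for k using not_less_Least that by blast
  ultimately show ?thesis unfolding returns_def by blast
qed

lemma returns_step:
  assumes "\<not> is_reduced (ipush \<pi> P)" "returns \<pi> N (ipush \<pi> P) Q" shows "returns \<pi> (Suc N) P Q"
  unfolding returns_def
proof (intro conjI allI impI)
  show "(ipush \<pi> ^^ Suc N) P = Q" "is_reduced Q" using assms(2) unfolding returns_def funpow_Suc_right by simp_all
  fix k assume "0 < k" "k < Suc N"
  then obtain l where "k = Suc l" "l < N" by (cases k) auto
  then show "\<not> is_reduced ((ipush \<pi> ^^ k) P)" using assms unfolding returns_def
    by (cases "l = 0") (simp_all del: funpow.simps(2) add: funpow_Suc_right)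
qed simp

lemma returns_one: "is_reduced (ipush \<pi> P) \<Longrightarrow> returns \<pi> 1 P (ipush \<pi> P)"
  by (simp add: returns_def)

lemma returns_cases:
  assumes "returns \<pi> N P Q"
  obtains "N = 1" "Q = ipush \<pi> P" "is_reduced (ipush \<pi> P)"
  | N' where "N = Suc N'" "\<not> is_reduced (ipush \<pi> P)" "returns \<pi> N' (ipush \<pi> P) Q"
proof (cases "N = 1")
  case True
  then show ?thesis using assms that(1) by (auto simp: returns_def)
next
  case False
  then obtain N' where N: "N = Suc N'" "0 < N'" using assms by (cases N) (auto simp: returns_def)
  have nr: "\<not> is_reduced ((ipush \<pi> ^^ k) (ipush \<pi> P))" if "k < N'" for k
    using assms that N unfolding returns_def
    by (metis Suc_mono comp_apply funpow_Suc_right zero_less_Suc)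
  then have "returns \<pi> N' (ipush \<pi> P) Q"
    using assms N unfolding returns_def by (metis comp_apply funpow_Suc_right)
  moreover have "\<not> is_reduced (ipush \<pi> P)" using nr[of 0] N by simp
  ultimately show ?thesis using that(2) N by blast
qed

text \<open>Pushes are undone one at a time. Each undoing lowers the letter sum, which is bounded
  below on nonreduced states, so a reduced predecessor must be reached.\<close>

lemma returns_back:
  assumes "\<pi> \<in> I_Z" "is_marked \<pi> Q" "is_reduced Q" shows "\<exists>N P. is_marked \<pi> P \<and> is_reduced P \<and> returns \<pi> N P Q"
proof -
  obtain K where K: "\<And>P. is_marked \<pi> P \<Longrightarrow> \<not> is_reduced P \<Longrightarrow> \<bar>sum_list (fst P)\<bar> \<le> K"
    using nonreduced_sum_bound[OF assms(1)] by blast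
  \<comment> \<open>Generalized to an intermediate state \<open>R\<close> of the backward run: it is
    \<open>Q\<close> itself, or it is nonreduced and its forward run first becomes reduced at
    \<open>Q\<close>.\<close>
  have "\<exists>N P. is_marked \<pi> P \<and> is_reduced P \<and> returns \<pi> N P Q"
    if "is_marked \<pi> R" "is_reduced R \<Longrightarrow> R = Q" "\<not> is_reduced R \<Longrightarrow> \<exists>N. returns \<pi> N R Q" for R
    using that
  proof (induction "nat (sum_list (fst R) + K + 1)" arbitrary: R rule: less_induct)
    case less
    obtain P where P: "is_marked \<pi> P" "ipush \<pi> P = R" using ipush_surj less.prems(1) by blast
    have ret: "\<exists>N. returns \<pi> N P Q"
      using P less.prems returns_one returns_step by (cases "is_reduced R") blast+
    show ?case
    proof (cases "is_reduced P")
      case True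
      then show ?thesis using ret P by blast
    next
      case False
      have "\<bar>sum_list (fst P)\<bar> \<le> K" "sum_list (fst R) = sum_list (fst P) + 1"
        using K P False sum_ipush by blast+
      then show ?thesis using less.hyps[OF _ P(1)] ret False by auto
    qed
  qed
  then show ?thesis using assms by blast
qed

text \<open>Cancelling the shorter run places its start on the longer run. Unless the run lengths
  agree, this start would be a strictly intermediate state and hence not reduced.\<close>

lemma returns_inj:
  assumes "is_marked \<pi> P" "is_marked \<pi> P'" "is_reduced P" "is_reduced P'" "returns \<pi> N P Q" "returns \<pi> N' P' Q"
  shows "P = P'"
proof -
  have "P = P'" if "is_marked \<pi> P" "is_marked \<pi> P'" "is_reduced P" "is_reduced P'" "returns \<pi> N P Q" "returns \<pi> N' P' Q" "N \<le> N'" for P P' N N'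
  proof -
    have eq: "(ipush \<pi> ^^ N) P = (ipush \<pi> ^^ N) ((ipush \<pi> ^^ (N' - N)) P')"
      using that by (metis returns_def add_diff_inverse_nat comp_apply funpow_add not_less)
    have "P = R" if "(ipush \<pi> ^^ N) P = (ipush \<pi> ^^ N) R" "is_marked \<pi> P" "is_marked \<pi> R" for N P R
      using that
    proof (induction N)
      case (Suc N)
      then have "(ipush \<pi> ^^ N) P = (ipush \<pi> ^^ N) R" using ipush_inj[OF is_marked_ipush_pow is_marked_ipush_pow] by simp
      then show ?case using Suc by blast
    qed simp
    then have P: "P = (ipush \<pi> ^^ (N' - N)) P'" using eq that is_marked_ipush_pow by blast
    show "P = P'"
    proof (cases "N' = N")
      case False
      then have "0 < N' - N" "N' - N < N'" using that by (auto simp: returns_def)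
      then show ?thesis using that P unfolding returns_def by blast
    qed (use P in simp)
  qed
  then show ?thesis using assms by (metis nat_le_linear)
qed

lemma ib_eq:
  assumes "marked \<pi> w i" "inv_reduced w" "returns \<pi> N (w, i) Q" shows "ib \<pi> w = fst Q"
proof -
  have i: "(THE i. marked \<pi> w i) = i" using assms marked_unique by blast
  have "(LEAST N. 0 < N \<and> inv_reduced (fst ((ipush \<pi> ^^ N) (w, i)))) = N"
    by (rule Least_equality) (use assms(3) in \<open>auto simp: returns_def is_reduced_def not_less[symmetric]\<close>)
  then show ?thesis using assms i by (auto simp: ib_def Let_def returns_def)
qed

lemma ib_unmarked: "\<nexists>i. marked \<pi> w i \<Longrightarrow> ib \<pi> w = w"
  by (simp add: ib_def)

lemma ib_returns:
  assumes "\<pi> \<in> I_Z" "marked \<pi> w i" "inv_reduced w"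
  shows "\<exists>N j. returns \<pi> N (w, i) (ib \<pi> w, j) \<and> marked \<pi> (ib \<pi> w) j \<and> inv_reduced (ib \<pi> w)"
proof -
  have m: "is_marked \<pi> (w, i)" using assms by (simp add: is_marked_def)
  obtain N Q where r: "returns \<pi> N (w, i) Q" using returns_exists[OF assms(1) m] by blast
  then have "ib \<pi> w = fst Q" using ib_eq assms by blast
  moreover have "is_marked \<pi> Q" "is_reduced Q" using r is_marked_ipush_pow[OF m] by (auto simp: returns_def)
  ultimately show ?thesis using r by (metis is_marked_def is_reduced_def prod.collapse)
qed

lemma ib_reduced:
  assumes "\<pi> \<in> I_Z" "inv_reduced w" shows "inv_reduced (ib \<pi> w)"
  using ib_returns assms ib_unmarked by metis

lemma length_ib: 
  assumes "\<pi> \<in> I_Z" "inv_reduced w" shows "length (ib \<pi> w) = length w"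
proof (cases "\<exists>i. marked \<pi> w i")
  case True
  then obtain i N j where "returns \<pi> N (w, i) (ib \<pi> w, j)" using ib_returns assms by blast
  then show ?thesis using length_ipush_pow[of N \<pi> "(w, i)"] by (simp add: returns_def)
qed (simp add: ib_unmarked)

text \<open>Having a mark is invariant under \<open>ib \<pi>\<close>, so words fixed for want of a
  mark never collide with bumped ones. Among the latter, the final word determines the final mark
  and thereby the run.\<close>

lemma ib_bij:
  assumes "\<pi> \<in> I_Z" shows "bij_betw (ib \<pi>) {w. inv_reduced w} {w. inv_reduced w}"
proof -
  have "inj_on (ib \<pi>) {w. inv_reduced w}"
  proof (rule inj_onI, clarify)
    fix w w' assume r: "inv_reduced w" "inv_reduced w'" and eq: "ib \<pi> w = ib \<pi> w'"
    have iff: "(\<exists>i. marked \<pi> w i) \<longleftrightarrow> (\<exists>i. marked \<pi> (ib \<pi> w) i)" if "inv_reduced w" for w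
      using ib_returns[OF assms _ that] ib_unmarked by metis
    show "w = w'"
    proof (cases "\<exists>i. marked \<pi> w i")
      case True
      then obtain i i' where m: "marked \<pi> w i" "marked \<pi> w' i'" using iff[OF r(1)] iff[OF r(2)] eq by metis
      obtain N j where 1: "returns \<pi> N (w, i) (ib \<pi> w, j)" "marked \<pi> (ib \<pi> w) j"
        using ib_returns[OF assms m(1) r(1)] by blast
      obtain N' j' where 2: "returns \<pi> N' (w', i') (ib \<pi> w', j')" "marked \<pi> (ib \<pi> w') j'" "inv_reduced (ib \<pi> w')"
        using ib_returns[OF assms m(2) r(2)] by blast
      have "j = j'" using 1 2 eq marked_unique by metis
      then have "(w, i) = (w', i')"
        using returns_inj[of \<pi> "(w, i)" "(w', i')"] 1 2 eq m r by (simp add: is_marked_def is_reduced_def)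
      then show ?thesis by simp
    next
      case False
      then show ?thesis using iff[OF r(1)] iff[OF r(2)] eq ib_unmarked by metis
    qed
  qed
  moreover have "v \<in> ib \<pi> ` {w. inv_reduced w}" if v: "inv_reduced v" for v
  proof (cases "\<exists>j. marked \<pi> v j")
    case True
    then obtain j where "marked \<pi> v j" by blast
    then obtain N w i where "marked \<pi> w i" "inv_reduced w" "returns \<pi> N (w, i) (v, j)"
      using returns_back[OF assms, of "(v, j)"] v by (auto simp: is_marked_def is_reduced_def)
    then show ?thesis using ib_eq by force
  next
    case False
    then show ?thesis using ib_unmarked v by force
  qed
  ultimately show ?thesis using ib_reduced[OF assms] by (auto simp: bij_betw_def)
qed

section \<open>Preservation of descents\<close>

lemma del_at_equal_neighbours:
  assumes "Suc k < length w" "w ! k = w ! Suc k"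
  shows "del_at w (Suc k) = del_at w k"
proof -
  have "take (Suc k) w = take k w @ [w ! k]" "drop (Suc k) w = w ! Suc k # drop (Suc (Suc k)) w"
    using assms(1) by (simp_all add: take_Suc_conv_app_nth Cons_nth_drop_Suc)
  then show ?thesis using assms(2) by (simp add: del_at_def)
qed

lemma reduced_neighbours:
  assumes "inv_reduced w" "Suc k < length w" shows "w ! k \<noteq> w ! Suc k"
proof
  assume eq: "w ! k = w ! Suc k"
  have "w = take k w @ w ! k # w ! k # drop (Suc (Suc k)) w"
    using assms(2) eq id_take_nth_drop[of k w] by (simp add: Cons_nth_drop_Suc)
  then have "ascending id (take k w @ w ! k # w ! k # drop (Suc (Suc k)) w)"
    using assms(1) by (simp add: inv_reduced_iff_ascending)
  then show False using step_has_descent[OF act_I_Z[OF id_I_Z], of "take k w" "w ! k"] by simp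
qed

text \<open>A push can make neighbouring letters equal, but then the next push moves the other one.\<close>

lemma ipush_ascent:
  assumes "is_marked \<pi> P" "Suc k < length (fst P)"
    "fst P ! k < fst P ! Suc k \<or> fst P ! k = fst P ! Suc k \<and> snd P = k"
  shows "fst (ipush \<pi> P) ! k < fst (ipush \<pi> P) ! Suc k \<or>
    fst (ipush \<pi> P) ! k = fst (ipush \<pi> P) ! Suc k \<and> snd (ipush \<pi> P) = k"
proof -
  obtain w i where P: "P = (w, i)" by fastforce
  show ?thesis
  proof (cases "w ! k = w ! Suc k")
    case True
    then have "i = k" using assms(3) P by simp
    moreover have "marked \<pi> w (Suc k)" using del_at_equal_neighbours[of k w] assms True P calculation
      by (simp add: is_marked_def marked_def)
    ultimately have "push_pos \<pi> w i = Suc k" using assms P by (intro push_pos_eqI) (auto simp: is_marked_def)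
    then show ?thesis using assms True P by (simp add: ipush_eq)
  next
    case False
    moreover have "push_pos \<pi> w i < length w" using assms(1) P push_pos_marked marked_length by (fastforce simp: is_marked_def)
    ultimately show ?thesis using assms P
      by (cases "push_pos \<pi> w i = k"; cases "push_pos \<pi> w i = Suc k") (auto simp: ipush_eq)
  qed
qed

text \<open>At a descent the two letters can meet only when the right one is raised, so the
  admissible equality carries its mark on the right.\<close>

lemma ipush_descent:
  assumes "is_marked \<pi> P" "Suc k < length (fst P)"
    "fst P ! k > fst P ! Suc k \<or> fst P ! k = fst P ! Suc k \<and> snd P = Suc k"
  shows "fst (ipush \<pi> P) ! k > fst (ipush \<pi> P) ! Suc k \<or>
    fst (ipush \<pi> P) ! k = fst (ipush \<pi> P) ! Suc k \<and> snd (ipush \<pi> P) = Suc k"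
proof -
  obtain w i where P: "P = (w, i)" by fastforce
  show ?thesis
  proof (cases "w ! k = w ! Suc k")
    case True
    then have "i = Suc k" using assms(3) P by simp
    moreover have "marked \<pi> w k" using del_at_equal_neighbours[of k w] assms True P calculation
      by (simp add: is_marked_def marked_def)
    ultimately have "push_pos \<pi> w i = k" using assms P by (intro push_pos_eqI) (auto simp: is_marked_def)
    then show ?thesis using assms True P by (simp add: ipush_eq)
  next
    case False
    moreover have "push_pos \<pi> w i < length w" using assms(1) P push_pos_marked marked_length by (fastforce simp: is_marked_def)
    ultimately show ?thesis using assms P
      by (cases "push_pos \<pi> w i = k"; cases "push_pos \<pi> w i = Suc k") (auto simp: ipush_eq)
  qed
qed

text \<open>The weakened ascent or descent survives the whole run, and the equality it tolerates is
  excluded at the end because the final word is reduced.\<close>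

lemma ib_ascent_iff:
  assumes "\<pi> \<in> I_Z" "inv_reduced w" "Suc k < length w"
  shows "ib \<pi> w ! k < ib \<pi> w ! Suc k \<longleftrightarrow> w ! k < w ! Suc k"
proof (cases "\<exists>i. marked \<pi> w i")
  case True
  then obtain i N j where m: "marked \<pi> w i" and r: "returns \<pi> N (w, i) (ib \<pi> w, j)"
    using ib_returns[OF assms(1) _ assms(2)] by blast
  have is_marked: "is_marked \<pi> ((ipush \<pi> ^^ n) (w, i))" for n using m by (intro is_marked_ipush_pow) (simp add: is_marked_def)
  have N: "(ipush \<pi> ^^ N) (w, i) = (ib \<pi> w, j)" using r by (simp add: returns_def)
  have ne: "ib \<pi> w ! k \<noteq> ib \<pi> w ! Suc k"
    using reduced_neighbours[OF ib_reduced[OF assms(1,2)]] length_ib[OF assms(1,2)] assms(3) by simp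
  consider "w ! k < w ! Suc k" | "w ! Suc k < w ! k" using reduced_neighbours[OF assms(2,3)] by linarith
  then show ?thesis
  proof cases
    case 1
    have "fst ((ipush \<pi> ^^ n) (w, i)) ! k < fst ((ipush \<pi> ^^ n) (w, i)) ! Suc k \<or>
      fst ((ipush \<pi> ^^ n) (w, i)) ! k = fst ((ipush \<pi> ^^ n) (w, i)) ! Suc k \<and> snd ((ipush \<pi> ^^ n) (w, i)) = k" for n
      using 1 assms(3) by (induction n) (simp, simp add: ipush_ascent is_marked)
    from this[of N] show ?thesis using 1 ne N by auto
  next
    case 2
    have "fst ((ipush \<pi> ^^ n) (w, i)) ! k > fst ((ipush \<pi> ^^ n) (w, i)) ! Suc k \<or>
      fst ((ipush \<pi> ^^ n) (w, i)) ! k = fst ((ipush \<pi> ^^ n) (w, i)) ! Suc k \<and> snd ((ipush \<pi> ^^ n) (w, i)) = Suc k" for n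
      using 2 assms(3) by (induction n) (simp, simp add: ipush_descent is_marked)
    from this[of N] show ?thesis using 2 ne N by auto
  qed
qed (simp add: ib_unmarked)

section \<open>Little bumps commute with Coxeter--Knuth moves\<close>

lemma demword_commute:
  assumes "\<bar>x - y\<bar> \<ge> 2" shows "demword (A @ x # y # C) = demword (A @ y # x # C)"
  using step_commute[OF I_Z_perm[OF act_I_Z[OF id_I_Z]] assms, of A] by (simp add: demword_act)

lemma demword_braid:
  "demword (A @ a # (a + 1) # a # C) = demword (A @ (a + 1) # a # (a + 1) # C)"
  using step_braid[OF I_Z_perm[OF act_I_Z[OF id_I_Z]], of A a] by (simp add: demword_act)

text \<open>Both sides are the transposition of \<open>x\<close> and \<open>x + 2\<close>. This is
  the extra relation available only at the beginning of an involution word.\<close>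

lemma step_init: "step (step id x) (x + 1) = step (step id (x + 1)) x"
proof -
  have s: "step id c = sZ c" for c using step_fixed[OF id_I_Z, of c] by simp
  have "step (sZ x) (x + 1) = sZ (x + 1) \<circ> sZ x \<circ> sZ (x + 1)"
    by (rule step_conj) (use step_I_Z[OF id_I_Z, of x] s in \<open>auto simp: sZ_def\<close>)
  moreover have "step (sZ (x + 1)) x = sZ x \<circ> sZ (x + 1) \<circ> sZ x"
    by (rule step_conj) (use step_I_Z[OF id_I_Z, of "x + 1"] s in \<open>auto simp: sZ_def\<close>)
  moreover have "sZ (x + 1) \<circ> sZ x \<circ> sZ (x + 1) = sZ x \<circ> sZ (x + 1) \<circ> sZ x"
    by (rule ext) (simp add: sZ_def)
  ultimately show ?thesis by (simp add: s)
qed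

lemma demword_init: "demword (x # y # C) = demword (y # x # C)"
proof -
  consider "\<bar>x - y\<bar> \<ge> 2" | "x = y" | "y = x + 1" | "x = y + 1" by linarith
  then show ?thesis
  proof cases
    case 1
    then show ?thesis using demword_commute[of x y "[]"] by simp
  qed (simp_all add: demword_act step_init)
qed

text \<open>Nothing is pushed here: two words for the same involution are compared, and one map
  \<open>\<mu>\<close> carries the marks of every \<open>\<pi>\<close>. Marks are transported in one
  direction only; the reverse move supplies the other.\<close>

definition static :: "int list \<Rightarrow> int list \<Rightarrow> (nat \<Rightarrow> nat) \<Rightarrow> bool" where
  "static w w' \<mu> \<longleftrightarrow> length w' = length w \<and> demword w' = demword w \<and> inj \<mu> \<and>
     (\<forall>\<pi> i. marked \<pi> w i \<longrightarrow> marked \<pi> w' (\<mu> i))"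

lemma static_reduced: "static w w' \<mu> \<Longrightarrow> inv_reduced w' \<longleftrightarrow> inv_reduced w"
  by (simp add: static_def inv_reduced_iff_H)

text \<open>The two words are reduced simultaneously, and otherwise the image of the second mark is
  a second mark, which is unique.\<close>

lemma static_push_pos:
  assumes "static w w' \<mu>" "marked \<pi> w i" shows "push_pos \<pi> w' (\<mu> i) = \<mu> (push_pos \<pi> w i)"
proof (cases "inv_reduced w")
  case True
  then show ?thesis using static_reduced[OF assms(1)] by (simp add: push_pos_reduced)
next
  case False
  have "\<mu> (push_pos \<pi> w i) \<noteq> \<mu> i" using push_pos_nonreduced[OF assms(2) False] assms(1)
    by (simp add: static_def inj_eq)
  then show ?thesis using assms push_pos_marked[OF assms(2)] by (intro push_pos_eqI) (auto simp: static_def)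
qed

definition swap_pos :: "nat \<Rightarrow> nat \<Rightarrow> nat" where
  "swap_pos k i = (if i = k then Suc k else if i = Suc k then k else i)"
definition refl_pos :: "nat \<Rightarrow> nat \<Rightarrow> nat" where
  "refl_pos k i = (if i = k then Suc (Suc k) else if i = Suc (Suc k) then k else i)"

lemma swap_pos_invol [simp]: "swap_pos k (swap_pos k i) = i"
  by (simp add: swap_pos_def)
lemma refl_pos_invol [simp]: "refl_pos k (refl_pos k i) = i"
  by (simp add: refl_pos_def)
lemma inj_swap_pos: "inj (swap_pos k)"
  by (metis injI swap_pos_invol)
lemma inj_refl_pos: "inj (refl_pos k)"
  by (metis injI refl_pos_invol)

lemma position_cases2:
  assumes "i < length (A @ x # y # C)"
  obtains "i < length A" | "i = length A" | "i = Suc (length A)" | l where "i = Suc (Suc (length A + l))" "l < length C"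
proof -
  have "i < length A \<or> i = length A \<or> i = Suc (length A) \<or> (\<exists>l. i = Suc (Suc (length A + l)))"
    using le_Suc_ex[of "Suc (Suc (length A))" i] by (cases "Suc (Suc (length A)) \<le> i") auto
  then show ?thesis using that assms by auto
qed

lemma static_swap:
  assumes "\<bar>x - y\<bar> \<ge> 2" shows "static (A @ x # y # C) (A @ y # x # C) (swap_pos (length A))"
  unfolding static_def
proof (intro conjI allI impI inj_swap_pos)
  show "demword (A @ y # x # C) = demword (A @ x # y # C)" using demword_commute[OF assms] by simp
  fix \<pi> i assume m: "marked \<pi> (A @ x # y # C) i"
  then have "i < length (A @ x # y # C)" by (rule marked_length)
  then show "marked \<pi> (A @ y # x # C) (swap_pos (length A) i)"
    by (cases rule: position_cases2) (use m demword_commute[OF assms] in \<open>auto simp: marked_iff_H swap_pos_def\<close>)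
qed simp

lemma static_init: "static (x # y # C) (y # x # C) (swap_pos 0)"
  unfolding static_def
proof (intro conjI allI impI inj_swap_pos)
  show "demword (y # x # C) = demword (x # y # C)" by (rule demword_init)
  fix \<pi> i assume m: "marked \<pi> (x # y # C) i"
  then have "i < length ([] @ x # y # C)" using marked_length by fastforce
  then show "marked \<pi> (y # x # C) (swap_pos 0 i)"
    by (cases rule: position_cases2) (use m demword_init in \<open>auto simp: marked_iff_H swap_pos_def\<close>)
qed simp

lemma not_reduced_double: "\<not> inv_reduced (A @ a # a # C)"
  using reduced_neighbours[of "A @ a # a # C" "length A"] by (auto simp: nth_append)

lemma position_cases3:
  assumes "i < length (A @ x # y # z # C)"
  obtains "i < length A" | "i = length A" | "i = Suc (length A)" | "i = Suc (Suc (length A))"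
  | l where "i = Suc (Suc (Suc (length A + l)))" "l < length C"
proof -
  have "i < length A \<or> i = length A \<or> i = Suc (length A) \<or> i = Suc (Suc (length A)) \<or> (\<exists>l. i = Suc (Suc (Suc (length A + l))))"
    using le_Suc_ex[of "Suc (Suc (Suc (length A)))" i] by (cases "Suc (Suc (Suc (length A))) \<le> i") auto
  then show ?thesis using that assms by auto
qed

lemma not_marked_double: "\<not> marked \<pi> (A @ a # b # a # C) (Suc (length A))"
proof
  assume "marked \<pi> (A @ a # b # a # C) (Suc (length A))"
  then have "inv_reduced (A @ a # a # C)" by (auto simp: marked_def inv_reduced_def inv_word_def)
  then show False using not_reduced_double by blast
qed

lemma del3:
  "i < length A \<Longrightarrow> del_at (A @ p # q # r # C) i = del_at A i @ p # q # r # C"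
  "del_at (A @ p # q # r # C) (length A) = A @ q # r # C"
  "del_at (A @ p # q # r # C) (Suc (length A)) = A @ p # r # C"
  "del_at (A @ p # q # r # C) (Suc (Suc (length A))) = A @ p # q # C"
  "del_at (A @ p # q # r # C) (Suc (Suc (Suc (length A + l)))) = A @ p # q # r # del_at C l"
  by (simp, (induction A; simp)+)

text \<open>Deleting the middle letter would leave two equal neighbours, so the middle is never
  marked. Deleting an outer letter of one triple leaves the same pair as deleting the opposite outer
  letter of the other, whence the reflection of positions.\<close>

lemma static_braid:
  "static (A @ a # (a + 1) # a # C) (A @ (a + 1) # a # (a + 1) # C) (refl_pos (length A))" (is ?A)
  "static (A @ (a + 1) # a # (a + 1) # C) (A @ a # (a + 1) # a # C) (refl_pos (length A))" (is ?B)
proof -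
  have 1: "marked \<pi> (A @ (a + 1) # a # (a + 1) # C) (refl_pos (length A) i)"
    if m: "marked \<pi> (A @ a # (a + 1) # a # C) i" for \<pi> i
    using marked_length[OF m] not_marked_double[of \<pi> A a "a + 1" C]
    by (cases rule: position_cases3)
      (use m demword_braid[of "del_at A i"] demword_braid[of A] in
        \<open>auto simp: marked_iff_H refl_pos_def del3 simp del: del_at_append\<close>)
  have 2: "marked \<pi> (A @ a # (a + 1) # a # C) (refl_pos (length A) i)"
    if m: "marked \<pi> (A @ (a + 1) # a # (a + 1) # C) i" for \<pi> i
    using marked_length[OF m] not_marked_double[of \<pi> A "a + 1" a C]
    by (cases rule: position_cases3)
      (use m demword_braid[of "del_at A i"] demword_braid[of A] in
        \<open>auto simp: marked_iff_H refl_pos_def del3 simp del: del_at_append\<close>)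
  show ?A ?B unfolding static_def using 1 2 demword_braid inj_refl_pos by auto
qed

text \<open>One push may destroy the relation and the next one restore it. An additional push is
  allowed only out of a nonreduced state, so that no first return is skipped.\<close>

definition simulates :: "(int \<Rightarrow> int) \<Rightarrow> (int list \<times> nat \<Rightarrow> int list \<times> nat \<Rightarrow> bool) \<Rightarrow> int list \<times> nat \<Rightarrow> int list \<times> nat \<Rightarrow> bool" where
  "simulates \<pi> R P P' \<longleftrightarrow>
     R (ipush \<pi> P) (ipush \<pi> P') \<or>
     \<not> is_reduced (ipush \<pi> P) \<and> R (ipush \<pi> (ipush \<pi> P)) (ipush \<pi> P') \<or>
     \<not> is_reduced (ipush \<pi> P') \<and> R (ipush \<pi> P) (ipush \<pi> (ipush \<pi> P')) \<or>
     \<not> is_reduced (ipush \<pi> P) \<and> \<not> is_reduced (ipush \<pi> P') \<and> R (ipush \<pi> (ipush \<pi> P)) (ipush \<pi> (ipush \<pi> P'))"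

lemma simulates_one: "R (ipush \<pi> P) (ipush \<pi> P') \<Longrightarrow> simulates \<pi> R P P'"
  by (simp add: simulates_def)

lemma simulates_sym:
  assumes "\<And>P P'. R P P' \<Longrightarrow> R P' P" "simulates \<pi> R P P'" shows "simulates \<pi> R P' P"
  using assms unfolding simulates_def by blast

text \<open>Strong induction on the run length, since one round may consume two pushes on the
  left.\<close>

lemma simulation_returns:
  assumes sim: "\<And>P P'. R P P' \<Longrightarrow> is_marked \<pi> P \<Longrightarrow> is_marked \<pi> P' \<and> simulates \<pi> R P P'"
    and red: "\<And>P P'. R P P' \<Longrightarrow> is_reduced P = is_reduced P'"
  shows "returns \<pi> N P Q \<Longrightarrow> R P P' \<Longrightarrow> is_marked \<pi> P \<Longrightarrow> \<exists>N' Q'. returns \<pi> N' P' Q' \<and> R Q Q'"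
proof (induction N arbitrary: P P' rule: less_induct)
  case (less N)
  \<comment> \<open>The states \<open>P1\<close> and \<open>P2\<close> are the last ones before the
    relation is restored, so all four forms of \<open>simulates\<close> reduce to this
    situation.\<close>
  have main: "\<exists>N' Q'. returns \<pi> N' P2 Q' \<and> R Q Q'"
    if R: "R (ipush \<pi> P1) (ipush \<pi> P2)" and m1: "is_marked \<pi> P1" and r: "returns \<pi> K P1 Q" "K \<le> N" for P1 P2 K
  proof (cases "is_reduced (ipush \<pi> P1)")
    case True
    then show ?thesis using R red r returns_det[OF r(1) returns_one[OF True]] returns_one by blast
  next
    case False
    then obtain K' where K: "K = Suc K'" "returns \<pi> K' (ipush \<pi> P1) Q" using r(1) by (metis returns_cases)
    then obtain N' Q' where "returns \<pi> N' (ipush \<pi> P2) Q'" "R Q Q'"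
      using less.IH[of K' "ipush \<pi> P1" "ipush \<pi> P2"] R is_marked_ipush[OF m1] r(2) by auto
    then show ?thesis using returns_step red[OF R] False by blast
  qed
  have first: "\<exists>K\<le>N. returns \<pi> K (ipush \<pi> P) Q" if "\<not> is_reduced (ipush \<pi> P)"
    using less.prems(1) that by (metis returns_cases le_SucI order_refl)
  have "simulates \<pi> R P P'" using sim less.prems by blast
  then consider "R (ipush \<pi> P) (ipush \<pi> P')"
    | "\<not> is_reduced (ipush \<pi> P)" "R (ipush \<pi> (ipush \<pi> P)) (ipush \<pi> P')"
    | "\<not> is_reduced (ipush \<pi> P')" "R (ipush \<pi> P) (ipush \<pi> (ipush \<pi> P'))"
    | "\<not> is_reduced (ipush \<pi> P)" "\<not> is_reduced (ipush \<pi> P')" "R (ipush \<pi> (ipush \<pi> P)) (ipush \<pi> (ipush \<pi> P'))"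
    unfolding simulates_def by blast
  then show ?case
  proof cases
    case 1
    then show ?thesis using main less.prems by blast
  next
    case 2
    then show ?thesis using main[OF 2(2) is_marked_ipush[OF less.prems(3)]] first by blast
  next
    case 3
    then show ?thesis using main[OF 3(2) less.prems(3) less.prems(1)] returns_step by blast
  next
    case 4
    then show ?thesis using main[OF 4(3) is_marked_ipush[OF less.prems(3)]] first returns_step by blast
  qed
qed

lemma ib_simulation:
  assumes "\<pi> \<in> I_Z" "inv_reduced w" "marked \<pi> w i" "R (w, i) (w', i')"
    and sim: "\<And>P P'. R P P' \<Longrightarrow> is_marked \<pi> P \<Longrightarrow> is_marked \<pi> P' \<and> simulates \<pi> R P P'"
    and red: "\<And>P P'. R P P' \<Longrightarrow> is_reduced P = is_reduced P'"
  shows "\<exists>j j'. R (ib \<pi> w, j) (ib \<pi> w', j')"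
proof -
  have m: "is_marked \<pi> (w, i)" using assms by (simp add: is_marked_def)
  obtain N j where r: "returns \<pi> N (w, i) (ib \<pi> w, j)" using ib_returns assms by blast
  obtain N' Q' where r': "returns \<pi> N' (w', i') Q'" "R (ib \<pi> w, j) Q'"
    using simulation_returns[OF sim red r assms(4) m] by blast
  have "marked \<pi> w' i'" "inv_reduced w'" using sim[OF assms(4) m] red[OF assms(4)] assms(2)
    by (simp_all add: is_marked_def is_reduced_def)
  then have "ib \<pi> w' = fst Q'" using ib_eq r' by blast
  then show ?thesis using r'(2) by (metis prod.collapse)
qed

text \<open>The relation \<open>R\<close> puts no condition on the first two letters, and neither
  does \<open>static_init\<close>. A push therefore never leaves \<open>R\<close>, and single pushes
  match throughout.\<close>

lemma ib_init_swap:
  assumes "\<pi> \<in> I_Z" "inv_reduced (x # y # C)"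
  shows "\<exists>x' y' C'. ib \<pi> (x # y # C) = x' # y' # C' \<and> ib \<pi> (y # x # C) = y' # x' # C'"
proof (cases "\<exists>i. marked \<pi> (x # y # C) i")
  case True
  then obtain i where i: "marked \<pi> (x # y # C) i" by blast
  define R where "R P P' \<longleftrightarrow> (\<exists>x y C i. P = (x # y # C, i) \<and> P' = (y # x # C, swap_pos 0 i))" for P P' :: "int list \<times> nat"
  have "\<exists>j j'. R (ib \<pi> (x # y # C), j) (ib \<pi> (y # x # C), j')"
  proof (rule ib_simulation[OF assms i])
    show "R (x # y # C, i) (y # x # C, swap_pos 0 i)" unfolding R_def by blast
    fix P P' assume "R P P'"
    then obtain x y C i where P: "P = (x # y # C, i)" "P' = (y # x # C, swap_pos 0 i)" unfolding R_def by blast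
    show "is_reduced P = is_reduced P'" using static_reduced[OF static_init] P by (simp add: is_reduced_def)
    assume "is_marked \<pi> P"
    then have m: "marked \<pi> (x # y # C) i" using P by (simp add: is_marked_def)
    define j where "j = push_pos \<pi> (x # y # C) i"
    have j: "push_pos \<pi> (y # x # C) (swap_pos 0 i) = swap_pos 0 j"
      unfolding j_def by (rule static_push_pos[OF static_init m])
    have 1: "ipush \<pi> P = ((x # y # C)[j := (x # y # C) ! j + 1], j)" by (simp add: P(1) ipush_eq j_def)
    have 2: "ipush \<pi> P' = ((y # x # C)[swap_pos 0 j := (y # x # C) ! swap_pos 0 j + 1], swap_pos 0 j)"
      unfolding P(2) ipush_eq j ..
    have "j < length ([] @ x # y # C)" using push_pos_marked[OF m] marked_length by (fastforce simp: j_def)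
    then have "R (ipush \<pi> P) (ipush \<pi> P')" unfolding 1 2
      by (cases rule: position_cases2) (simp_all add: R_def swap_pos_def)
    then show "is_marked \<pi> P' \<and> simulates \<pi> R P P'" using static_init m P by (auto simp: is_marked_def static_def simulates_def)
  qed
  then show ?thesis unfolding R_def by blast
next
  case False
  moreover have "\<nexists>i. marked \<pi> (y # x # C) i" using False static_init unfolding static_def by blast
  ultimately show ?thesis by (simp add: ib_unmarked)
qed

text \<open>All three kinds of moves belong to one relation because a push can turn one kind into
  another; the mark travels along with the letters.\<close>

inductive ck :: "nat \<Rightarrow> int list \<times> nat \<Rightarrow> int list \<times> nat \<Rightarrow> bool" where
  ck_right: "x < y \<Longrightarrow> y < z \<Longrightarrow>
    ck (length A) (A @ y # x # z # C, i) (A @ y # z # x # C, swap_pos (Suc (length A)) i)"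
| ck_left: "x < y \<Longrightarrow> y < z \<Longrightarrow>
    ck (length A) (A @ x # z # y # C, i) (A @ z # x # y # C, swap_pos (length A) i)"
| ck_braid: "ck (length A) (A @ a # (a + 1) # a # C, i) (A @ (a + 1) # a # (a + 1) # C, refl_pos (length A) i)"

definition ck_sym :: "nat \<Rightarrow> int list \<times> nat \<Rightarrow> int list \<times> nat \<Rightarrow> bool" where
  "ck_sym k P P' \<longleftrightarrow> ck k P P' \<or> ck k P' P"

lemma static_swap1: "\<bar>x - z\<bar> \<ge> 2 \<Longrightarrow> static (A @ y # x # z # C) (A @ y # z # x # C) (swap_pos (Suc (length A)))"
  using static_swap[of x z "A @ [y]" C] by simp

lemma ck_static:
  assumes "ck k (w, i) (w', i')" shows "\<exists>\<mu>. static w w' \<mu> \<and> i' = \<mu> i \<and> static w' w \<mu> \<and> i = \<mu> i'"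
  using assms
proof cases
  case (ck_right x y z A C)
  then show ?thesis using static_swap1[of x z A y C] static_swap1[of z x A y C] by auto
next
  case (ck_left x y z A C)
  then show ?thesis using static_swap[of x z A "y # C"] static_swap[of z x A "y # C"] by auto
next
  case (ck_braid A a C)
  then show ?thesis using static_braid[of A a C] by auto
qed

lemma update3:
  "(A @ p # q # r # C)[length A := v] = A @ v # q # r # C"
  "(A @ p # q # r # C)[Suc (length A) := v] = A @ p # v # r # C"
  "(A @ p # q # r # C)[Suc (Suc (length A)) := v] = A @ p # q # v # C"
  "(A @ p # q # r # C) ! length A = p"
  "(A @ p # q # r # C) ! Suc (length A) = q"
  "(A @ p # q # r # C) ! Suc (Suc (length A)) = r"
  by (induction A) auto

lemma update_outer:
  assumes "j < length A + 3 + length C" "j \<noteq> length A" "j \<noteq> Suc (length A)" "j \<noteq> Suc (Suc (length A))"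
  obtains A' C' where "length A' = length A"
    "\<And>p q r. (A @ p # q # r # C)[j := (A @ p # q # r # C) ! j + 1] = A' @ p # q # r # (C' :: int list)"
proof (cases "j < length A")
  case True
  then show ?thesis using that[of "A[j := A ! j + 1]" C] by (simp add: list_update_append nth_append)
next
  case False
  then have "length A + 3 \<le> j" using assms by linarith
  then obtain l where "j = length A + 3 + l" using le_Suc_ex by blast
  then show ?thesis using that[of A "C[l := C ! l + 1]"] by (simp add: list_update_append nth_append numeral_3_eq_3)
qed

text \<open>A second deletion with the same product has the same length and is therefore marked as
  well. The word is then not reduced and the next push is forced.\<close>

lemma second_mark:
  assumes "marked \<pi> w i" "j < length w" "j \<noteq> i" "demword (del_at w j) = demword (del_at w i)"
  shows "\<not> is_reduced (w, i)" "ipush \<pi> (w, i) = (w[j := w ! j + 1], j)"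
proof -
  have m: "marked \<pi> w j" using assms by (simp add: marked_iff_H)
  then show "\<not> is_reduced (w, i)" using marked_unique assms by (auto simp: is_reduced_def)
  show "ipush \<pi> (w, i) = (w[j := w ! j + 1], j)" using push_pos_eqI[OF assms(1) m assms(3)] by (simp add: ipush_eq)
qed

text \<open>Raising a letter of the triple breaks its pattern only by creating two equal letters,
  which are adjacent or separated by a letter commuting with them, or by creating a braid triple. In
  the first situation the other copy is pushed next, which yields a valid pattern again.\<close>

lemma ck_simulates:
  assumes "ck k P P'" "is_marked \<pi> P" shows "is_marked \<pi> P' \<and> simulates \<pi> (ck_sym k) P P'"
proof
  obtain w i w' i' where PP: "P = (w, i)" "P' = (w', i')" by fastforce
  obtain \<mu> where mu: "static w w' \<mu>" "i' = \<mu> i" using ck_static assms(1) PP by blast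
  have m: "marked \<pi> w i" using assms PP by (simp add: is_marked_def)
  then have m': "marked \<pi> w' i'" using mu by (simp add: static_def)
  then show "is_marked \<pi> P'" using PP by (simp add: is_marked_def)
  define j where "j = push_pos \<pi> w i"
  have mj: "marked \<pi> w j" using m push_pos_marked j_def by blast
  have P1: "ipush \<pi> P = (w[j := w ! j + 1], j)" by (simp add: PP ipush_eq j_def)
  have m1: "marked \<pi> (w[j := w ! j + 1]) j" using mj by simp
  show "simulates \<pi> (ck_sym k) P P'"
    using assms(1)
  proof cases
    case (ck_right x y z A C i0)
    have w: "w = A @ y # x # z # C" "w' = A @ y # z # x # C" and k: "k = length A"
      and i': "i' = swap_pos (Suc k) i" and lt: "x < y" "y < z" using ck_right PP by auto
    define j' where "j' = swap_pos (Suc k) j"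
    have "push_pos \<pi> w' i' = j'" unfolding i' j'_def j_def w k
      by (rule static_push_pos[OF static_swap1]) (use lt m w in auto)
    then have P1': "ipush \<pi> P' = (w'[j' := w' ! j' + 1], j')" by (simp add: PP ipush_eq)
    have "is_marked \<pi> (ipush \<pi> P')" using m' PP by (intro is_marked_ipush) (simp add: is_marked_def)
    then have m1': "marked \<pi> (w'[j' := w' ! j' + 1]) j'" by (simp add: P1' is_marked_def)
    have jl: "j < length w" using mj marked_length by blast
    consider "j = k" | "j = Suc k" | "j = Suc (Suc k)" | "j \<noteq> k" "j \<noteq> Suc k" "j \<noteq> Suc (Suc k)" by blast
    then show ?thesis
    proof cases
      case 1
      then have j': "j' = k" by (simp add: j'_def swap_pos_def)
      show ?thesis
      proof (cases "y + 1 < z")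
        case True
        then show ?thesis using lt 1 j' ck.ck_right[of x "y + 1" z A C k]
          by (simp add: simulates_one ck_sym_def P1 P1' w update3 k swap_pos_def)
      next
        case False
        then have z: "z = y + 1" using lt by simp
        \<comment> \<open>The raised \<open>y\<close> has met \<open>z\<close>: the triples are now
          \<open>z x z\<close> and \<open>z z x\<close>. Since \<open>x\<close> commutes with
          \<open>z\<close>, either copy of \<open>z\<close> can be deleted, so the other copy moves
          on to \<open>z + 1\<close>.\<close>
        have c: "demword (A @ z # x # C) = demword (A @ x # z # C)" using demword_commute[of z x] lt by simp
        have 2: "\<not> is_reduced (ipush \<pi> P)" "ipush \<pi> (ipush \<pi> P) = (A @ z # x # (z + 1) # C, Suc (Suc k))"
          using second_mark[OF m1, of "Suc (Suc k)"] c 1 by (simp_all add: P1 w update3 del3 k z)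
        have 3: "\<not> is_reduced (ipush \<pi> P')" "ipush \<pi> (ipush \<pi> P') = (A @ z # (z + 1) # x # C, Suc k)"
          using second_mark[OF m1', of "Suc k"] c j' by (simp_all add: P1' w update3 del3 k z)
        have "ck k (A @ z # x # (z + 1) # C, Suc (Suc k)) (A @ z # (z + 1) # x # C, Suc k)"
          using ck.ck_right[of x z "z + 1" A C "Suc (Suc k)"] ck_right by (simp add: k swap_pos_def)
        then show ?thesis using 2 3 by (simp add: simulates_def ck_sym_def)
      qed
    next
      case 2
      then have j': "j' = Suc (Suc k)" by (simp add: j'_def swap_pos_def)
      consider "x + 1 < y" | "x + 1 = y" "y + 1 < z" | "x + 1 = y" "z = y + 1" using lt by linarith
      then show ?thesis
      proof cases
        case 1
        then show ?thesis using lt 2 j' ck.ck_right[of "x + 1" y z A C "Suc k"]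
          by (simp add: simulates_one ck_sym_def P1 P1' w update3 k swap_pos_def)
      next
        case xy: 2
        have c: "demword (A @ z # y # C) = demword (A @ y # z # C)" using demword_commute[of z y] xy by simp
        have 3: "\<not> is_reduced (ipush \<pi> P)" "ipush \<pi> (ipush \<pi> P) = (A @ (y + 1) # y # z # C, k)"
          using second_mark[OF m1, of k] c 2 xy by (simp_all add: P1 w update3 del3 k)
        have 4: "\<not> is_reduced (ipush \<pi> P')" "ipush \<pi> (ipush \<pi> P') = (A @ (y + 1) # z # y # C, k)"
          using second_mark[OF m1', of k] c j' xy by (simp_all add: P1' w update3 del3 k)
        have "ck k (A @ (y + 1) # y # z # C, k) (A @ (y + 1) # z # y # C, k)"
          using ck.ck_right[of y "y + 1" z A C k] xy by (simp add: k swap_pos_def)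
        then show ?thesis using 3 4 by (simp add: simulates_def ck_sym_def)
      next
        case xyz: 3
        \<comment> \<open>For consecutive values the left word passes through
          \<open>y y (y + 1)\<close> and needs two pushes to reach \<open>(y + 1) y (y + 1)\<close>,
          whereas the right word is already \<open>y (y + 1) y\<close>. A swap has turned into a
          braid move.\<close>
        have 3: "\<not> is_reduced (ipush \<pi> P)" "ipush \<pi> (ipush \<pi> P) = (A @ (y + 1) # y # (y + 1) # C, k)"
          using second_mark[OF m1, of k] 2 xyz by (simp_all add: P1 w update3 del3 k)
        have 4: "ipush \<pi> P' = (A @ y # (y + 1) # y # C, Suc (Suc k))"
          using j' xyz by (simp add: P1' w update3 k)
        have "ck k (A @ y # (y + 1) # y # C, Suc (Suc k)) (A @ (y + 1) # y # (y + 1) # C, k)"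
          using ck.ck_braid[of A y C "Suc (Suc k)"] by (simp add: k refl_pos_def)
        then show ?thesis using 3 4 by (simp add: simulates_def ck_sym_def)
      qed
    next
      case 3
      then have j': "j' = Suc k" by (simp add: j'_def swap_pos_def)
      then show ?thesis using lt 3 ck.ck_right[of x y "z + 1" A C "Suc (Suc k)"]
        by (simp add: simulates_one ck_sym_def P1 P1' w update3 k swap_pos_def)
    next
      case 4
      then have j': "j' = j" by (simp add: j'_def swap_pos_def)
      obtain A' C' where AC: "length A' = length A"
        "\<And>p q r. (A @ p # q # r # C)[j := (A @ p # q # r # C) ! j + 1] = A' @ p # q # r # C'"
        using update_outer[of j A C] 4 jl by (auto simp: k w)
      then show ?thesis using 4 j' lt ck.ck_right[of x y z A' C' j]
        by (simp add: simulates_one ck_sym_def P1 P1' w k swap_pos_def)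
    qed
  next
    case (ck_left x y z A C i0)
    have w: "w = A @ x # z # y # C" "w' = A @ z # x # y # C" and k: "k = length A"
      and i': "i' = swap_pos k i" and lt: "x < y" "y < z" using ck_left PP by auto
    define j' where "j' = swap_pos k j"
    have "push_pos \<pi> w' i' = j'" unfolding i' j'_def j_def w k
      by (rule static_push_pos[OF static_swap]) (use lt m w in auto)
    then have P1': "ipush \<pi> P' = (w'[j' := w' ! j' + 1], j')" by (simp add: PP ipush_eq)
    have "is_marked \<pi> (ipush \<pi> P')" using m' PP by (intro is_marked_ipush) (simp add: is_marked_def)
    then have m1': "marked \<pi> (w'[j' := w' ! j' + 1]) j'" by (simp add: P1' is_marked_def)
    have jl: "j < length w" using mj marked_length by blast
    consider "j = k" | "j = Suc k" | "j = Suc (Suc k)" | "j \<noteq> k" "j \<noteq> Suc k" "j \<noteq> Suc (Suc k)" by blast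
    then show ?thesis
    proof cases
      case 1
      then have j': "j' = Suc k" by (simp add: j'_def swap_pos_def)
      consider "x + 1 < y" | "x + 1 = y" "y + 1 < z" | "x + 1 = y" "z = y + 1" using lt by linarith
      then show ?thesis
      proof cases
        case xy: 1
        then show ?thesis using lt 1 j' ck.ck_left[of "x + 1" y z A C k]
          by (simp add: simulates_one ck_sym_def P1 P1' w update3 k swap_pos_def)
      next
        case xy: 2
        have c: "demword (A @ z # y # C) = demword (A @ y # z # C)" using demword_commute[of z y] xy by simp
        have 3: "\<not> is_reduced (ipush \<pi> P)" "ipush \<pi> (ipush \<pi> P) = (A @ y # z # (y + 1) # C, Suc (Suc k))"
          using second_mark[OF m1, of "Suc (Suc k)"] c 1 xy by (simp_all add: P1 w update3 del3 k)
        have 4: "\<not> is_reduced (ipush \<pi> P')" "ipush \<pi> (ipush \<pi> P') = (A @ z # y # (y + 1) # C, Suc (Suc k))"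
          using second_mark[OF m1', of "Suc (Suc k)"] c j' xy by (simp_all add: P1' w update3 del3 k)
        have "ck k (A @ y # z # (y + 1) # C, Suc (Suc k)) (A @ z # y # (y + 1) # C, Suc (Suc k))"
          using ck.ck_left[of y "y + 1" z A C "Suc (Suc k)"] xy by (simp add: k swap_pos_def)
        then show ?thesis using 3 4 by (simp add: simulates_def ck_sym_def)
      next
        case xyz: 3
        have 3: "\<not> is_reduced (ipush \<pi> P')" "ipush \<pi> (ipush \<pi> P') = (A @ (y + 1) # y # (y + 1) # C, Suc (Suc k))"
          using second_mark[OF m1', of "Suc (Suc k)"] j' xyz by (simp_all add: P1' w update3 del3 k)
        have 4: "ipush \<pi> P = (A @ y # (y + 1) # y # C, k)"
          using 1 xyz by (simp add: P1 w update3 k)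
        have "ck k (A @ y # (y + 1) # y # C, k) (A @ (y + 1) # y # (y + 1) # C, Suc (Suc k))"
          using ck.ck_braid[of A y C k] by (simp add: k refl_pos_def)
        then show ?thesis using 3 4 by (simp add: simulates_def ck_sym_def)
      qed
    next
      case 2
      then have j': "j' = k" by (simp add: j'_def swap_pos_def)
      then show ?thesis using lt 2 ck.ck_left[of x y "z + 1" A C "Suc k"]
        by (simp add: simulates_one ck_sym_def P1 P1' w update3 k swap_pos_def)
    next
      case 3
      then have j': "j' = Suc (Suc k)" by (simp add: j'_def swap_pos_def)
      show ?thesis
      proof (cases "y + 1 < z")
        case True
        then show ?thesis using lt 3 j' ck.ck_left[of x "y + 1" z A C "Suc (Suc k)"]
          by (simp add: simulates_one ck_sym_def P1 P1' w update3 k swap_pos_def)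
      next
        case False
        then have z: "z = y + 1" using lt by simp
        have c: "demword (A @ z # x # C) = demword (A @ x # z # C)" using demword_commute[of z x] lt by simp
        have 2: "\<not> is_reduced (ipush \<pi> P)" "ipush \<pi> (ipush \<pi> P) = (A @ x # (z + 1) # z # C, Suc k)"
          using second_mark[OF m1, of "Suc k"] c 3 by (simp_all add: P1 w update3 del3 k z)
        have 4: "\<not> is_reduced (ipush \<pi> P')" "ipush \<pi> (ipush \<pi> P') = (A @ (z + 1) # x # z # C, k)"
          using second_mark[OF m1', of k] c j' by (simp_all add: P1' w update3 del3 k z)
        have "ck k (A @ x # (z + 1) # z # C, Suc k) (A @ (z + 1) # x # z # C, k)"
          using ck.ck_left[of x z "z + 1" A C "Suc k"] ck_left by (simp add: k swap_pos_def)
        then show ?thesis using 2 4 by (simp add: simulates_def ck_sym_def)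
      qed
    next
      case 4
      then have j': "j' = j" by (simp add: j'_def swap_pos_def)
      obtain A' C' where AC: "length A' = length A"
        "\<And>p q r. (A @ p # q # r # C)[j := (A @ p # q # r # C) ! j + 1] = A' @ p # q # r # C'"
        using update_outer[of j A C] 4 jl by (auto simp: k w)
      then show ?thesis using 4 j' lt ck.ck_left[of x y z A' C' j]
        by (simp add: simulates_one ck_sym_def P1 P1' w k swap_pos_def)
    qed
  next
    case (ck_braid A a C i0)
    have w: "w = A @ a # (a + 1) # a # C" "w' = A @ (a + 1) # a # (a + 1) # C" and k: "k = length A"
      and i': "i' = refl_pos k i" using ck_braid PP by auto
    define j' where "j' = refl_pos k j"
    have "push_pos \<pi> w' i' = j'" unfolding i' j'_def j_def w k
      by (rule static_push_pos[OF static_braid(1)]) (use m w in auto)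
    then have P1': "ipush \<pi> P' = (w'[j' := w' ! j' + 1], j')" by (simp add: PP ipush_eq)
    have jl: "j < length w" using mj marked_length by blast
    consider "j = k" | "j = Suc k" | "j = Suc (Suc k)" | "j \<noteq> k" "j \<noteq> Suc k" "j \<noteq> Suc (Suc k)" by blast
    then show ?thesis
    proof cases
      case 1
      then have j': "j' = Suc (Suc k)" by (simp add: j'_def refl_pos_def)
      \<comment> \<open>The raised first letter equals the middle one, which is pushed next. In the
        other word the matching push raises the last letter and meets no obstacle, so the braid move
        becomes a swap.\<close>
      have 2: "\<not> is_reduced (ipush \<pi> P)" "ipush \<pi> (ipush \<pi> P) = (A @ (a + 1) # (a + 2) # a # C, Suc k)"
        using second_mark[OF m1, of "Suc k"] 1 by (simp_all add: P1 w update3 del3 k)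
      have 3: "ipush \<pi> P' = (A @ (a + 1) # a # (a + 2) # C, Suc (Suc k))"
        using j' by (simp add: P1' w update3 k)
      have "ck k (A @ (a + 1) # a # (a + 2) # C, Suc (Suc k)) (A @ (a + 1) # (a + 2) # a # C, Suc k)"
        using ck.ck_right[of a "a + 1" "a + 2" A C "Suc (Suc k)"] by (simp add: k swap_pos_def)
      then show ?thesis using 2 3 by (simp add: simulates_def ck_sym_def)
    next
      case 2
      then show ?thesis using mj not_marked_double k w by blast
    next
      case 3
      then have j': "j' = k" by (simp add: j'_def refl_pos_def)
      have 2: "\<not> is_reduced (ipush \<pi> P)" "ipush \<pi> (ipush \<pi> P) = (A @ a # (a + 2) # (a + 1) # C, Suc k)"
        using second_mark[OF m1, of "Suc k"] 3 by (simp_all add: P1 w update3 del3 k)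
      have 3: "ipush \<pi> P' = (A @ (a + 2) # a # (a + 1) # C, k)"
        using j' by (simp add: P1' w update3 k)
      have "ck k (A @ a # (a + 2) # (a + 1) # C, Suc k) (A @ (a + 2) # a # (a + 1) # C, k)"
        using ck.ck_left[of a "a + 1" "a + 2" A C "Suc k"] by (simp add: k swap_pos_def)
      then show ?thesis using 2 3 by (simp add: simulates_def ck_sym_def)
    next
      case 4
      then have j': "j' = j" by (simp add: j'_def refl_pos_def)
      obtain A' C' where AC: "length A' = length A"
        "\<And>p q r. (A @ p # q # r # C)[j := (A @ p # q # r # C) ! j + 1] = A' @ p # q # r # C'"
        using update_outer[of j A C] 4 jl by (auto simp: k w)
      then show ?thesis using 4 j' ck.ck_braid[of A' a C' j]
        by (simp add: simulates_one ck_sym_def P1 P1' w k refl_pos_def)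
    qed
  qed
qed

section \<open>Bracketing via lattice paths\<close>

definition cnt :: "int set \<Rightarrow> int \<Rightarrow> int" where
  "cnt X z = int (card {x \<in> X. x \<le> z})"

text \<open>The height function of the bracketing of two words with letter sets \<open>X\<close> and \<open>Y\<close>: the largest
  unpaired letter of the first word is its leftmost maximum, and the smallest unpaired letter of the
  second word is its rightmost maximum.\<close>

definition S :: "int set \<Rightarrow> int set \<Rightarrow> int \<Rightarrow> int" where
  "S X Y z = cnt X z - cnt Y (z - 1)"

lemma cnt_insert:
  assumes "finite X" "x \<notin> X" shows "cnt (insert x X) z = cnt X z + (if x \<le> z then 1 else 0)"
proof -
  have "{y \<in> insert x X. y \<le> z} = (if x \<le> z then insert x {y \<in> X. y \<le> z} else {y \<in> X. y \<le> z})" by auto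
  then show ?thesis using assms by (simp add: cnt_def)
qed

lemma cnt_remove:
  assumes "finite X" "x \<in> X" shows "cnt (X - {x}) z = cnt X z - (if x \<le> z then 1 else 0)"
  using cnt_insert[of "X - {x}" x z] assms by (simp add: insert_absorb)

lemma cnt_mono: "finite X \<Longrightarrow> w \<le> z \<Longrightarrow> cnt X w \<le> cnt X z"
  unfolding cnt_def by (intro of_nat_mono card_mono) auto

lemma cnt_less:
  assumes "finite X" "x \<in> X" "w < x" "x \<le> z" shows "cnt X w < cnt X z"
proof -
  have "{y \<in> X. y \<le> w} \<subset> {y \<in> X. y \<le> z}" using assms by (intro psubsetI) (auto dest: eqset_imp_iff[of _ _ x])
  then show ?thesis unfolding cnt_def using assms(1) by (simp add: psubset_card_mono)
qed

lemma cnt_eq: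
  assumes "w \<le> z" "\<And>x. x \<in> X \<Longrightarrow> w < x \<Longrightarrow> z < x" shows "cnt X z = cnt X w"
proof -
  have "{x \<in> X. x \<le> z} = {x \<in> X. x \<le> w}" using assms by force
  then show ?thesis by (simp add: cnt_def)
qed

lemma cnt_step: assumes "finite X" shows "cnt X (z + 1) = cnt X z + (if z + 1 \<in> X then 1 else 0)"
proof -
  have "{x \<in> X. x \<le> z + 1} = (if z + 1 \<in> X then insert (z + 1) {x \<in> X. x \<le> z} else {x \<in> X. x \<le> z})"
    by (auto simp: le_less)
  then show ?thesis using assms by (simp add: cnt_def)
qed

lemma cnt_empty: "(\<And>x. x \<in> X \<Longrightarrow> z < x) \<Longrightarrow> cnt X z = 0"
proof -
  assume "\<And>x. x \<in> X \<Longrightarrow> z < x"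
  then have "{x \<in> X. x \<le> z} = {}" by force
  then show ?thesis unfolding cnt_def by (metis card.empty of_nat_0)
qed

lemma cnt_all: "(\<And>x. x \<in> X \<Longrightarrow> x \<le> z) \<Longrightarrow> cnt X z = int (card X)"
proof -
  assume "\<And>x. x \<in> X \<Longrightarrow> x \<le> z"
  then have "{x \<in> X. x \<le> z} = X" by force
  then show ?thesis unfolding cnt_def by simp
qed

lemma cnt_nonneg: "0 \<le> cnt X z"
  by (simp add: cnt_def)

lemma cnt_le_card: "finite X \<Longrightarrow> cnt X z \<le> int (card X)"
  unfolding cnt_def by (intro of_nat_mono card_mono) auto

lemma S_step:
  assumes "finite X" "finite Y"
  shows "S X Y (z + 1) = S X Y z + (if z + 1 \<in> X then 1 else 0) - (if z \<in> Y then 1 else 0)"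
  using cnt_step[OF assms(1), of z] cnt_step[OF assms(2), of "z - 1"] by (simp add: S_def)

text \<open>Induction from the largest letter \<open>y\<close> of the second word. If
  \<open>y\<close> stays unpaired, no remaining letter of \<open>A\<close> exceeds it, and the
  profile without \<open>y\<close> is flat to the right of \<open>y\<close>. If \<open>y\<close> is
  paired, deleting both partners changes the profile only strictly between them, where it is lifted
  to its level at \<open>y\<close>; the extreme positions of the maximum stay the same.\<close>

lemma pair_aux_props:
  assumes "finite A" "sorted_wrt (>) ys" "pair_aux ys A = (A', U)"
  shows "A' \<subseteq> A \<and> U \<subseteq> set ys \<and>
    (A' = {} \<longleftrightarrow> (\<forall>z. S A (set ys) z \<le> 0)) \<and>
    (A' \<noteq> {} \<longrightarrow> (\<forall>z<Max A'. S A (set ys) z < S A (set ys) (Max A')) \<and>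
        (\<forall>z. S A (set ys) z \<le> S A (set ys) (Max A'))) \<and>
    (U = {} \<longleftrightarrow> (\<forall>z. S A (set ys) z \<le> int (card A) - int (length ys))) \<and>
    (U \<noteq> {} \<longrightarrow> (\<forall>z>Min U. S A (set ys) z < S A (set ys) (Min U)) \<and>
        (\<forall>z. S A (set ys) z \<le> S A (set ys) (Min U)))"
  using assms
proof (induction ys arbitrary: A A' U)
  case Nil
  then have [simp]: "A' = A" "U = {}" by auto
  have S: "S A {} z = cnt A z" for z by (simp add: S_def cnt_def)
  have "A = {} \<longleftrightarrow> (\<forall>z. cnt A z \<le> 0)"
  proof
    assume *: "\<forall>z. cnt A z \<le> 0"
    show "A = {}"
    proof (rule ccontr)
      assume "A \<noteq> {}"
      then obtain x where "x \<in> A" by blast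
      then show False using cnt_less[OF Nil(1), of x "x - 1" x] * cnt_nonneg[of A "x - 1"] by (smt (verit))
    qed
  qed (simp add: cnt_def)
  moreover have "(\<forall>z<Max A. cnt A z < cnt A (Max A)) \<and> (\<forall>z. cnt A z \<le> cnt A (Max A))" if "A \<noteq> {}"
    using cnt_less[OF Nil(1) Max_in[OF Nil(1) that]] cnt_all[of A "Max A"] cnt_le_card[OF Nil(1)] Nil(1)
    by (metis Max_ge order_refl)
  ultimately show ?case using cnt_le_card[OF Nil(1)] by (simp add: S)
next
  case (Cons y ys)
  have fy: "finite (set ys)" "y \<notin> set ys" "sorted_wrt (>) ys" and lt: "\<And>v. v \<in> set ys \<Longrightarrow> v < y" using Cons.prems(2) by auto
  let ?C = "{x \<in> A. y < x}"
  have Sy: "S A (set (y # ys)) z = S A (set ys) z - (if y < z then 1 else 0)" for z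
    using cnt_insert[OF fy(1,2), of "z - 1"] by (simp add: S_def)
  have top: "cnt (set ys) z = int (length ys)" if "y - 1 \<le> z" for z
  proof -
    have "distinct ys" using fy(3) by (metis distinct_rev sorted_wrt_rev strict_sorted_iff)
    then show ?thesis using cnt_all[of "set ys" z] lt that by (simp add: distinct_card) (meson dual_order.trans zle_diff1_eq)
  qed
  show ?case
  proof (cases "?C = {}")
    case True
    then have Ay: "\<And>x. x \<in> A \<Longrightarrow> x \<le> y" by force
    obtain U1 where U1: "pair_aux ys A = (A', U1)" "U = insert y U1"
      using Cons.prems(3) True by (auto simp: Let_def split: prod.splits)
    note IH = Cons.IH[OF Cons.prems(1) fy(3) U1(1)]
    have flat: "S A (set ys) z = int (card A) - int (length ys)" if "y \<le> z" for z
      using that top[of "z - 1"] cnt_all[of A z] Ay by (simp add: S_def) (metis dual_order.trans)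
    have "finite U1" "finite A'" using IH Cons.prems(1) fy(1) by (meson finite_subset)+
    have M: "Max A' \<le> y" if "A' \<noteq> {}" using IH Ay that \<open>finite A'\<close> by (meson Max_in subsetD)
    have a1: "A' = {} \<longleftrightarrow> (\<forall>z. S A (set (y # ys)) z \<le> 0)"
    proof
      assume "\<forall>z. S A (set (y # ys)) z \<le> 0"
      then have *: "S A (set ys) z - (if y < z then 1 else 0) \<le> 0" for z unfolding Sy by blast
      have "S A (set ys) z \<le> 0" for z using *[of z] *[of y] flat[of z] flat[of y] by (cases "y < z") auto
      then show "A' = {}" using IH by blast
    next
      assume "A' = {}"
      then have *: "\<forall>z. S A (set ys) z \<le> 0" using IH by blast
      show "\<forall>z. S A (set (y # ys)) z \<le> 0"
      proof
        fix z show "S A (set (y # ys)) z \<le> 0" using *[rule_format, of z] by (simp only: Sy) simp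
      qed
    qed
    have a2: "(\<forall>z<Max A'. S A (set (y # ys)) z < S A (set (y # ys)) (Max A')) \<and>
        (\<forall>z. S A (set (y # ys)) z \<le> S A (set (y # ys)) (Max A'))" if "A' \<noteq> {}"
    proof -
      have "(\<forall>z<Max A'. S A (set ys) z < S A (set ys) (Max A')) \<and> (\<forall>z. S A (set ys) z \<le> S A (set ys) (Max A'))"
        using IH that by blast
      then show ?thesis using M[OF that] by (simp only: Sy) (smt (verit))
    qed
    have u: "S A (set (y # ys)) z \<le> S A (set (y # ys)) (Min U) \<and>
        (Min U < z \<longrightarrow> S A (set (y # ys)) z < S A (set (y # ys)) (Min U))" for z
    proof (cases "U1 = {}")
      case True
      then have "\<forall>z. S A (set ys) z \<le> int (card A) - int (length ys)" using IH by blast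
      moreover have "Min U = y" using True U1 by simp
      ultimately show ?thesis using flat[of y] flat[of z] by (simp only: Sy) (smt (verit))
    next
      case False
      then have 1: "(\<forall>z>Min U1. S A (set ys) z < S A (set ys) (Min U1)) \<and> (\<forall>z. S A (set ys) z \<le> S A (set ys) (Min U1))"
        using IH by blast
      have "Min U1 < y" using False IH lt \<open>finite U1\<close> by (meson Min_in subsetD)
      moreover have "Min U = Min U1" using False U1 \<open>finite U1\<close> calculation by simp
      ultimately show ?thesis using 1 by (simp only: Sy) (smt (verit))
    qed
    \<comment> \<open>At \<open>y\<close> the profile is one above its eventual value, in accordance
      with \<open>y\<close> being unpaired.\<close>
    have "\<not> S A (set (y # ys)) y \<le> int (card A) - int (length (y # ys))" using flat[of y] by (simp only: Sy) simp
    moreover have "A' \<subseteq> A" "U \<subseteq> set (y # ys)" "U \<noteq> {}" using IH U1 by auto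
    ultimately show ?thesis using a1 a2 u by blast
  next
    case False
    let ?m = "Min ?C"
    have fC: "finite ?C" using Cons.prems(1) by simp
    have m: "?m \<in> A" "y < ?m" using Min_in[OF fC False] by auto
    have gap: "?m \<le> x" if "x \<in> A" "y < x" for x using Min_le[OF fC, of x] that by simp
    have p: "pair_aux ys (A - {?m}) = (A', U)" using Cons.prems(3) unfolding pair_aux.simps Let_def if_not_P[OF False] .
    have fA: "finite (A - {?m})" using Cons.prems(1) by simp
    note IH = Cons.IH[OF fA fy(3) p]
    let ?S = "S A (set (y # ys))" and ?S1 = "S (A - {?m}) (set ys)"
    have S1: "?S1 z = ?S z + (if y < z then 1 else 0) - (if ?m \<le> z then 1 else 0)" for z
      using Sy[of z] cnt_remove[OF Cons.prems(1) m(1), of z] by (simp add: S_def)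
    have mid: "?S1 z = ?S1 y" if "y < z" "z < ?m" for z
    proof -
      have "cnt A z = cnt A y" using cnt_eq[of y z A] that gap by force
      then have "cnt (A - {?m}) z = cnt (A - {?m}) y"
        using cnt_remove[OF Cons.prems(1) m(1)] that m by simp
      then show ?thesis using top[of "z - 1"] top[of "y - 1"] that by (simp add: S_def)
    qed
    have ge: "?S z \<le> ?S1 z" for z using S1[of z] m(2) by (auto split: if_splits)
    have eq: "?S z = ?S1 z" if "z \<le> y \<or> ?m \<le> z" for z using S1[of z] that m(2) by auto
    have fin: "finite A'" "finite U" using IH fA fy(1) by (meson finite_subset)+
    have max: "(\<forall>z. ?S1 z \<le> B) \<longleftrightarrow> (\<forall>z. ?S z \<le> B)" for B
    proof
      assume *: "\<forall>z. ?S z \<le> B"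
      show "\<forall>z. ?S1 z \<le> B"
      proof
        fix z show "?S1 z \<le> B" using eq[of z] eq[of y] mid[of z] *[rule_format, of z] *[rule_format, of y]
          by (cases "z \<le> y \<or> ?m \<le> z") (auto simp: not_le)
      qed
    next
      assume *: "\<forall>z. ?S1 z \<le> B"
      show "\<forall>z. ?S z \<le> B" using order_trans[OF ge *[rule_format]] by blast
    qed
    have a2: "(\<forall>z<Max A'. ?S z < ?S (Max A')) \<and> (\<forall>z. ?S z \<le> ?S (Max A'))" if "A' \<noteq> {}"
    proof -
      have 1: "\<And>z. z < Max A' \<Longrightarrow> ?S1 z < ?S1 (Max A')" "\<And>z. ?S1 z \<le> ?S1 (Max A')"
        using IH that by blast+
      have "Max A' \<le> y \<or> ?m \<le> Max A'" 
      proof (rule ccontr)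
        assume "\<not> ?thesis"
        then have "y < Max A'" "Max A' < ?m" by linarith+
        then show False using 1(1)[of y] mid[of "Max A'"] by linarith
      qed
      then have "?S (Max A') = ?S1 (Max A')" by (rule eq)
      then show ?thesis using order.strict_trans1[OF ge 1(1)] order_trans[OF ge 1(2)] by simp
    qed
    have u: "(\<forall>z>Min U. ?S z < ?S (Min U)) \<and> (\<forall>z. ?S z \<le> ?S (Min U))" if "U \<noteq> {}"
    proof -
      have 1: "\<And>z. z > Min U \<Longrightarrow> ?S1 z < ?S1 (Min U)" "\<And>z. ?S1 z \<le> ?S1 (Min U)"
        using IH that by blast+
      have "Min U \<in> set ys" using that IH fin Min_in by (meson subsetD)
      then have "?S (Min U) = ?S1 (Min U)" using eq lt by force
      then show ?thesis using order.strict_trans1[OF ge 1(1)] order_trans[OF ge 1(2)] by simp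
    qed
    have c: "int (card (A - {?m})) - int (length ys) = int (card A) - int (length (y # ys))"
      using card_Suc_Diff1[OF Cons.prems(1) m(1)] by simp
    have "A' \<subseteq> A" "U \<subseteq> set (y # ys)" using IH by auto
    then show ?thesis using a2 u IH max[of 0] max[of "int (card (A - {?m})) - int (length ys)"] unfolding c by auto
  qed
qed

text \<open>Data of a lowering step: \<open>x\<close> leaves \<open>a\<close> and \<open>y\<close>
  enters \<open>b\<close>. The run of \<open>b\<close> comes from the search for \<open>y\<close>;
  the run of \<open>a\<close> is forced by reducedness and is what lets the raising operator find
  \<open>x\<close> again.\<close>

definition moves :: "int set \<Rightarrow> int set \<Rightarrow> int \<Rightarrow> int \<Rightarrow> bool" where
  "moves a b x y \<longleftrightarrow> x \<le> y \<and> {x..y} \<subseteq> a \<and> {x..<y} \<subseteq> b \<and> y \<notin> b \<and>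
     (\<forall>z<x. S a b z < S a b x) \<and> (\<forall>z. S a b z \<le> S a b x)"

lemma moves_in: "moves a b x y \<Longrightarrow> x \<in> a \<and> y \<in> a"
  by (auto simp: moves_def)

text \<open>Edelman--Greene row insertion of the smallest letter \<open>\<beta>\<close> of \<open>b\<close> into \<open>a\<close>, bumping \<open>c\<close>,
  changes the height function as follows.\<close>

lemma S_insert_new:
  assumes "finite a" "finite b" "\<beta> \<in> b" "\<beta> \<notin> a" "c \<in> a" "\<beta> < c"
  shows "S (insert \<beta> (a - {c})) (b - {\<beta>}) z =
    S a b z + (if \<beta> \<le> z then 1 else 0) + (if \<beta> < z then 1 else 0) - (if c \<le> z then 1 else 0)"
  using assms cnt_insert[of "a - {c}" \<beta> z] cnt_remove[of a c z] cnt_remove[of b \<beta> "z - 1"]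
  by (simp add: S_def)

lemma S_insert_old:
  assumes "finite b" "\<beta> \<in> b"
  shows "S a (b - {\<beta>}) z = S a b z + (if \<beta> < z then 1 else 0)"
  using assms cnt_remove[of b \<beta> "z - 1"] by (simp add: S_def)

text \<open>Strictly between \<open>\<beta>\<close> and \<open>c\<close> no letter of
  \<open>a\<close> is gained, while \<open>\<beta>\<close> starts to count negatively immediately to
  its right.\<close>

lemma S_gap:
  assumes "finite b" "\<beta> \<in> b" "\<And>e. e \<in> a \<Longrightarrow> \<beta> < e \<Longrightarrow> c \<le> e" "\<beta> < z" "z < c"
  shows "S a b z < S a b \<beta>"
proof -
  have "cnt a z = cnt a \<beta>" by (rule cnt_eq) (use assms in force)+
  moreover have "cnt b (\<beta> - 1) < cnt b (z - 1)" by (rule cnt_less) (use assms in auto)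
  ultimately show ?thesis by (simp add: S_def)
qed

section \<open>Effect of one row insertion on a pending move\<close>

context
  fixes a b :: "int set" and \<beta> x y :: int
  assumes fa: "finite a" and fb: "finite b" and \<beta>: "\<beta> \<in> b" "\<And>e. e \<in> b \<Longrightarrow> \<beta> \<le> e"
    and mv: "moves a b x y"
begin

lemma moves_lt: "z < x \<Longrightarrow> S a b z < S a b x" and moves_le: "S a b z \<le> S a b x"
  using mv by (auto simp: moves_def)

text \<open>Up to \<open>\<beta>\<close> the letters of \<open>b\<close> do not count, so another
  letter of \<open>a\<close> after \<open>x\<close> and up to \<open>\<beta>\<close> would lift the
  profile above its maximum.\<close>

lemma moves_below:
  assumes "x < \<beta>"
  shows "y = x" "\<beta> \<notin> a" "\<And>e. e \<in> a \<Longrightarrow> x < e \<Longrightarrow> \<beta> < e"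
proof -
  have "x \<notin> b" using \<beta> assms by force
  then show yx: "y = x" using mv unfolding moves_def by (metis atLeastLessThan_iff le_less subsetD order_refl)
  show gap: "\<beta> < e" if "e \<in> a" "x < e" for e
  proof (rule ccontr)
    assume "\<not> \<beta> < e"
    then have "cnt b (e - 1) = 0" "cnt b (x - 1) = 0" using \<beta> assms by (intro cnt_empty; force)+
    moreover have "cnt a x < cnt a e" using cnt_less[OF fa that(1) that(2)] by simp
    ultimately show False using moves_le[of e] by (simp add: S_def)
  qed
  then show "\<beta> \<notin> a" using assms by force
qed

text \<open>After the move, \<open>x\<close> heads the second word and takes over the bumping of
  \<open>c\<close>. The pending move then concerns \<open>\<beta>\<close>, which the original
  insertion has just placed into \<open>a\<close>.\<close>

lemma moves_insert_below:
  assumes "x < \<beta>" "c \<in> a" "\<beta> < c" "\<And>e. e \<in> a \<Longrightarrow> \<beta> < e \<Longrightarrow> c \<le> e"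
  shows "moves (insert \<beta> (a - {c})) (b - {\<beta>}) \<beta> \<beta>"
proof -
  note na = moves_below(2)[OF assms(1)]
  note S' = S_insert_new[OF fa fb \<beta>(1) na assms(2,3)]
  have "S a b \<beta> = S a b x"
  proof -
    have "cnt a \<beta> = cnt a x" by (rule cnt_eq) (use assms(1) moves_below(3)[OF assms(1)] in force)+
    moreover have "cnt b (\<beta> - 1) = 0" "cnt b (x - 1) = 0" using \<beta> assms(1) by (intro cnt_empty; force)+
    ultimately show ?thesis by (simp add: S_def)
  qed
  then have le: "S a b z \<le> S a b \<beta>" for z using moves_le by simp
  have gap: "S a b z < S a b \<beta>" if "\<beta> < z" "z < c" for z
    by (rule S_gap[OF fb \<beta>(1) _ that]) (use assms(4) in blast)
  have "S (insert \<beta> (a - {c})) (b - {\<beta>}) z \<le> S (insert \<beta> (a - {c})) (b - {\<beta>}) \<beta> \<and>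
     (z < \<beta> \<longrightarrow> S (insert \<beta> (a - {c})) (b - {\<beta>}) z < S (insert \<beta> (a - {c})) (b - {\<beta>}) \<beta>)" for z
    using gap[of z] assms(3) le[of z] unfolding S' by (cases "z < \<beta>"; cases "z = \<beta>"; cases "z < c") simp_all
  then show ?thesis by (simp add: moves_def)
qed

text \<open>Inserting a letter already present bumps its successor and keeps the row, so the common
  run merely loses its first letter.\<close>

lemma moves_insert_at:
  assumes "x = \<beta>"
  shows "x < y" "\<beta> + 1 \<in> a" "moves a (b - {\<beta>}) (x + 1) y"
proof -
  have "y \<noteq> x" using mv \<beta> assms by (auto simp: moves_def)
  then show xy: "x < y" using mv by (simp add: moves_def)
  then have x1: "x + 1 \<in> a" using mv by (auto simp: moves_def)
  then show "\<beta> + 1 \<in> a" using assms by simp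
  have "S a b (x + 1) = S a b x" using S_step[OF fa fb, of x] x1 \<beta> assms by simp
  then have "S a (b - {\<beta>}) z \<le> S a (b - {\<beta>}) (x + 1) \<and> (z < x + 1 \<longrightarrow> S a (b - {\<beta>}) z < S a (b - {\<beta>}) (x + 1))" for z
    using S_insert_old[OF fb \<beta>(1)] moves_le[of z] assms by auto
  moreover have "{x + 1..y} \<subseteq> a" "{x + 1..<y} \<subseteq> b - {\<beta>}" "y \<notin> b - {\<beta>}"
    using mv assms by (auto simp: moves_def)
  ultimately show "moves a (b - {\<beta>}) (x + 1) y" using xy by (simp add: moves_def)
qed

text \<open>The bumped letter is not \<open>x\<close>: at the first letter of \<open>a\<close>
  beyond \<open>\<beta>\<close> the profile does not exceed its value at \<open>\<beta>\<close>,
  whereas \<open>x\<close> is the leftmost maximum. Past \<open>c\<close> the profile changes by a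
  constant.\<close>

lemma moves_insert_above_new:
  assumes "\<beta> < x" "\<beta> \<notin> a" "c \<in> a" "\<beta> < c" "\<And>e. e \<in> a \<Longrightarrow> \<beta> < e \<Longrightarrow> c \<le> e"
  shows "c < x" "moves (insert \<beta> (a - {c})) (b - {\<beta>}) x y"
proof -
  note S' = S_insert_new[OF fa fb \<beta>(1) assms(2-4)]
  have gap: "S a b z < S a b \<beta>" if "\<beta> < z" "z < c" for z
    by (rule S_gap[OF fb \<beta>(1) _ that]) (use assms(5) in blast)
  have "c \<noteq> x"
  proof
    assume c: "c = x"
    have "S a b x \<le> S a b \<beta>"
    proof (cases "x = \<beta> + 1")
      case True
      then show ?thesis using S_step[OF fa fb, of \<beta>] \<beta> by simp
    next
      case False
      then have "S a b (x - 1) < S a b \<beta>" using gap[of "x - 1"] assms(1) c by simp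
      then show ?thesis using S_step[OF fa fb, of "x - 1"] by (auto split: if_splits)
    qed
    then show False using moves_lt[of \<beta>] assms(1) by simp
  qed
  then show cx: "c < x" using assms(5)[of x] moves_in[OF mv] assms(1) by simp
  have "S (insert \<beta> (a - {c})) (b - {\<beta>}) z \<le> S (insert \<beta> (a - {c})) (b - {\<beta>}) x \<and>
     (z < x \<longrightarrow> S (insert \<beta> (a - {c})) (b - {\<beta>}) z < S (insert \<beta> (a - {c})) (b - {\<beta>}) x)" for z
    using gap[of z] assms(4) cx assms(1) moves_le[of z] moves_lt[of z] moves_lt[of \<beta>]
    unfolding S' by (cases "z < \<beta>"; cases "z = \<beta>"; cases "z < c") simp_all
  moreover have "{x..y} \<subseteq> insert \<beta> (a - {c})" "{x..<y} \<subseteq> b - {\<beta>}" "y \<notin> b - {\<beta>}" "x \<le> y"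
    using mv assms(1) cx by (auto simp: moves_def)
  ultimately show "moves (insert \<beta> (a - {c})) (b - {\<beta>}) x y" by (simp add: moves_def)
qed

lemma moves_insert_above_old:
  assumes "\<beta> < x" "\<beta> \<in> a"
  shows "x \<noteq> \<beta> + 1" "moves a (b - {\<beta>}) x y"
proof -
  show "x \<noteq> \<beta> + 1"
  proof
    assume x: "x = \<beta> + 1"
    then have "S a b x \<le> S a b \<beta>" using S_step[OF fa fb, of \<beta>] \<beta> by simp
    then show False using moves_lt[of \<beta>] x by simp
  qed
  have "S a (b - {\<beta>}) z \<le> S a (b - {\<beta>}) x \<and> (z < x \<longrightarrow> S a (b - {\<beta>}) z < S a (b - {\<beta>}) x)" for z
    using S_insert_old[OF fb \<beta>(1)] moves_le[of z] moves_lt[of z] assms by auto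
  moreover have "{x..y} \<subseteq> a" "{x..<y} \<subseteq> b - {\<beta>}" "y \<notin> b - {\<beta>}" "x \<le> y"
    using mv assms(1) by (auto simp: moves_def)
  ultimately show "moves a (b - {\<beta>}) x y" by (simp add: moves_def)
qed

end

section \<open>Coxeter--Knuth operators and row insertion\<close>

text \<open>An end letter of intermediate value witnesses the swap of the other two. All remaining
  patterns except braid triples are fixed, which makes the operator a total involution.\<close>

definition ck_triple :: "int \<Rightarrow> int \<Rightarrow> int \<Rightarrow> int list" where
  "ck_triple p q r =
    (if q < p \<and> p < r \<or> r < p \<and> p < q then [p, r, q]
     else if p < r \<and> r < q \<or> q < r \<and> r < p then [q, p, r]
     else if p = r \<and> \<bar>p - q\<bar> = 1 then [q, p, q]
     else [p, q, r])"

definition T :: "nat \<Rightarrow> int list \<Rightarrow> int list" where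
  "T k w = (if Suc (Suc k) < length w
     then take k w @ ck_triple (w ! k) (w ! Suc k) (w ! Suc (Suc k)) @ drop (Suc (Suc (Suc k))) w else w)"

lemma T_append: "T (length A) (A @ p # q # r # C) = A @ ck_triple p q r @ C"
  by (simp add: T_def update3)

lemma T_short: "\<not> Suc (Suc k) < length w \<Longrightarrow> T k w = w"
  by (simp add: T_def)

lemma triple_split:
  assumes "Suc (Suc k) < length w"
  obtains A p q r C where "w = A @ p # q # r # C" "length A = k"
proof -
  have "w = take k w @ w ! k # w ! Suc k # w ! Suc (Suc k) # drop (Suc (Suc (Suc k))) w"
    using assms by (simp add: Cons_nth_drop_Suc)
  then show ?thesis using that[of "take k w"] assms by auto
qed

lemma ck_triple_cases:
  obtains "ck_triple p q r = [p, q, r]"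
  | p' q' r' where "ck_triple p q r = [p', q', r']"
     "\<And>A C i. \<exists>j. ck_sym (length A) (A @ p # q # r # C, i) (A @ p' # q' # r' # C, j)"
     "ck_triple p' q' r' = [p, q, r]"
proof -
  consider (1) "q < p" "p < r" | (2) "r < p" "p < q" | (3) "p < r" "r < q" | (4) "q < r" "r < p"
    | (5) "p = r" "q = p + 1" | (6) "p = r" "p = q + 1" | (7) "ck_triple p q r = [p, q, r]"
  proof (cases "ck_triple p q r = [p, q, r]")
    case False
    then have "q < p \<and> p < r \<or> r < p \<and> p < q \<or> p < r \<and> r < q \<or> q < r \<and> r < p \<or>
        p = r \<and> q = p + 1 \<or> p = r \<and> p = q + 1"
      by (auto simp: ck_triple_def abs_if split: if_splits)
    then show ?thesis using that(1-6) by blast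
  qed (use that(7) in blast)
  then show ?thesis
  proof cases
    case 1
    have "\<exists>j. ck_sym (length A) (A @ p # q # r # C, i) (A @ p # r # q # C, j)" for A C i
      using ck_right[OF 1, of A C i] unfolding ck_sym_def by blast
    then show ?thesis using 1 that(2)[of p r q] by (simp add: ck_triple_def)
  next
    case 2
    have "\<exists>j. ck_sym (length A) (A @ p # q # r # C, i) (A @ p # r # q # C, j)" for A C i
      using ck_right[OF 2, of A C "swap_pos (Suc (length A)) i"] unfolding ck_sym_def swap_pos_invol by blast
    then show ?thesis using 2 that(2)[of p r q] by (simp add: ck_triple_def)
  next
    case 3
    have "\<exists>j. ck_sym (length A) (A @ p # q # r # C, i) (A @ q # p # r # C, j)" for A C i
      using ck_left[OF 3, of A C i] unfolding ck_sym_def by blast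
    then show ?thesis using 3 that(2)[of q p r] by (simp add: ck_triple_def)
  next
    case 4
    have "\<exists>j. ck_sym (length A) (A @ p # q # r # C, i) (A @ q # p # r # C, j)" for A C i
      using ck_left[OF 4, of A C "swap_pos (length A) i"] unfolding ck_sym_def swap_pos_invol by blast
    then show ?thesis using 4 that(2)[of q p r] by (simp add: ck_triple_def)
  next
    case 5
    have "\<exists>j. ck_sym (length A) (A @ p # q # r # C, i) (A @ q # p # q # C, j)" for A C i
      using ck_braid[of A p C i] 5 unfolding ck_sym_def by blast
    then show ?thesis using 5 that(2)[of q p q] by (simp add: ck_triple_def)
  next
    case 6
    have "\<exists>j. ck_sym (length A) (A @ p # q # r # C, i) (A @ q # p # q # C, j)" for A C i
      using ck_braid[of A q C "refl_pos (length A) i"] 6 unfolding ck_sym_def refl_pos_invol by blast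
    then show ?thesis using 6 that(2)[of q p q] by (simp add: ck_triple_def)
  next
    case 7
    then show ?thesis using that(1) by blast
  qed
qed

lemma ck_T:
  assumes "ck_sym k (w, i) (w', j)" shows "w' = T k w"
proof -
  have "T k w = w' \<and> T k w' = w" if "ck k (w, i) (w', j)" for w i w' j
    using that
  proof cases
    case (ck_right x y z A C)
    then show ?thesis by (simp add: T_append ck_triple_def)
  next
    case (ck_left x y z A C)
    then show ?thesis by (simp add: T_append ck_triple_def)
  next
    case (ck_braid A a C)
    then show ?thesis by (simp add: T_append ck_triple_def)
  qed
  then show ?thesis using assms unfolding ck_sym_def by metis
qed

lemma T_cases:
  obtains "T k w = w" | "\<And>i. \<exists>j. ck_sym k (w, i) (T k w, j)"
proof (cases "Suc (Suc k) < length w")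
  case True
  then obtain A p q r C where w: "w = A @ p # q # r # C" "length A = k" by (rule triple_split)
  show ?thesis
  proof (cases rule: ck_triple_cases[of p q r])
    case 1
    then show ?thesis using that(1) w T_append[of A p q r C] by simp
  next
    case (2 p' q' r')
    then have "T k w = A @ p' # q' # r' # C" using w T_append[of A p q r C] by simp
    then show ?thesis using that(2) 2(2)[of A C] w by simp
  qed
qed (simp add: T_short)

lemma ck_sym_static:
  assumes "ck_sym k (w, i) (w', j)" shows "\<exists>\<mu>. static w w' \<mu> \<and> j = \<mu> i \<and> static w' w \<mu>"
  using assms ck_static unfolding ck_sym_def by blast

lemma length_T [simp]: "length (T k w) = length w"
proof (cases rule: T_cases[of k w])
  case 2
  then show ?thesis using ck_sym_static unfolding static_def by blast
qed simp

lemma T_reduced [simp]: "inv_reduced (T k w) \<longleftrightarrow> inv_reduced w"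
proof (cases rule: T_cases[of k w])
  case 2
  then show ?thesis using ck_sym_static static_reduced by blast
qed simp

lemma T_T [simp]: "T k (T k w) = w"
proof (cases rule: T_cases[of k w])
  case 2
  then obtain j where "ck_sym k (w, 0) (T k w, j)" by blast
  then have "ck_sym k (T k w, j) (w, 0)" unfolding ck_sym_def by blast
  then show ?thesis using ck_T by metis
qed simp

lemma ck_sym_simulates:
  assumes "ck_sym k P P'" "is_marked \<pi> P" shows "is_marked \<pi> P' \<and> simulates \<pi> (ck_sym k) P P'"
proof (cases "ck k P P'")
  case True
  then show ?thesis using ck_simulates assms by blast
next
  case False
  then have c: "ck k P' P" using assms(1) unfolding ck_sym_def by blast
  obtain w i w' i' where PP: "P = (w, i)" "P' = (w', i')" by fastforce
  obtain \<mu> where "static w w' \<mu>" "i' = \<mu> i" using c PP ck_static[of k w' i' w i] by blast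
  then have "is_marked \<pi> P'" using assms(2) PP by (simp add: is_marked_def static_def)
  moreover have "simulates \<pi> (ck_sym k) P' P" using ck_simulates[OF c] calculation by blast
  then have "simulates \<pi> (ck_sym k) P P'" by (rule simulates_sym[rotated]) (auto simp: ck_sym_def)
  ultimately show ?thesis by blast
qed

lemma ck_sym_reduced: "ck_sym k P P' \<Longrightarrow> is_reduced P = is_reduced P'"
  by (cases P; cases P') (use ck_sym_static static_reduced in \<open>fastforce simp: is_reduced_def\<close>)

text \<open>Equal neighbours cannot occur, and \<open>p q p\<close> with distant letters commutes to
  equal neighbours. A triple fixed by the operator is therefore monotone, a property visible in the
  descents.\<close>

lemma reduced_triple:
  assumes "inv_reduced (A @ p # q # r # C)" "ck_triple p q r = [p, q, r]"
  shows "p < q \<and> q < r \<or> r < q \<and> q < p"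
proof -
  have "p \<noteq> q" "q \<noteq> r"
    using assms(1) not_reduced_double[of A p "r # C"] not_reduced_double[of "A @ [p]" q C] by auto
  moreover have "p \<noteq> r"
  proof
    assume r: "p = r"
    then have "\<bar>p - q\<bar> \<ge> 2" using assms(2) \<open>p \<noteq> q\<close> by (auto simp: ck_triple_def split: if_splits)
    then have "inv_reduced (A @ p # p # q # C)"
      using assms(1) static_reduced[OF static_swap1[of q p A p C]] r by auto
    then show False using not_reduced_double by blast
  qed
  ultimately show ?thesis using assms(2) by (auto simp: ck_triple_def split: if_splits)
qed

text \<open>A genuine move is handled by simulation. A fixed triple is monotone, and since descents
  are preserved it remains monotone and fixed.\<close>

lemma ib_T:
  assumes "\<pi> \<in> I_Z" "inv_reduced w" shows "ib \<pi> (T k w) = T k (ib \<pi> w)"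
proof (cases "Suc (Suc k) < length w")
  case False
  then show ?thesis using length_ib[OF assms] by (simp add: T_short)
next
  case long: True
  show ?thesis
  proof (cases rule: T_cases[of k w])
    case 1
    obtain A p q r C where w: "w = A @ p # q # r # C" "length A = k" using triple_split[OF long] .
    have "ck_triple p q r = [p, q, r]" using 1 w T_append[of A p q r C] by (simp add: ck_triple_def split: if_splits)
    then have m: "p < q \<and> q < r \<or> r < q \<and> q < p" using reduced_triple assms(2) w by blast
    obtain A' p' q' r' C' where v: "ib \<pi> w = A' @ p' # q' # r' # C'" "length A' = k"
      using triple_split[of k "ib \<pi> w"] long length_ib[OF assms] by metis
    have "w ! k = p" "w ! Suc k = q" "w ! Suc (Suc k) = r"
      using update3(4-6)[of A p q r C] w by simp_all
    moreover have "ib \<pi> w ! k = p'" "ib \<pi> w ! Suc k = q'" "ib \<pi> w ! Suc (Suc k) = r'"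
      using update3(4-6)[of A' p' q' r' C'] v by simp_all
    ultimately have asc: "(p' < q') = (p < q)" "(q' < r') = (q < r)"
      using ib_ascent_iff[OF assms, of k] ib_ascent_iff[OF assms, of "Suc k"] long by auto
    have "p' \<noteq> q'" "q' \<noteq> r'"
      using ib_reduced[OF assms] v not_reduced_double[of A' p' "r' # C'"] not_reduced_double[of "A' @ [p']" q' C'] by auto
    then have "ck_triple p' q' r' = [p', q', r']" using asc m by (auto simp: ck_triple_def)
    then show ?thesis using 1 v T_append[of A' p' q' r' C'] by simp
  next
    case 2
    show ?thesis
    proof (cases "\<exists>i. marked \<pi> w i")
      case True
      then obtain i where i: "marked \<pi> w i" by blast
      obtain i' where c: "ck_sym k (w, i) (T k w, i')" using 2 by blast
      have "\<exists>j j'. ck_sym k (ib \<pi> w, j) (ib \<pi> (T k w), j')"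
        by (rule ib_simulation[where R = "ck_sym k", OF assms i c]) (use ck_sym_simulates ck_sym_reduced in blast)+
      then show ?thesis using ck_T by blast
    next
      case False
      moreover have "\<nexists>i. marked \<pi> (T k w) i"
        using 2 False ck_sym_static unfolding static_def by blast
      ultimately show ?thesis by (simp add: ib_unmarked)
    qed
  qed
qed

text \<open>The operators are applied from position \<open>k + m - 1\<close> down to
  \<open>k\<close>. With \<open>m\<close> one less than the length of a row starting at
  \<open>k\<close>, this inserts the letter following the row and puts the bumped letter in front of
  it.\<close>

primrec bump :: "nat \<Rightarrow> nat \<Rightarrow> int list \<Rightarrow> int list" where
  "bump k 0 w = w"
| "bump k (Suc m) w = bump k m (T (k + m) w)"

lemma length_bump [simp]: "length (bump k m w) = length w"
  by (induction m arbitrary: w) auto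
lemma bump_reduced [simp]: "inv_reduced (bump k m w) \<longleftrightarrow> inv_reduced w"
  by (induction m arbitrary: w) auto
lemma bump_inject: "bump k m w = bump k m w' \<longleftrightarrow> w = w'"
  by (induction m arbitrary: w w') (auto, metis T_T)
lemma ib_bump: "\<pi> \<in> I_Z \<Longrightarrow> inv_reduced w \<Longrightarrow> ib \<pi> (bump k m w) = bump k m (ib \<pi> w)"
  by (induction m arbitrary: w) (auto simp: ib_T)

text \<open>The inserted letter travels left: in \<open>e x \<beta>\<close> with
  \<open>\<beta> < e < x\<close> the letter \<open>e\<close> witnesses the swap of the last
  two.\<close>

lemma bump_small_letter:
  assumes "\<beta> < c" "sorted_wrt (<) (c # u)"
  shows "bump (length A) (length l + length u) (A @ l @ c # u @ \<beta> # C)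
       = bump (length A) (length l) (A @ l @ c # \<beta> # u @ C)"
  using assms(2)
proof (induction u arbitrary: C rule: rev_induct)
  case (snoc x u)
  let ?B = "butlast (c # u)" and ?e = "last (c # u)"
  have cu: "c # u = ?B @ [?e]" by (metis append_butlast_last_id list.distinct(1))
  have lB: "length ?B = length u" by simp
  have "c \<le> ?e" "?e < x" using snoc.prems by (cases "u = []"; simp add: sorted_wrt_append less_imp_le)+
  then have e: "\<beta> < ?e" "?e < x" using assms(1) by linarith+
  have "T (length A + (length l + length u)) (A @ l @ c # (u @ [x]) @ \<beta> # C)
      = T (length (A @ l @ ?B)) ((A @ l @ ?B) @ ?e # x # \<beta> # C)"
    using cu lB by (metis append.assoc append_Cons append_Nil length_append)
  also have "\<dots> = (A @ l @ ?B) @ ?e # \<beta> # x # C"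
    unfolding T_append using e by (simp add: ck_triple_def)
  also have "\<dots> = A @ l @ c # u @ \<beta> # x # C" using cu by (metis append.assoc append_Cons append_Nil)
  finally have "bump (length A) (length l + length (u @ [x])) (A @ l @ c # (u @ [x]) @ \<beta> # C)
     = bump (length A) (length l + length u) (A @ l @ c # u @ \<beta> # x # C)" by simp
  then show ?case using snoc.IH[of "x # C"] snoc.prems by (simp add: sorted_wrt_append)
qed simp

text \<open>The bumped letter travels to the front: in \<open>m c r\<close> with
  \<open>m < r < c\<close> the letter \<open>r\<close> witnesses the swap of the first two.\<close>

lemma bump_large_letter:
  assumes "sorted_wrt (<) (l @ [r])" "r < c"
  shows "bump (length A) (length l) (A @ l @ c # r # R) = A @ c # l @ r # R"
  using assms
proof (induction l arbitrary: r R rule: rev_induct)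
  case (snoc m l)
  have "m < r" using snoc.prems by (auto simp: sorted_wrt_append)
  then have "T (length A + length l) (A @ (l @ [m]) @ c # r # R) = A @ l @ c # m # r # R"
    using T_append[of "A @ l" m c r R] snoc.prems(2) by (simp add: ck_triple_def)
  then have "bump (length A) (length (l @ [m])) (A @ (l @ [m]) @ c # r # R)
    = bump (length A) (length l) (A @ l @ c # m # r # R)" by simp
  then show ?case using snoc.IH[of m "r # R"] snoc.prems \<open>m < r\<close> by (simp add: sorted_wrt_append)
qed simp

lemma sorted_list_eq:
  assumes "sorted_wrt (<) (xs :: int list)" "sorted_wrt (<) ys" "set xs = set ys" shows "xs = ys"
  using assms by (simp add: strict_sorted_equal)

lemma length_sorted: "sorted_wrt (<) (xs :: int list) \<Longrightarrow> length xs = card (set xs)"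
  by (simp add: distinct_card strict_sorted_iff)

lemma split_at_letter:
  assumes "sorted_wrt (<) a" "c \<in> set (a :: int list)" "\<beta> < c" "\<And>e. e \<in> set a \<Longrightarrow> \<beta> < e \<Longrightarrow> c \<le> e"
  obtains l u where "a = l @ c # u" "\<And>e. e \<in> set l \<Longrightarrow> e \<le> \<beta>" "\<And>e. e \<in> set u \<Longrightarrow> c < e"
proof -
  obtain l u where a: "a = l @ c # u" using assms(2) by (meson split_list)
  have "e \<le> \<beta>" if "e \<in> set l" for e
  proof -
    have "e < c" "e \<in> set a" using assms(1) a that by (auto simp: sorted_wrt_append)
    then show ?thesis using assms(4)[of e] by linarith
  qed
  moreover have "c < e" if "e \<in> set u" for e using assms(1) a that by (auto simp: sorted_wrt_append)
  ultimately show ?thesis using that a by blast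
qed

lemma bump_insert:
  assumes "sorted_wrt (<) a" "c \<in> set a" "\<beta> < c" "\<And>e. e \<in> set a \<Longrightarrow> \<beta> < e \<Longrightarrow> c \<le> e"
    "\<beta> \<in> set a \<Longrightarrow> c = \<beta> + 1"
    "sorted_wrt (<) a'" "set a' = (if \<beta> \<in> set a then set a else insert \<beta> (set a - {c}))"
  shows "bump (length A) (length a - 1) (A @ a @ \<beta> # C) = A @ c # a' @ C"
proof -
  obtain l u where a: "a = l @ c # u" and l: "\<And>e. e \<in> set l \<Longrightarrow> e \<le> \<beta>" and u: "\<And>e. e \<in> set u \<Longrightarrow> c < e"
    using split_at_letter[OF assms(1-4)] by blast
  have sl: "sorted_wrt (<) l" "sorted_wrt (<) (c # u)" using assms(1) a by (auto simp: sorted_wrt_append)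
  have 1: "bump (length A) (length a - 1) (A @ a @ \<beta> # C) = bump (length A) (length l) (A @ l @ c # \<beta> # u @ C)"
    using bump_small_letter[OF assms(3) sl(2), of A l C] by (simp add: a)
  show ?thesis
  proof (cases "\<beta> \<in> set a")
    case False
    then have l': "e < \<beta>" if "e \<in> set l" for e using l[OF that] that a by (auto simp: le_less)
    have "sorted_wrt (<) (l @ \<beta> # u)" using sl assms(3) by (fastforce simp: sorted_wrt_append dest!: l' u)
    moreover have "c \<notin> set l" "c \<notin> set u" using l' u assms(3) by force+
    then have "set (l @ \<beta> # u) = set a'"
      using False assms(7) a u l' assms(3) by auto
    ultimately have "a' = l @ \<beta> # u" using sorted_list_eq assms(6) by blast
    moreover have "sorted_wrt (<) (l @ [\<beta>])" using sl l' by (simp add: sorted_wrt_append)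
    ultimately show ?thesis using 1 bump_large_letter[of l \<beta> c A "u @ C"] assms(3) by simp
  next
    case True
    then have c: "c = \<beta> + 1" and a': "a' = a" using assms sorted_list_eq by auto
    have "\<beta> \<in> set l" using True a u assms(3) by fastforce
    then obtain l1 l2 where l12: "l = l1 @ \<beta> # l2" by (meson split_list)
    have "l2 = []" using sl(1) l[of "hd l2"] l12 by (cases l2) (auto simp: sorted_wrt_append)
    then have l1: "l = l1 @ [\<beta>]" using l12 by simp
    \<comment> \<open>The exceptional Edelman--Greene rule: \<open>\<beta> c \<beta>\<close> with
      \<open>c = \<beta> + 1\<close> is a braid triple, whose move keeps the row and releases
      \<open>c\<close>.\<close>
    have "T (length A + length l1) (A @ l @ c # \<beta> # u @ C) = A @ l1 @ c # \<beta> # c # u @ C"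
      using T_append[of "A @ l1" \<beta> c \<beta> "u @ C"] by (simp add: l1 c ck_triple_def)
    then have "bump (length A) (length l) (A @ l @ c # \<beta> # u @ C)
      = bump (length A) (length l1) (A @ l1 @ c # \<beta> # c # u @ C)" by (simp add: l1)
    also have "\<dots> = A @ c # l1 @ \<beta> # c # u @ C" using bump_large_letter sl(1) assms(3) l1 by blast
    finally show ?thesis using 1 a' a l1 by simp
  qed
qed

section \<open>Common runs that rule out reducedness\<close>

lemma demword_commute_lists:
  assumes "\<And>e f. e \<in> set u \<Longrightarrow> f \<in> set v \<Longrightarrow> \<bar>e - f\<bar> \<ge> 2"
  shows "demword (A @ u @ v @ C) = demword (A @ v @ u @ C)"
  using assms
proof (induction u arbitrary: A)
  case (Cons e u)
  have 1: "demword (A @ e # v @ C) = demword (A @ v @ e # C)" if "\<And>f. f \<in> set v \<Longrightarrow> \<bar>e - f\<bar> \<ge> 2" for v A C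
    using that
  proof (induction v arbitrary: A)
    case (Cons f v)
    then show ?case using demword_commute[of e f A "v @ C"] Cons.IH[of "A @ [f]"] by simp
  qed simp
  have "demword (A @ (e # u) @ v @ C) = demword (A @ e # v @ u @ C)"
    using Cons.IH[of "A @ [e]"] Cons.prems by simp
  then show ?case using 1[of v A "u @ C"] Cons.prems by simp
qed simp

lemma reduced_cong: "demword w = demword w' \<Longrightarrow> length w = length w' \<Longrightarrow> inv_reduced w = inv_reduced w'"
  by (simp add: inv_reduced_iff_H)

text \<open>The second \<open>x\<close> commutes back until it follows \<open>x (x + 1)\<close>. The
  braid move on this triple leaves two copies of the interval starting at \<open>x + 1\<close>, and
  finally two equal letters.\<close>

lemma not_reduced_twice:
  assumes "x \<le> m" shows "\<not> inv_reduced (A @ [x..m] @ [x..m] @ C)"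
  using assms
proof (induction "nat (m - x)" arbitrary: x A)
  case 0
  then have "x = m" by simp
  then show ?case using not_reduced_double[of A m C] by simp
next
  case (Suc n)
  then have xm: "x + 1 \<le> m" by simp
  have e: "[x..m] = x # (x + 1) # [x + 2..m]" "[x + 1..m] = (x + 1) # [x + 2..m]"
    using xm upto_rec1[of x m] upto_rec1[of "x + 1" m] by (simp_all add: ac_simps)
  let ?D = "[x + 1..m] @ C"
  have "demword (A @ [x..m] @ [x..m] @ C) = demword ((A @ [x, x + 1]) @ [x + 2..m] @ [x] @ ?D)"
    by (simp add: e)
  also have "\<dots> = demword ((A @ [x, x + 1]) @ [x] @ [x + 2..m] @ ?D)"
    by (rule demword_commute_lists) auto
  also have "\<dots> = demword (A @ x # (x + 1) # x # [x + 2..m] @ ?D)" by simp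
  also have "\<dots> = demword (A @ (x + 1) # x # (x + 1) # [x + 2..m] @ ?D)" by (rule demword_braid)
  also have "\<dots> = demword ((A @ [x + 1, x]) @ [x + 1..m] @ [x + 1..m] @ C)" by (simp add: e)
  finally have "demword (A @ [x..m] @ [x..m] @ C) = demword ((A @ [x + 1, x]) @ [x + 1..m] @ [x + 1..m] @ C)" .
  then have "inv_reduced (A @ [x..m] @ [x..m] @ C) = inv_reduced ((A @ [x + 1, x]) @ [x + 1..m] @ [x + 1..m] @ C)"
    by (rule reduced_cong) (simp add: e)
  then show ?case using Suc.hyps(1)[of "x + 1" "A @ [x + 1, x]"] Suc.hyps(2) xm by simp
qed

text \<open>The bound \<open>max (x - 1) m\<close> keeps the two filters complementary even if the
  interval is empty.\<close>

lemma sorted_split_interval: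
  assumes "sorted_wrt (<) (a :: int list)" "{x..m} \<subseteq> set a"
  shows "a = filter (\<lambda>e. e < x) a @ [x..m] @ filter (\<lambda>e. max (x - 1) m < e) a"
proof (rule sorted_list_eq[OF assms(1)])
  show "sorted_wrt (<) (filter (\<lambda>e. e < x) a @ [x..m] @ filter (\<lambda>e. max (x - 1) m < e) a)"
    using assms(1) by (auto simp: sorted_wrt_append sorted_wrt_filter)
qed (use assms(2) in auto)

text \<open>Letters of \<open>a\<close> beyond the run exceed \<open>m + 1\<close> and letters of
  \<open>b\<close> before it are below \<open>x - 1\<close>. Both commute out of the way, and the
  two copies of the run become adjacent.\<close>

lemma run_not_reduced:
  assumes "sorted_wrt (<) a" "sorted_wrt (<) b" "x \<le> m" "{x..m} \<subseteq> set a" "{x..m} \<subseteq> set b"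
    "m + 1 \<notin> set a" "x - 1 \<notin> set b"
  shows "\<not> inv_reduced (A @ a @ b @ C)"
proof -
  let ?a1 = "filter (\<lambda>e. e < x) a" and ?a2 = "filter (\<lambda>e. max (x - 1) m < e) a"
  let ?b1 = "filter (\<lambda>e. e < x) b" and ?b2 = "filter (\<lambda>e. max (x - 1) m < e) b"
  have far: "m + 1 < e" if "e \<in> set ?a2" for e using that assms(6) by (cases "e = m + 1") auto
  have near: "e < x - 1" if "e \<in> set ?b1" for e using that assms(7) by (cases "e = x - 1") auto
  have "demword (A @ a @ b @ C) = demword ((A @ ?a1) @ ([x..m] @ ?a2) @ ?b1 @ [x..m] @ ?b2 @ C)"
    using sorted_split_interval[OF assms(1,4)] sorted_split_interval[OF assms(2,5)] by (metis append.assoc)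
  also have "\<dots> = demword ((A @ ?a1) @ ?b1 @ ([x..m] @ ?a2) @ [x..m] @ ?b2 @ C)"
    by (rule demword_commute_lists) (use near assms(3) in fastforce)
  also have "\<dots> = demword ((A @ ?a1 @ ?b1 @ [x..m]) @ ?a2 @ [x..m] @ ?b2 @ C)" by simp
  also have "\<dots> = demword ((A @ ?a1 @ ?b1 @ [x..m]) @ [x..m] @ ?a2 @ ?b2 @ C)"
    by (rule demword_commute_lists) (use far in fastforce)
  finally have eq: "demword (A @ a @ b @ C) = demword ((A @ ?a1 @ ?b1) @ [x..m] @ [x..m] @ ?a2 @ ?b2 @ C)" by simp
  have "length a = length ?a1 + length [x..m] + length ?a2"
    using arg_cong[OF sorted_split_interval[OF assms(1,4)], of length] by (simp del: length_upto)
  moreover have "length b = length ?b1 + length [x..m] + length ?b2"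
    using arg_cong[OF sorted_split_interval[OF assms(2,5)], of length] by (simp del: length_upto)
  ultimately have "length (A @ a @ b @ C) = length ((A @ ?a1 @ ?b1) @ [x..m] @ [x..m] @ ?a2 @ ?b2 @ C)"
    by (simp del: length_upto)
  then show ?thesis using reduced_cong[OF eq] not_reduced_twice[OF assms(3)] by blast
qed

text \<open>At most \<open>q\<close> letters are inserted into the row of length \<open>p\<close> at
  position \<open>k\<close>, until an ascent follows the row; released letters pile up in front. The
  control flow reads only positions and descents, so it can be compared across a bump. The test
  \<open>0 < p\<close> protects the index \<open>k + p - 1\<close> when the row is empty.\<close>

fun rectify :: "nat \<Rightarrow> nat \<Rightarrow> nat \<Rightarrow> int list \<Rightarrow> nat \<times> int list" where
  "rectify 0 k p w = (0, w)"
| "rectify (Suc q) k p w =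
    (if 0 < p \<and> w ! (k + p) < w ! (k + p - 1)
     then (case rectify q (Suc k) p (bump k (p - 1) w) of (r, v) \<Rightarrow> (Suc r, v)) else (0, w))"

text \<open>The returned count fixes the number of insertions on both sides, and every insertion is
  injective.\<close>

lemma rectify_inject: "rectify q k p w = rectify q k p w' \<Longrightarrow> w = w'"
proof (induction q arbitrary: k w w')
  case (Suc q)
  then show ?case
    by (auto simp: bump_inject split: if_splits prod.splits) (metis Suc.IH bump_inject)
qed simp

lemma rectify_ib:
  assumes "\<pi> \<in> I_Z" "inv_reduced w" "k + p + q \<le> length w"
  shows "rectify q k p (ib \<pi> w) = apsnd (ib \<pi>) (rectify q k p w)"
  using assms(2,3)
proof (induction q arbitrary: k w)
  case (Suc q)
  have "ib \<pi> w ! (k + p) < ib \<pi> w ! (k + p - 1) \<longleftrightarrow> w ! (k + p) < w ! (k + p - 1)" if p: "0 < p"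
  proof -
    let ?j = "k + p - 1"
    have j: "Suc ?j < length w" "Suc ?j = k + p" using p Suc.prems(2) by auto
    have "w ! ?j \<noteq> w ! Suc ?j" "ib \<pi> w ! ?j \<noteq> ib \<pi> w ! Suc ?j"
      using reduced_neighbours[OF Suc.prems(1) j(1)] reduced_neighbours[OF ib_reduced[OF assms(1) Suc.prems(1)]]
        j(1) length_ib[OF assms(1) Suc.prems(1)] by simp_all
    then show ?thesis using ib_ascent_iff[OF assms(1) Suc.prems(1) j(1)] unfolding j(2) by linarith
  qed
  moreover have "rectify q (Suc k) p (bump k (p - 1) (ib \<pi> w)) = apsnd (ib \<pi>) (rectify q (Suc k) p (bump k (p - 1) w))"
    using Suc.IH[of "bump k (p - 1) w" "Suc k"] Suc.prems ib_bump[OF assms(1) Suc.prems(1)] by simp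
  ultimately show ?case by (auto split: prod.splits)
qed simp

lemma rectify_Cons:
  assumes "\<beta> < last a" "a \<noteq> []"
  shows "rectify (Suc q) (length A) (length a) (A @ a @ \<beta> # C) =
    (case rectify q (Suc (length A)) (length a) (bump (length A) (length a - 1) (A @ a @ \<beta> # C)) of (r, v) \<Rightarrow> (Suc r, v))"
proof -
  have "(A @ a @ \<beta> # C) ! (length A + length a - 1) = last a" "(A @ a @ \<beta> # C) ! (length A + length a) = \<beta>"
    using assms(2) by (cases a rule: rev_cases; simp add: nth_append)+
  then show ?thesis using assms by simp
qed

text \<open>If \<open>b\<close> is empty, positive fuel would make the test compare the row with
  letters of \<open>C\<close>; this is excluded.\<close>

lemma rectify_ascent:
  assumes "a \<noteq> [] \<Longrightarrow> b \<noteq> [] \<Longrightarrow> last a \<le> hd b" "b = [] \<Longrightarrow> q = 0"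
  shows "rectify q (length A) (length a) (A @ a @ b @ C) = (0, A @ a @ b @ C)"
proof (cases q)
  case (Suc q')
  then obtain \<beta> b' where b: "b = \<beta> # b'" using assms(2) by (cases b) auto
  have "\<not> (A @ a @ b @ C) ! (length A + length a) < (A @ a @ b @ C) ! (length A + length a - 1)" if "a \<noteq> []"
    using assms(1) that b by (cases a rule: rev_cases) (auto simp: nth_append)
  then show ?thesis using Suc by auto
qed simp

lemma last_sorted: "sorted_wrt (<) (a :: int list) \<Longrightarrow> e \<in> set a \<Longrightarrow> e \<le> last a"
  by (induction a) (auto, meson last_in_set less_imp_le)

lemma bump_exists:
  assumes "sorted_wrt (<) (a :: int list)" "e \<in> set a" "\<beta> < e"
  obtains c where "c \<in> set a" "\<beta> < c" "\<And>e. e \<in> set a \<Longrightarrow> \<beta> < e \<Longrightarrow> c \<le> e"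
proof -
  let ?C = "{e \<in> set a. \<beta> < e}"
  have "finite ?C" "?C \<noteq> {}" using assms by auto
  then have "Min ?C \<in> ?C" "\<And>e. e \<in> ?C \<Longrightarrow> Min ?C \<le> e" by (rule Min_in, simp)
  then show ?thesis using that[of "Min ?C"] by auto
qed

lemma sorted_of_set: "finite X \<Longrightarrow> \<exists>xs. sorted_wrt (<) (xs :: int list) \<and> set xs = X"
  by (metis sorted_list_of_set.strict_sorted_key_list_of_set sorted_list_of_set.set_sorted_key_list_of_set)

text \<open>Moving a letter and inserting the first letter of the second word commute: both factorizations
  bump the same letter and the remaining pairs are again related by a move.\<close>

lemma insertion_step:
  assumes s: "sorted_wrt (<) a" "sorted_wrt (<) (\<beta> # b)" "sorted_wrt (<) a2" "sorted_wrt (<) b2"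
    and mv: "moves (set a) (set (\<beta> # b)) x y"
    and sets: "set a2 = set a - {x}" "set b2 = insert y (set (\<beta> # b))"
    and e: "e \<in> set a" "\<beta> < e"
    and EG: "\<not> (\<beta> \<in> set a \<and> \<beta> + 1 \<notin> set a)"
  obtains c a' a2' \<beta>2 b2' x' y' where "b2 = \<beta>2 # b2'"
    "c \<in> set a" "\<beta> < c" "\<And>e. e \<in> set a \<Longrightarrow> \<beta> < e \<Longrightarrow> c \<le> e" "\<beta> \<in> set a \<Longrightarrow> c = \<beta> + 1"
    "sorted_wrt (<) a'" "set a' = (if \<beta> \<in> set a then set a else insert \<beta> (set a - {c}))"
    "c \<in> set a2" "\<beta>2 < c" "\<And>e. e \<in> set a2 \<Longrightarrow> \<beta>2 < e \<Longrightarrow> c \<le> e" "\<beta>2 \<in> set a2 \<Longrightarrow> c = \<beta>2 + 1"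
    "sorted_wrt (<) a2'" "set a2' = (if \<beta>2 \<in> set a2 then set a2 else insert \<beta>2 (set a2 - {c}))"
    "moves (set a') (set b) x' y'" "set a2' = set a' - {x'}" "set b2' = insert y' (set b)"
proof -
  have fin: "finite (set a)" "finite (set (\<beta> # b))" by auto
  have \<beta>: "\<beta> \<in> set (\<beta> # b)" "\<And>e. e \<in> set (\<beta> # b) \<Longrightarrow> \<beta> \<le> e" using s(2) by auto
  have bb: "set (\<beta> # b) - {\<beta>} = set b" using s(2) by auto
  note ctx = fin \<beta> mv
  obtain c where c: "c \<in> set a" "\<beta> < c" "\<And>e. e \<in> set a \<Longrightarrow> \<beta> < e \<Longrightarrow> c \<le> e"
    using bump_exists[OF s(1) e] by blast
  have cE: "c = \<beta> + 1" if "\<beta> \<in> set a" using EG that c(2) c(3)[of "\<beta> + 1"] by force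
  obtain a' where a': "sorted_wrt (<) a'" "set a' = (if \<beta> \<in> set a then set a else insert \<beta> (set a - {c}))"
  proof -
    have "finite (if \<beta> \<in> set a then set a else insert \<beta> (set a - {c}))" by simp
    then show ?thesis using that sorted_of_set by blast
  qed
  have b2: "\<exists>b2'. b2 = m # b2' \<and> set b2' = set b2 - {m}"
    if "m \<in> set b2" "\<And>e. e \<in> set b2 \<Longrightarrow> m \<le> e" for m
  proof (cases b2)
    case (Cons h t)
    then have "m = h" using that s(4) by (auto simp: order.antisym dest: less_imp_le)
    then show ?thesis using Cons s(4) by auto
  qed (use that in auto)
  consider "x < \<beta>" | "x = \<beta>" | "\<beta> < x" by linarith
  then show ?thesis
  proof cases
    case 1
    note m = moves_below[OF ctx 1] and m' = moves_insert_below[OF ctx 1 c]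
    \<comment> \<open>Here \<open>y = x\<close>, so the moved letter becomes the first one to be
      inserted. The gap after \<open>x\<close> guarantees that it bumps the same
      \<open>c\<close>.\<close>
    obtain b2' where b2': "b2 = x # b2'" "set b2' = set b2 - {x}"
      using b2[of x] sets(2) m(1) \<beta>(2) 1 by (force simp: less_imp_le)
    obtain a2' where a2': "sorted_wrt (<) a2'" "set a2' = insert x (set a2 - {c})"
      using sorted_of_set[of "insert x (set a2 - {c})"] by auto
    have 2: "\<And>e. e \<in> set a2 \<Longrightarrow> x < e \<Longrightarrow> c \<le> e" using sets(1) m(3) c(3) by blast
    have 3: "set a2' = set a' - {\<beta>}" using a'(2) a2'(2) sets(1) m(2) moves_in[OF mv] 1 c(2) by auto
    have 4: "set b2' = insert \<beta> (set b)" using b2'(2) sets(2) m(1) \<beta> 1 s(2) by auto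
    show ?thesis
      by (rule that[OF b2'(1) c cE a' _ _ 2 _ a2'(1) _ _ 3 4])
        (use c 1 sets(1) a2'(2) m' bb m(2) a'(2) in auto)
  next
    case 2
    note m = moves_insert_at[OF ctx 2]
    \<comment> \<open>Both sides insert \<open>\<beta>\<close>: into \<open>a\<close> by the
      exceptional rule, into \<open>a2\<close>, which has lost \<open>\<beta>\<close>, by replacing
      \<open>\<beta> + 1\<close>.\<close>
    obtain b2' where b2': "b2 = \<beta> # b2'" "set b2' = set b2 - {\<beta>}"
      using b2[of \<beta>] sets(2) \<beta> m(1) 2 by (force simp: less_imp_le)
    obtain a2' where a2': "sorted_wrt (<) a2'" "set a2' = insert \<beta> (set a2 - {c})"
      using sorted_of_set[of "insert \<beta> (set a2 - {c})"] by auto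
    have xa: "\<beta> \<in> set a" using moves_in[OF mv] 2 by blast
    have cc: "c = \<beta> + 1" using cE xa by blast
    have 3: "set a2' = set a' - {x + 1}" using a'(2) a2'(2) sets(1) 2 xa cc by auto
    have 4: "set b2' = insert y (set b)" using b2'(2) sets(2) m(1) 2 s(2) by auto
    show ?thesis
      by (rule that[OF b2'(1) c cE a' _ c(2) _ _ a2'(1) _ _ 3 4])
        (use c 2 sets(1) a2'(2) m(3) bb xa a'(2) in auto)
  next
    case 3
    have xy: "x \<le> y" using mv by (simp add: moves_def)
    obtain b2' where b2': "b2 = \<beta> # b2'" "set b2' = set b2 - {\<beta>}"
      using b2[of \<beta>] sets(2) \<beta> 3 xy by (force simp: less_imp_le)
    have 4: "set b2' = insert y (set b)" using b2'(2) sets(2) 3 xy s(2) by auto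
    show ?thesis
    proof (cases "\<beta> \<in> set a")
      case True
      note m = moves_insert_above_old[OF ctx 3 True]
      have cc: "c = \<beta> + 1" using cE True by blast
      have 5: "set a2 = set a' - {x}" using a'(2) sets(1) True by auto
      show ?thesis
        by (rule that[OF b2'(1) c cE a' _ c(2) _ _ s(3) _ _ 5 4])
          (use c 3 sets(1) m bb True a'(2) cc in auto)
    next
      case False
      note m = moves_insert_above_new[OF ctx 3 False c]
      obtain a2' where a2': "sorted_wrt (<) a2'" "set a2' = insert \<beta> (set a2 - {c})"
        using sorted_of_set[of "insert \<beta> (set a2 - {c})"] by auto
      have 5: "set a2' = set a' - {x}" using a'(2) a2'(2) sets(1) False 3 by auto
      show ?thesis
        by (rule that[OF b2'(1) c cE a' _ c(2) _ _ a2'(1) _ _ 5 4])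
          (use c 3 sets(1) a2'(2) m bb False a'(2) in auto)
    qed
  qed
qed

lemma EG_not_reduced:
  assumes "sorted_wrt (<) a" "\<beta> \<in> set a" "\<beta> + 1 \<notin> set a"
  shows "\<not> inv_reduced (A @ a @ \<beta> # C)"
  using run_not_reduced[OF assms(1), of "[\<beta>]" \<beta> \<beta> A C] assms(2,3) by simp

text \<open>Without a descent between the factors, the last letter of \<open>a\<close> is the
  leftmost maximum. The move only shifts the boundary between the factors and leaves the
  concatenation unchanged.\<close>

lemma moves_no_bump:
  assumes s: "sorted_wrt (<) a" "sorted_wrt (<) b" "sorted_wrt (<) a2" "sorted_wrt (<) b2"
    and mv: "moves (set a) (set b) x y" and sets: "set a2 = set a - {x}" "set b2 = insert y (set b)"
    and nb: "\<And>e f. e \<in> set a \<Longrightarrow> f \<in> set b \<Longrightarrow> e \<le> f"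
  shows "a = a2 @ [x]" "b2 = x # b"
proof -
  have xa: "x \<in> set a" "y \<in> set a" "x \<le> y" "{x..<y} \<subseteq> set b" "y \<notin> set b"
    using moves_in[OF mv] mv by (auto simp: moves_def)
  have yx: "y = x"
  proof (rule ccontr)
    assume "y \<noteq> x"
    then have "x \<in> set b" "x < y" using xa(3,4) by auto
    then show False using nb[of y x] xa(2) by force
  qed
  have lt: "x < f" if "f \<in> set b" for f using nb[OF xa(1) that] xa(5) yx that by (cases "x = f") auto
  have max: "e \<le> x" if e: "e \<in> set a" for e
  proof (rule ccontr)
    assume "\<not> e \<le> x"
    then have "cnt (set a) x < cnt (set a) e" using cnt_less[of "set a" e x e] e by simp
    moreover have "cnt (set b) (e - 1) = 0" using nb[OF e] by (intro cnt_empty) force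
    moreover have "cnt (set b) (x - 1) = 0" using lt by (intro cnt_empty) force
    ultimately have "S (set a) (set b) x < S (set a) (set b) e" by (simp add: S_def)
    then show False using mv by (simp add: moves_def not_le[symmetric])
  qed
  show "a = a2 @ [x]"
  proof (rule sorted_list_eq[OF s(1)])
    have "e < x" if "e \<in> set a2" for e using max[of e] that sets(1) by (cases "e = x") auto
    then show "sorted_wrt (<) (a2 @ [x])" using s(3) by (simp add: sorted_wrt_append)
  qed (use sets(1) xa(1) in auto)
  show "b2 = x # b"
    by (rule sorted_list_eq[OF s(4)]) (use s(2) lt sets(2) yx in auto)
qed

text \<open>Rectification does not see a move; the additional unit of fuel matches the longer second
  factor. Reducedness is carried along the same insertions, since it is needed to exclude invalid
  ones.\<close>

lemma rectify_move:
  assumes "sorted_wrt (<) a" "sorted_wrt (<) b" "sorted_wrt (<) a2" "sorted_wrt (<) b2"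
    "moves (set a) (set b) x y" "set a2 = set a - {x}" "set b2 = insert y (set b)"
  shows "inv_reduced (A @ a2 @ b2 @ C) = inv_reduced (A @ a @ b @ C) \<and>
    (inv_reduced (A @ a @ b @ C) \<longrightarrow>
      rectify (Suc (length b)) (length A) (length a2) (A @ a2 @ b2 @ C)
      = rectify (length b) (length A) (length a) (A @ a @ b @ C))"
  using assms
proof (induction b arbitrary: a a2 b2 x y A)
  case Nil
  have e: "a = a2 @ [x]" "b2 = [x]" by (rule moves_no_bump[OF Nil]; simp)+
  have "last a2 \<le> x" if "a2 \<noteq> []"
    using last_in_set[OF that] Nil(1) unfolding e(1) sorted_wrt_append by (simp add: less_imp_le)
  then have "rectify (Suc 0) (length A) (length a2) (A @ a2 @ b2 @ C) = (0, A @ a2 @ b2 @ C)"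
    by (intro rectify_ascent) (simp_all add: e(2))
  moreover have "A @ a2 @ b2 @ C = A @ a @ [] @ C" by (simp add: e)
  ultimately show ?case by (metis list.size(3) rectify.simps(1))
next
  case (Cons \<beta> b)
  note s = Cons.prems(1-4) and mv = Cons.prems(5) and sets = Cons.prems(6,7)
  show ?case
  proof (cases "\<exists>e \<in> set a. \<beta> < e")
    case False
    then have "\<And>e f. e \<in> set a \<Longrightarrow> f \<in> set (\<beta> # b) \<Longrightarrow> e \<le> f" using s(2) by fastforce
    then have e: "a = a2 @ [x]" "b2 = x # \<beta> # b" using moves_no_bump[OF Cons.prems] by blast+
    have 1: "last a2 \<le> x" if "a2 \<noteq> []"
      using last_in_set[OF that] s(1) unfolding e(1) sorted_wrt_append by (simp add: less_imp_le)
    have 2: "x \<le> \<beta>" using s(4) e(2) by auto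
    have "rectify (Suc (length (\<beta> # b))) (length A) (length a2) (A @ a2 @ b2 @ C) = (0, A @ a2 @ b2 @ C)"
      by (rule rectify_ascent) (use 1 e(2) in simp_all)
    moreover have "rectify (length (\<beta> # b)) (length A) (length a) (A @ a @ (\<beta> # b) @ C) = (0, A @ a @ (\<beta> # b) @ C)"
      by (rule rectify_ascent) (use 2 e(1) in simp_all)
    moreover have "A @ a2 @ b2 @ C = A @ a @ (\<beta> # b) @ C" by (simp add: e)
    ultimately show ?thesis by metis
  next
    case True
    then obtain e where e: "e \<in> set a" "\<beta> < e" by blast
    have \<beta>: "\<beta> \<in> set (\<beta> # b)" "\<And>e. e \<in> set (\<beta> # b) \<Longrightarrow> \<beta> \<le> e" using s(2) by auto
    show ?thesis
    proof (cases "\<beta> \<in> set a \<and> \<beta> + 1 \<notin> set a")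
      case EG: True
      \<comment> \<open>The exceptional insertion is impossible because \<open>\<beta> + 1\<close>
        is missing. The move does not affect these letters, so both words contain the forbidden
        pattern.\<close>
      have "\<not> x < \<beta>" "x \<noteq> \<beta>"
        using moves_below(2)[OF _ _ \<beta> mv] moves_insert_at(2)[OF _ _ \<beta> mv] EG by auto
      then have x: "\<beta> < x" "x \<le> y" using mv by (auto simp: moves_def)
      obtain h b2' where b2: "b2 = h # b2'" using sets(2) by (cases b2) auto
      have "h = \<beta>"
      proof -
        have m: "\<beta> \<in> set b2" "h \<in> set b2" using sets(2) b2 by auto
        then have "h = y \<or> h \<in> set (\<beta> # b)" using sets(2) by blast
        then have "\<beta> \<le> h" using \<beta>(2)[of h] x by auto
        moreover have "h \<le> \<beta>" using m(1) s(4) b2 by auto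
        ultimately show ?thesis by simp
      qed
      moreover have "\<beta> \<in> set a2" "\<beta> + 1 \<notin> set a2" using sets(1) EG x by auto
      ultimately have "\<not> inv_reduced (A @ a2 @ b2 @ C)" using EG_not_reduced[OF s(3), of \<beta> A "b2' @ C"] b2 by simp
      moreover have "\<not> inv_reduced (A @ a @ (\<beta> # b) @ C)" using EG_not_reduced[OF s(1), of \<beta> A "b @ C"] EG by simp
      ultimately show ?thesis by blast
    next
      case False
      obtain c a' a2' \<beta>2 b2' x' y' where b2: "b2 = \<beta>2 # b2'"
        and i1: "c \<in> set a" "\<beta> < c" "\<And>e. e \<in> set a \<Longrightarrow> \<beta> < e \<Longrightarrow> c \<le> e" "\<beta> \<in> set a \<Longrightarrow> c = \<beta> + 1"
         "sorted_wrt (<) a'" "set a' = (if \<beta> \<in> set a then set a else insert \<beta> (set a - {c}))"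
        and i2: "c \<in> set a2" "\<beta>2 < c" "\<And>e. e \<in> set a2 \<Longrightarrow> \<beta>2 < e \<Longrightarrow> c \<le> e" "\<beta>2 \<in> set a2 \<Longrightarrow> c = \<beta>2 + 1"
         "sorted_wrt (<) a2'" "set a2' = (if \<beta>2 \<in> set a2 then set a2 else insert \<beta>2 (set a2 - {c}))"
        and mv': "moves (set a') (set b) x' y'" "set a2' = set a' - {x'}" "set b2' = insert y' (set b)"
        by (rule insertion_step[OF s mv sets e False]) (rule that)
      have B1: "bump (length A) (length a - 1) (A @ a @ \<beta> # b @ C) = (A @ [c]) @ a' @ b @ C"
        using bump_insert[OF s(1) i1] by simp
      have B2: "bump (length A) (length a2 - 1) (A @ a2 @ \<beta>2 # b2' @ C) = (A @ [c]) @ a2' @ b2' @ C"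
        using bump_insert[OF s(3) i2] by simp
      have l1: "length a' = length a" using arg_cong[OF B1, of length] by simp
      have l2: "length a2' = length a2" using arg_cong[OF B2, of length] by simp
      have sb: "sorted_wrt (<) b" "sorted_wrt (<) b2'" using s(2,4) b2 by auto
      note IH = Cons.IH[OF i1(5) sb(1) i2(5) sb(2) mv', of "A @ [c]"]
      have "inv_reduced (A @ a2 @ b2 @ C) = inv_reduced ((A @ [c]) @ a2' @ b2' @ C)"
        using B2 bump_reduced b2 by (metis append_Cons)
      moreover have "inv_reduced (A @ a @ (\<beta> # b) @ C) = inv_reduced ((A @ [c]) @ a' @ b @ C)"
        using B1 bump_reduced by (metis append_Cons)
      moreover have "rectify (length (\<beta> # b)) (length A) (length a) (A @ a @ (\<beta> # b) @ C) =
         (case rectify (length b) (length (A @ [c])) (length a') ((A @ [c]) @ a' @ b @ C) of (r, v) \<Rightarrow> (Suc r, v))"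
        using rectify_Cons[of \<beta> a "length b" A "b @ C"] i1(1,2) last_sorted[OF s(1) i1(1)] B1 l1 by force
      moreover have "rectify (Suc (length (\<beta> # b))) (length A) (length a2) (A @ a2 @ b2 @ C) =
         (case rectify (Suc (length b)) (length (A @ [c])) (length a2') ((A @ [c]) @ a2' @ b2' @ C) of (r, v) \<Rightarrow> (Suc r, v))"
      proof -
        have "\<beta>2 < last a2" "a2 \<noteq> []" using i2(1,2) last_sorted[OF s(3) i2(1)] by auto
        from rectify_Cons[OF this, of "Suc (length b)" A "b2' @ C"] show ?thesis
          unfolding B2 by (simp del: rectify.simps add: b2 l2)
      qed
      ultimately show ?thesis using IH by simp
    qed
  qed
qed

text \<open>The number of insertions is \<open>length a\<close> minus the maximum of the profile:
  each insertion raises the maximum by one, and when none is possible it equals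
  \<open>length a\<close>. The two one-sided bounds for a parameter \<open>m\<close> express this;
  \<open>m = 0\<close> and \<open>m = 1\<close> decide whether the lowering operator is
  defined.\<close>

lemma rectify_count:
  assumes "sorted_wrt (<) a" "sorted_wrt (<) b" "inv_reduced (A @ a @ b @ C)"
  shows "((\<forall>z. S (set a) (set b) z \<le> int m) \<longrightarrow>
      length a \<le> fst (rectify (length b) (length A) (length a) (A @ a @ b @ C)) + m) \<and>
    ((\<exists>z. int m \<le> S (set a) (set b) z) \<longrightarrow>
      fst (rectify (length b) (length A) (length a) (A @ a @ b @ C)) + m \<le> length a)"
  using assms
proof (induction b arbitrary: a A m)
  case Nil
  have "S (set a) {} z = cnt (set a) z" for z by (simp add: S_def cnt_def)
  moreover have "cnt (set a) z \<le> int (length a)" for z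
    using cnt_le_card[of "set a" z] length_sorted[OF Nil(1)] by simp
  moreover have "\<exists>z. cnt (set a) z = int (length a)"
  proof (cases "a = []")
    case False
    have "cnt (set a) (last a) = int (length a)"
      using cnt_all[of "set a" "last a"] last_sorted[OF Nil(1)] length_sorted[OF Nil(1)] by simp
    then show ?thesis by blast
  qed (simp add: cnt_def)
  ultimately show ?case by (auto, (metis of_nat_le_iff)+, smt (verit) of_nat_le_iff)
next
  case (Cons \<beta> b)
  note s = Cons.prems(1,2) and red = Cons.prems(3)
  let ?S = "S (set a) (set (\<beta> # b))"
  have sb: "sorted_wrt (<) b" "\<And>e. e \<in> set b \<Longrightarrow> \<beta> < e" using s(2) by auto
  have bb: "set (\<beta> # b) - {\<beta>} = set b" using sb by auto
  have \<beta>: "\<beta> \<in> set (\<beta> # b)" by simp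
  have fin: "finite (set a)" "finite (set (\<beta> # b))" by auto
  have low: "cnt (set (\<beta> # b)) z = 0" if "z < \<beta>" for z using sb(2) that by (intro cnt_empty) force
  show ?case
  proof (cases "\<exists>e \<in> set a. \<beta> < e")
    case False
    have "last a \<le> \<beta>" if "a \<noteq> []" using False last_in_set[OF that] by force
    then have r: "rectify (length (\<beta> # b)) (length A) (length a) (A @ a @ (\<beta> # b) @ C) = (0, A @ a @ (\<beta> # b) @ C)"
      by (intro rectify_ascent) auto
    have le: "?S z \<le> int (length a)" for z
      using cnt_le_card[of "set a" z] length_sorted[OF s(1)] cnt_nonneg[of "set (\<beta> # b)" "z - 1"] by (simp add: S_def)
    have "\<exists>z. ?S z = int (length a)"
    proof -
      have "cnt (set a) \<beta> = int (length a)"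
        using cnt_all[of "set a" \<beta>] False length_sorted[OF s(1)] by (simp add: not_less)
      then show ?thesis using low[of "\<beta> - 1"] unfolding S_def by (intro exI[of _ \<beta>]) simp
    qed
    then show ?thesis using le unfolding r by (metis add_0 fst_conv of_nat_le_iff order_trans)
  next
    case True
    then obtain e where e: "e \<in> set a" "\<beta> < e" by blast
    obtain c where c: "c \<in> set a" "\<beta> < c" "\<And>e. e \<in> set a \<Longrightarrow> \<beta> < e \<Longrightarrow> c \<le> e"
      using bump_exists[OF s(1) e] by blast
    have EG: "\<beta> + 1 \<in> set a" if "\<beta> \<in> set a"
      using EG_not_reduced[OF s(1) that, of A "b @ C"] red by auto
    have cE: "c = \<beta> + 1" if "\<beta> \<in> set a" using EG[OF that] c(2) c(3)[of "\<beta> + 1"] by force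
    obtain a' where a': "sorted_wrt (<) a'" "set a' = (if \<beta> \<in> set a then set a else insert \<beta> (set a - {c}))"
    proof -
      have "finite (if \<beta> \<in> set a then set a else insert \<beta> (set a - {c}))" by simp
      then show ?thesis using that sorted_of_set by blast
    qed
    have B: "bump (length A) (length a - 1) (A @ a @ \<beta> # b @ C) = (A @ [c]) @ a' @ b @ C"
      using bump_insert[OF s(1) c cE a'] by simp
    have l: "length a' = length a" using arg_cong[OF B, of length] by simp
    have "inv_reduced ((A @ [c]) @ a' @ b @ C)" using red B bump_reduced by (metis append_Cons)
    note IH = Cons.IH[OF a'(1) sb(1) this, of "Suc m", unfolded l]
    have r: "fst (rectify (length (\<beta> # b)) (length A) (length a) (A @ a @ (\<beta> # b) @ C)) =
       Suc (fst (rectify (length b) (length (A @ [c])) (length a) ((A @ [c]) @ a' @ b @ C)))"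
      using rectify_Cons[of \<beta> a "length b" A "b @ C"] c(1,2) last_sorted[OF s(1) c(1)] B
      by (fastforce split: prod.splits)
    have gap: "?S z < ?S \<beta>" if "\<beta> < z" "z < c" for z
      by (rule S_gap[OF fin(2) \<beta> _ that]) (use c(3) in blast)
    have new: "S (set a') (set b) z = ?S z + (if \<beta> \<le> z then 1 else 0) + (if \<beta> < z then 1 else 0) - (if c \<le> z then 1 else 0)"
      if "\<beta> \<notin> set a" for z
      using S_insert_new[OF fin \<beta> that c(1,2), of z] bb a'(2) that by simp
    have old: "S (set a') (set b) z = ?S z + (if \<beta> < z then 1 else 0)" if "\<beta> \<in> set a" for z
      using S_insert_old[OF fin(2) \<beta>, of "set a" z] bb a'(2) that by simp
    have up: "S (set a') (set b) z \<le> int (Suc m)" if "\<And>z. ?S z \<le> int m" for z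
    proof (cases "\<beta> \<in> set a")
      case True
      then show ?thesis using old[of z] that[of z] by simp
    next
      case False
      then show ?thesis using new[of z] that[of z] that[of \<beta>] gap[of z] c(2)
        by (cases "z < \<beta>"; cases "z = \<beta>"; cases "z < c") auto
    qed
    have down: "\<exists>z. int (Suc m) \<le> S (set a') (set b) z" if "int m \<le> ?S z" for z
    proof (cases "z < \<beta>")
      case True
      \<comment> \<open>Before \<open>\<beta>\<close> the second word contributes nothing, so
        \<open>\<beta>\<close> is at least as good a witness.\<close>
      have "?S z \<le> ?S \<beta>"
        using cnt_mono[of "set a" z \<beta>] low[of "z - 1"] low[of "\<beta> - 1"] True by (simp add: S_def)
      then have m: "int m \<le> ?S \<beta>" using that by simp
      show ?thesis
      proof (cases "\<beta> \<in> set a")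
        case True
        \<comment> \<open>An exceptional insertion gains height only strictly to the right of
          \<open>\<beta>\<close>, so the witness moves to \<open>\<beta> + 1\<close>, which has the
          same height before.\<close>
        have "?S (\<beta> + 1) = ?S \<beta>" using S_step[OF fin, of \<beta>] EG[OF True] by simp
        then show ?thesis using old[OF True, of "\<beta> + 1"] m by (intro exI[of _ "\<beta> + 1"]) simp
      next
        case False
        then show ?thesis using new[OF False, of \<beta>] m c(2) by (intro exI[of _ \<beta>]) simp
      qed
    next
      case False
      show ?thesis
      proof (cases "\<beta> \<in> set a")
        case True
        show ?thesis
        proof (cases "z = \<beta>")
          case z: True
          have "?S (\<beta> + 1) = ?S \<beta>" using S_step[OF fin, of \<beta>] EG[OF True] by simp
          then show ?thesis using old[OF True, of "\<beta> + 1"] that z by (intro exI[of _ "\<beta> + 1"]) simp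
        next
          case z: False
          then show ?thesis using old[OF True, of z] that False by (intro exI[of _ z]) simp
        qed
      next
        case na: False
        then show ?thesis using new[OF na, of z] that False c(2) by (intro exI[of _ z]) auto
      qed
    qed
    show ?thesis using IH up down unfolding r by fastforce
  qed
qed

section \<open>Crystal operators on a pair of neighbouring factors\<close>

definition letter_move :: "int list \<Rightarrow> int list \<Rightarrow> int list \<Rightarrow> int list \<Rightarrow> bool" where
  "letter_move a b a2 b2 \<longleftrightarrow> sorted_wrt (<) a \<and> sorted_wrt (<) b \<and> sorted_wrt (<) a2 \<and> sorted_wrt (<) b2 \<and>
    (\<exists>x y. moves (set a) (set b) x y \<and> set a2 = set a - {x} \<and> set b2 = insert y (set b))"

definition pair_f :: "int list \<Rightarrow> int list \<Rightarrow> (int list \<times> int list) option" where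
  "pair_f a b = (let UA = fst (unpaired a b) in if UA = {} then None else
     (let x = Max UA; y = (LEAST y. x \<le> y \<and> y \<notin> set b) in Some (remove1 x a, insort y b)))"

definition pair_e :: "int list \<Rightarrow> int list \<Rightarrow> (int list \<times> int list) option" where
  "pair_e a b = (let UB = snd (unpaired a b) in if UB = {} then None else
     (let y = Min UB; x = (GREATEST x. x \<le> y \<and> x \<notin> set a) in Some (insort x a, remove1 y b)))"

lemma unpaired_props:
  assumes "sorted_wrt (<) a" "sorted_wrt (<) b" "unpaired a b = (UA, UB)"
  shows "UA \<subseteq> set a" "UB \<subseteq> set b"
    "UA = {} \<longleftrightarrow> (\<forall>z. S (set a) (set b) z \<le> 0)"
    "UA \<noteq> {} \<Longrightarrow> z < Max UA \<Longrightarrow> S (set a) (set b) z < S (set a) (set b) (Max UA)"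
    "UA \<noteq> {} \<Longrightarrow> S (set a) (set b) z \<le> S (set a) (set b) (Max UA)"
    "UB = {} \<longleftrightarrow> (\<forall>z. S (set a) (set b) z \<le> int (length a) - int (length b))"
    "UB \<noteq> {} \<Longrightarrow> Min UB < z \<Longrightarrow> S (set a) (set b) z < S (set a) (set b) (Min UB)"
    "UB \<noteq> {} \<Longrightarrow> S (set a) (set b) z \<le> S (set a) (set b) (Min UB)"
proof -
  have "sort b = b" using assms(2) by (simp add: sort_key_id_if_sorted strict_sorted_iff)
  then have p: "pair_aux (rev b) (set a) = (UA, UB)" using assms(3) by (simp add: unpaired_def)
  have "sorted_wrt (>) (rev b)" using assms(2) by (simp add: sorted_wrt_rev)
  from pair_aux_props[OF _ this p, simplified, folded length_sorted[OF assms(1)]]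
  show "UA \<subseteq> set a" "UB \<subseteq> set b"
    "UA = {} \<longleftrightarrow> (\<forall>z. S (set a) (set b) z \<le> 0)"
    "UA \<noteq> {} \<Longrightarrow> z < Max UA \<Longrightarrow> S (set a) (set b) z < S (set a) (set b) (Max UA)"
    "UA \<noteq> {} \<Longrightarrow> S (set a) (set b) z \<le> S (set a) (set b) (Max UA)"
    "UB = {} \<longleftrightarrow> (\<forall>z. S (set a) (set b) z \<le> int (length a) - int (length b))"
    "UB \<noteq> {} \<Longrightarrow> Min UB < z \<Longrightarrow> S (set a) (set b) z < S (set a) (set b) (Min UB)"
    "UB \<noteq> {} \<Longrightarrow> S (set a) (set b) z \<le> S (set a) (set b) (Min UB)"
    by blast+
qed

lemma sorted_remove1: "sorted_wrt (<) (a :: int list) \<Longrightarrow> sorted_wrt (<) (remove1 x a) \<and> set (remove1 x a) = set a - {x}"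
  by (simp add: strict_sorted_iff sorted_remove1 distinct_remove1 set_remove1_eq)

lemma sorted_insort_new: "sorted_wrt (<) (b :: int list) \<Longrightarrow> y \<notin> set b \<Longrightarrow> sorted_wrt (<) (insort y b) \<and> set (insort y b) = insert y (set b)"
  by (simp add: strict_sorted_iff sorted_insort distinct_insort set_insort_key)

lemma bounded_ex:
  assumes "P (x :: int)" "\<not> P y" "x \<le> y"
  shows "\<exists>m. x \<le> m \<and> m < y \<and> (\<forall>z. x \<le> z \<and> z \<le> m \<longrightarrow> P z) \<and> \<not> P (m + 1)"
  using assms
proof (induction "nat (y - x)" arbitrary: x)
  case (Suc n)
  show ?case
  proof (cases "P (x + 1)")
    case True
    then have "x + 1 \<le> y" using Suc.prems Suc.hyps(2) by (cases "x = y") auto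
    moreover have nat_diff: "n = nat (y - (x + 1))" using Suc.hyps(2) by linarith
    ultimately obtain m where m: "x + 1 \<le> m" "m < y" "\<forall>z. x + 1 \<le> z \<and> z \<le> m \<longrightarrow> P z" "\<not> P (m + 1)"
      using Suc.hyps(1)[of "x + 1"] Suc.hyps(2) True Suc.prems nat_diff by auto
    have "P z" if "x \<le> z" "z \<le> m" for z using m(3) Suc.prems(1) that by (cases "z = x") auto
    then show ?thesis using m by (intro exI[of _ m]) auto
  next
    case False
    moreover have "x < y" using Suc.hyps(2) by linarith
    moreover have "P z" if "x \<le> z" "z \<le> x" for z using that Suc.prems(1) by simp
    ultimately show ?thesis by (intro exI[of _ x]) auto
  qed
qed auto

lemma S_plateau:
  assumes "finite a" "finite b" "{x<..y} \<subseteq> a" "{x..<y} \<subseteq> b" "x \<le> z" "z \<le> y"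
  shows "S a b z = S a b x"
  using assms(5,6)
proof (induction z rule: int_ge_induct)
  case (step z)
  then have "z + 1 \<in> a" "z \<in> b" using assms(3,4) by auto
  then show ?case using S_step[OF assms(1,2), of z] step by simp
qed simp

lemma S_zero:
  assumes "finite a" "finite b" shows "\<exists>z<y. S a b z = 0"
proof -
  let ?z = "Min (insert y (a \<union> b)) - 1"
  have z: "?z < e" if "e \<in> insert y (a \<union> b)" for e
  proof -
    have "Min (insert y (a \<union> b)) \<le> e" using assms that by (intro Min_le) auto
    then show ?thesis by linarith
  qed
  have "cnt a ?z = 0" "cnt b (?z - 1) = 0" by (intro cnt_empty; use z in force)+
  then show ?thesis unfolding S_def using z by (intro exI[of _ ?z]) simp
qed

lemma S_limit:
  assumes "finite a" "finite b" shows "\<exists>z>y. S a b z = int (card a) - int (card b)"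
proof -
  let ?z = "Max (insert y (a \<union> b)) + 1"
  have z: "e < ?z" if "e \<in> insert y (a \<union> b)" for e using Max_ge[of "insert y (a \<union> b)" e] assms that by simp
  have "cnt a ?z = int (card a)" "cnt b (?z - 1) = int (card b)" by (intro cnt_all; use z in force)+
  then show ?thesis unfolding S_def using z by (intro exI[of _ ?z]) simp
qed

lemma pair_f_None_iff:
  assumes "sorted_wrt (<) a" "sorted_wrt (<) b"
  shows "pair_f a b = None \<longleftrightarrow> (\<forall>z. S (set a) (set b) z \<le> 0)"
  using unpaired_props(3)[OF assms] by (cases "unpaired a b") (auto simp: pair_f_def Let_def)

text \<open>The profile rises at \<open>x\<close>, hence \<open>x - 1\<close> is not in
  \<open>b\<close>. If the run of \<open>a\<close> broke off after some \<open>m\<close> before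
  reaching \<open>y\<close>, the letters from \<open>x\<close> to \<open>m\<close> would be a common
  run with \<open>m + 1\<close> missing from \<open>a\<close>, contradicting reducedness.\<close>

lemma pair_f_Some:
  assumes s: "sorted_wrt (<) a" "sorted_wrt (<) b" and red: "inv_reduced (A @ a @ b @ C)"
    and f: "pair_f a b = Some (a2, b2)"
  shows "letter_move a b a2 b2"
proof -
  obtain UA UB where U: "unpaired a b = (UA, UB)" by fastforce
  note p = unpaired_props[OF s U]
  let ?S = "S (set a) (set b)"
  define x where "x = Max UA"
  define y where "y = (LEAST y. x \<le> y \<and> y \<notin> set b)"
  have ne: "UA \<noteq> {}" and a2: "a2 = remove1 x a" and b2: "b2 = insort y b"
    using f U by (auto simp: pair_f_def Let_def x_def y_def split: if_splits)
  have xa: "x \<in> set a" using p(1) Max_in[OF _ ne] finite_subset[OF p(1)] by (auto simp: x_def)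
  have lt: "?S z < ?S x" if "z < x" for z using p(4)[OF ne] that by (simp add: x_def)
  have le: "?S z \<le> ?S x" for z using p(5)[OF ne] by (simp add: x_def)
  obtain y' where y': "x \<le> y'" "y' \<notin> set b" "{x..<y'} \<subseteq> set b"
  proof (cases "x \<in> set b")
    case True
    define h where "h = Max (set b) + 1"
    have "h \<notin> set b" using Max_ge[of "set b" h] by (auto simp: h_def)
    moreover have "x \<le> Max (set b)" using True by (intro Max_ge) auto
    then have "x \<le> h" unfolding h_def by linarith
    ultimately obtain m where m: "x \<le> m" "\<forall>z. x \<le> z \<and> z \<le> m \<longrightarrow> z \<in> set b" "m + 1 \<notin> set b"
      using bounded_ex[of "\<lambda>z. z \<in> set b" x h] True by auto
    have "{x..<m + 1} \<subseteq> set b"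
    proof
      fix z assume "z \<in> {x..<m + 1}"
      then show "z \<in> set b" using m(2)[rule_format, of z] by simp
    qed
    then show ?thesis using that[of "m + 1"] m by simp
  next
    case False
    then show ?thesis using that[of x] by simp
  qed
  have yy: "y = y'" unfolding y_def
    by (rule Least_equality) (use y' in \<open>auto simp: not_less[symmetric]\<close>)
  have x1: "x - 1 \<notin> set b"
    using S_step[of "set a" "set b" "x - 1"] lt[of "x - 1"] xa by (auto split: if_splits)
  have "{x..y} \<subseteq> set a"
  proof (rule ccontr)
    assume "\<not> ?thesis"
    then obtain h where "h \<in> {x..y}" "h \<notin> set a" by blast
    then have h: "x \<le> h" "h \<le> y" "h \<notin> set a" by auto
    then obtain m where m: "x \<le> m" "m < h" "\<forall>z. x \<le> z \<and> z \<le> m \<longrightarrow> z \<in> set a" "m + 1 \<notin> set a"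
      using bounded_ex[of "\<lambda>z. z \<in> set a" x h] xa by auto
    have "{x..m} \<subseteq> set a" "{x..m} \<subseteq> set b" using m h y' yy by auto
    then show False using run_not_reduced[OF s m(1) _ _ m(4) x1] red by blast
  qed
  then have "moves (set a) (set b) x y" unfolding moves_def using y' yy lt le by auto
  then show ?thesis unfolding letter_move_def a2 b2
    using sorted_remove1[OF s(1)] sorted_insort_new[OF s(2)] s y' yy by blast
qed

lemma pair_f_of_move:
  assumes "letter_move a b a2 b2" shows "pair_f a b = Some (a2, b2)"
proof -
  obtain x y where mv: "moves (set a) (set b) x y" and sets: "set a2 = set a - {x}" "set b2 = insert y (set b)"
    and s: "sorted_wrt (<) a" "sorted_wrt (<) b" "sorted_wrt (<) a2" "sorted_wrt (<) b2"
    using assms unfolding letter_move_def by blast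
  obtain UA UB where U: "unpaired a b = (UA, UB)" by fastforce
  note p = unpaired_props[OF s(1,2) U]
  let ?S = "S (set a) (set b)"
  have lt: "?S z < ?S x" if "z < x" for z using mv that by (simp add: moves_def)
  have le: "?S z \<le> ?S x" for z using mv by (simp add: moves_def)
  have "0 < ?S x" using S_zero[of "set a" "set b" x] lt by fastforce
  then have ne: "UA \<noteq> {}" using p(3) by (auto simp: not_le[symmetric])
  have "Max UA = x"
    using p(4)[OF ne, of x] p(5)[OF ne, of x] lt[of "Max UA"] le[of "Max UA"] by linarith
  moreover have "(LEAST y. x \<le> y \<and> y \<notin> set b) = y"
    by (rule Least_equality) (use mv in \<open>auto simp: moves_def not_less[symmetric] subset_iff\<close>)
  moreover have "remove1 x a = a2" using sorted_remove1[OF s(1), of x] sets s by (intro sorted_list_eq) auto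
  moreover have "insort y b = b2"
    using sorted_insort_new[OF s(2), of y] mv sets s by (intro sorted_list_eq) (auto simp: moves_def)
  ultimately show ?thesis using U ne by (simp add: pair_f_def Let_def)
qed

text \<open>The move lowers the profile by one from \<open>x\<close> on and once more after
  \<open>y\<close>. It was constant from \<open>x\<close> to \<open>y\<close>, so \<open>y\<close>
  is the new rightmost maximum, and the run of \<open>a\<close> leads from \<open>y\<close> back to
  \<open>x\<close>.\<close>

lemma pair_e_of_move:
  assumes "letter_move a b a2 b2" shows "pair_e a2 b2 = Some (a, b)"
proof -
  obtain x y where mv: "moves (set a) (set b) x y" and sets: "set a2 = set a - {x}" "set b2 = insert y (set b)"
    and s: "sorted_wrt (<) a" "sorted_wrt (<) b" "sorted_wrt (<) a2" "sorted_wrt (<) b2"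
    using assms unfolding letter_move_def by blast
  obtain UA UB where U: "unpaired a2 b2 = (UA, UB)" by fastforce
  note p = unpaired_props[OF s(3,4) U]
  let ?S = "S (set a) (set b)" and ?S2 = "S (set a2) (set b2)"
  have m: "x \<le> y" "{x..y} \<subseteq> set a" "{x..<y} \<subseteq> set b" "y \<notin> set b" "x \<in> set a" using mv by (auto simp: moves_def)
  have lt: "?S z < ?S x" if "z < x" for z using mv that by (simp add: moves_def)
  have le: "?S z \<le> ?S x" for z using mv by (simp add: moves_def)
  have S2: "?S2 z = ?S z - (if x \<le> z then 1 else 0) - (if y < z then 1 else 0)" for z
    using cnt_remove[of "set a" x z] cnt_insert[of "set b" y "z - 1"] m sets by (simp add: S_def)
  have Sy: "?S y = ?S x" by (rule S_plateau[of _ _ x y]) (use m in auto)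
  have top: "?S2 z < ?S2 y" if "y < z" for z using S2[of z] S2[of y] le[of z] Sy m(1) that by simp
  have ge: "?S2 z \<le> ?S2 y" for z
    using S2[of z] S2[of y] le[of z] lt[of z] Sy m(1) by (cases "z < x") auto
  obtain z1 where "y < z1" "?S2 z1 = int (card (set a2)) - int (card (set b2))" using S_limit[of "set a2" "set b2" y] by auto
  then have ne: "UB \<noteq> {}" using p(6) top[of z1] length_sorted[OF s(3)] length_sorted[OF s(4)] by (auto simp: not_le[symmetric])
  have "Min UB = y"
    using p(7)[OF ne, of y] p(8)[OF ne, of y] top[of "Min UB"] ge[of "Min UB"] by linarith
  moreover have "(GREATEST z. z \<le> y \<and> z \<notin> set a2) = x"
    by (rule Greatest_equality) (use m sets in \<open>auto simp: not_less[symmetric] subset_iff\<close>)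
  moreover have "remove1 y b2 = b" using sorted_remove1[OF s(4), of y] sets s m by (intro sorted_list_eq) auto
  moreover have "insort x a2 = a"
    using sorted_insort_new[OF s(3), of x] m sets s by (intro sorted_list_eq) auto
  ultimately show ?thesis using U ne by (simp add: pair_e_def Let_def)
qed

lemma pair_e_Some:
  assumes s: "sorted_wrt (<) a" "sorted_wrt (<) b" and red: "inv_reduced (A @ a @ b @ C)"
    and f: "pair_e a b = Some (a2, b2)"
  shows "letter_move a2 b2 a b"
proof -
  obtain UA UB where U: "unpaired a b = (UA, UB)" by fastforce
  note p = unpaired_props[OF s U]
  let ?S = "S (set a) (set b)"
  define y where "y = Min UB"
  define x where "x = (GREATEST x. x \<le> y \<and> x \<notin> set a)"
  have ne: "UB \<noteq> {}" and a2: "a2 = insort x a" and b2: "b2 = remove1 y b"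
    using f U by (auto simp: pair_e_def Let_def x_def y_def split: if_splits)
  have yb: "y \<in> set b" using p(2) Min_in[OF _ ne] finite_subset[OF p(2)] by (auto simp: y_def)
  have lt: "?S z < ?S y" if "y < z" for z using p(7)[OF ne] that by (simp add: y_def)
  have le: "?S z \<le> ?S y" for z using p(8)[OF ne] by (simp add: y_def)
  obtain x' where x': "x' \<le> y" "x' \<notin> set a" "{x'<..y} \<subseteq> set a"
  proof (cases "y \<in> set a")
    case True
    define h where "h = Min (set a) - 1"
    have "h \<notin> set a" using Min_le[of "set a" h] by (auto simp: h_def)
    moreover have "Min (set a) \<le> y" using True by (intro Min_le) auto
    then have "h \<le> y" unfolding h_def by linarith
    \<comment> \<open>Negating the letters turns the downward search into the upward search of
      \<open>bounded_ex\<close>.\<close>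
    ultimately obtain m where m: "- y \<le> m" "\<forall>z. - y \<le> z \<and> z \<le> m \<longrightarrow> - z \<in> set a" "- (m + 1) \<notin> set a"
      using bounded_ex[of "\<lambda>z. - z \<in> set a" "- y" "- h"] True by auto
    have "{- (m + 1)<..y} \<subseteq> set a"
    proof
      fix z assume "z \<in> {- (m + 1)<..y}"
      then show "z \<in> set a" using m(2)[rule_format, of "- z"] by simp
    qed
    then show ?thesis using that[of "- (m + 1)"] m by simp
  next
    case False
    then show ?thesis using that[of y] by simp
  qed
  have xx: "x = x'" unfolding x_def
    by (rule Greatest_equality) (use x' in \<open>auto simp: not_less[symmetric]\<close>)
  have y1: "y + 1 \<notin> set a"
    using S_step[of "set a" "set b" y] lt[of "y + 1"] yb by (auto split: if_splits)
  have xy: "{x..<y} \<subseteq> set b"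
  proof (rule ccontr)
    assume "\<not> ?thesis"
    then obtain h where "h \<in> {x..<y}" "h \<notin> set b" by blast
    then have h: "x \<le> h" "h < y" "h \<notin> set b" by auto
    then obtain m where m: "- y \<le> m" "m < - h" "\<forall>z. - y \<le> z \<and> z \<le> m \<longrightarrow> - z \<in> set b" "- (m + 1) \<notin> set b"
      using bounded_ex[of "\<lambda>z. - z \<in> set b" "- y" "- h"] yb by auto
    have "{- m..y} \<subseteq> set a" using m h x' xx by auto
    moreover have "{- m..y} \<subseteq> set b"
    proof
      fix z assume "z \<in> {- m..y}"
      then show "z \<in> set b" using m(3)[rule_format, of "- z"] by auto
    qed
    ultimately show False using run_not_reduced[OF s, of "- m" y A C] m(1,4) y1 red by simp
  qed
  have sets: "set a2 = insert x (set a)" "set b2 = set b - {y}" "sorted_wrt (<) a2" "sorted_wrt (<) b2"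
    using sorted_insort_new[OF s(1), of x] sorted_remove1[OF s(2), of y] a2 b2 x' xx by auto
  let ?S2 = "S (set a2) (set b2)"
  have S2: "?S2 z = ?S z + (if x \<le> z then 1 else 0) + (if y < z then 1 else 0)" for z
    using cnt_insert[of "set a" x z] cnt_remove[of "set b" y "z - 1"] yb x' xx sets by (simp add: S_def)
  have Sy: "?S y = ?S x" by (rule S_plateau[of _ _ x y]) (use x' xx xy in auto)
  have "?S2 z < ?S2 x" if "z < x" for z using S2[of z] S2[of x] le[of z] Sy x' xx that by simp
  moreover have "?S2 z \<le> ?S2 x" for z
    using S2[of z] S2[of x] le[of z] lt[of z] Sy x' xx by (cases "y < z") auto
  moreover have "{x..y} \<subseteq> set a2"
  proof
    fix z assume "z \<in> {x..y}"
    then show "z \<in> set a2" using x'(3) xx sets(1) by (cases "z = x") auto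
  qed
  moreover have "{x..<y} \<subseteq> set b2" "y \<notin> set b2" "x \<le> y" using xy sets(2) x'(1) xx by auto
  ultimately have "moves (set a2) (set b2) x y" unfolding moves_def by blast
  then show ?thesis unfolding letter_move_def using sets s x' xx yb by auto
qed

section \<open>The crystal isomorphism\<close>

text \<open>Every word produces some involution, so the union over all of them leaves only the
  condition of reducedness.\<close>

lemma crystal_X_iff:
  "ws \<in> crystal_X n \<longleftrightarrow> length ws = n \<and> (\<forall>w\<in>set ws. sorted_wrt (<) w) \<and> inv_reduced (concat ws)"
  using demword_I_Z[of "concat ws"]
  by (auto simp: crystal_X_def RO_n_def RO_def inv_reduced_def inv_word_def)

lemma split_lens_concat [simp]: "split_lens (map length ws) (concat ws) = ws"
  by (induction ws) auto

lemma split_lens_props: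
  "sum_list ks = length v \<Longrightarrow> map length (split_lens ks v) = ks \<and> concat (split_lens ks v) = v"
  by (induction ks arbitrary: v) (auto simp: min_def)

lemma factorization_eqI:
  "map length us = map length vs \<Longrightarrow> concat us = concat vs \<Longrightarrow> us = vs"
  by (metis split_lens_concat)

lemma sorted_iff_ascents: "sorted_wrt (<) (w :: int list) \<longleftrightarrow> (\<forall>k. Suc k < length w \<longrightarrow> w ! k < w ! Suc k)"
  by (rule sorted_wrt_iff_nth_Suc_transp) (auto intro: transpI)

text \<open>Formulated for any two words with the same cut points, since it is applied both to the
  image and to the preimage under the bump.\<close>

lemma sorted_factors_transfer:
  fixes ws vs :: "int list list"
  assumes "map length ws = map length vs" "\<forall>w\<in>set ws. sorted_wrt (<) w"
    "\<And>k. Suc k < length (concat ws) \<Longrightarrow> concat ws ! k < concat ws ! Suc k \<Longrightarrow> concat vs ! k < concat vs ! Suc k"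
  shows "\<forall>v\<in>set vs. sorted_wrt (<) v"
  using assms
proof (induction ws arbitrary: vs)
  case (Cons w ws)
  then obtain v vs' where vs: "vs = v # vs'" and l: "length w = length v" "map length ws = map length vs'" by auto
  have "sorted_wrt (<) v"
    unfolding sorted_iff_ascents
  proof (intro allI impI)
    fix k assume k: "Suc k < length v"
    have "w ! k < w ! Suc k" using Cons.prems(2) k l sorted_iff_ascents[of w] by simp
    then show "v ! k < v ! Suc k" using Cons.prems(3)[of k] k l vs by (simp add: nth_append)
  qed
  moreover have "\<forall>v\<in>set vs'. sorted_wrt (<) v"
  proof (rule Cons.IH[OF l(2)])
    fix k assume k: "Suc k < length (concat ws)" "concat ws ! k < concat ws ! Suc k"
    then show "concat vs' ! k < concat vs' ! Suc k"
      using Cons.prems(3)[of "length w + k"] l(1) by (simp add: vs nth_append)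
  qed (use Cons.prems(2) in simp)
  ultimately show ?case by (simp add: vs)
qed simp

fun T0 :: "int list \<Rightarrow> int list" where
  "T0 (x # y # w) = y # x # w"
| "T0 w = w"

lemma T0_reduced [simp]: "inv_reduced (T0 w) = inv_reduced w"
  by (cases w rule: T0.cases) (simp_all add: static_reduced[OF static_init])

text \<open>After the swap of the first two letters come \<open>T 0\<close>, \<open>T 1\<close> and
  so on, carrying the original first letter to the right.\<close>

fun bar_path :: "nat \<Rightarrow> int list \<Rightarrow> int list" where
  "bar_path 0 w = w"
| "bar_path (Suc 0) w = T0 w"
| "bar_path (Suc (Suc m)) w = T m (bar_path (Suc m) w)"

lemma bar_path_reduced [simp]: "inv_reduced (bar_path m w) = inv_reduced w"
  by (induction m w rule: bar_path.induct) auto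

text \<open>Only the first swap lacks a witness; later, the letter \<open>d\<close> just passed
  satisfies \<open>x < d < y\<close> and witnesses the swap of \<open>x\<close> and
  \<open>y\<close>.\<close>

lemma bar_path_shift:
  assumes "sorted_wrt (<) (x # a)" shows "bar_path (length a) (x # a @ R) = a @ x # R"
  using assms
proof (induction a arbitrary: R rule: rev_induct)
  case (snoc y a)
  show ?case
  proof (cases a rule: rev_cases)
    case (snoc c d)
    have "x < d" "d < y" using snoc.prems snoc by (auto simp: sorted_wrt_append)
    moreover have "bar_path (length a) (x # a @ y # R) = a @ x # y # R"
      using snoc.IH[of "y # R"] snoc.prems by (simp add: sorted_wrt_append)
    ultimately show ?thesis using T_append[of c d x y R] snoc by (simp add: ck_triple_def)
  qed simp
qed simp

lemma f_op_split: "f_op (Suc (length P)) (P @ a # b # Q) = map_option (\<lambda>(a2, b2). P @ a2 # b2 # Q) (pair_f a b)"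
  by (simp add: f_op_def pair_f_def Let_def nth_append list_update_append)

lemma e_op_split: "e_op (Suc (length P)) (P @ a # b # Q) = map_option (\<lambda>(a2, b2). P @ a2 # b2 # Q) (pair_e a b)"
  by (simp add: e_op_def pair_e_def Let_def nth_append list_update_append)

lemma crystal_split:
  assumes "ws \<in> crystal_X n" "i \<in> {1..<n}"
  obtains P a b Q where "ws = P @ a # b # Q" "i = Suc (length P)"
proof -
  obtain j where j: "i = Suc j" using assms(2) by (cases i) auto
  have "Suc j < length ws" using assms j by (simp add: crystal_X_iff)
  then have "ws = take j ws @ ws ! j # ws ! Suc j # drop (Suc (Suc j)) ws"
    by (simp add: Cons_nth_drop_Suc)
  then show ?thesis using that[of "take j ws"] j \<open>Suc j < length ws\<close> by auto
qed

lemma letter_move_crystal: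
  assumes "letter_move a b a2 b2"
  shows "P @ a2 # b2 # Q \<in> crystal_X n \<longleftrightarrow> P @ a # b # Q \<in> crystal_X n"
    "length b2 = Suc (length b)" "length a = Suc (length a2)"
    "P @ a # b # Q \<in> crystal_X n \<Longrightarrow>
      rectify (Suc (length b)) (length (concat P)) (length a2) (concat (P @ a2 # b2 # Q))
      = rectify (length b) (length (concat P)) (length a) (concat (P @ a # b # Q))"
    "P @ a # b # Q \<in> crystal_X n \<Longrightarrow>
      fst (rectify (length b) (length (concat P)) (length a) (concat (P @ a # b # Q))) < length a"
proof -
  obtain x y where s: "sorted_wrt (<) a" "sorted_wrt (<) b" "sorted_wrt (<) a2" "sorted_wrt (<) b2"
    and mv: "moves (set a) (set b) x y" and sets: "set a2 = set a - {x}" "set b2 = insert y (set b)"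
    using assms unfolding letter_move_def by blast
  note R = rectify_move[OF s mv sets, of "concat P" "concat Q"]
  show "P @ a2 # b2 # Q \<in> crystal_X n \<longleftrightarrow> P @ a # b # Q \<in> crystal_X n"
    using R s by (auto simp: crystal_X_iff)
  have m: "x \<in> set a" "y \<notin> set b" using mv moves_in[OF mv] by (auto simp: moves_def)
  show "length b2 = Suc (length b)" using m sets length_sorted[OF s(2)] length_sorted[OF s(4)] by simp
  show "length a = Suc (length a2)"
    using m sets length_sorted[OF s(1)] length_sorted[OF s(3)] card_Suc_Diff1[of "set a" x] by simp
  assume X: "P @ a # b # Q \<in> crystal_X n"
  then have red: "inv_reduced (concat P @ a @ b @ concat Q)" by (simp add: crystal_X_iff)
  then show "rectify (Suc (length b)) (length (concat P)) (length a2) (concat (P @ a2 # b2 # Q))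
      = rectify (length b) (length (concat P)) (length a) (concat (P @ a # b # Q))"
    using R by (simp del: rectify.simps)
  have "pair_f a b = Some (a2, b2)" by (rule pair_f_of_move[OF assms])
  then have "\<not> (\<forall>z. S (set a) (set b) z \<le> 0)" using pair_f_None_iff[OF s(1,2)] by simp
  then obtain z where "int 1 \<le> S (set a) (set b) z" by (auto simp: not_le int_one_le_iff_zero_less)
  then have ex: "\<exists>z. int 1 \<le> S (set a) (set b) z" by blast
  show "fst (rectify (length b) (length (concat P)) (length a) (concat (P @ a # b # Q))) < length a"
    using rectify_count[OF s(1,2) red, of 1, THEN conjunct2, THEN mp, OF ex] by (simp del: rectify.simps)
qed

lemma f_op_Some:
  assumes "ws \<in> crystal_X n" "i \<in> {1..<n}" "f_op i ws = Some us"
  obtains P a b a2 b2 Q where "ws = P @ a # b # Q" "us = P @ a2 # b2 # Q" "i = Suc (length P)" "letter_move a b a2 b2"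
proof -
  obtain P a b Q where ws: "ws = P @ a # b # Q" "i = Suc (length P)" using crystal_split[OF assms(1,2)] .
  then obtain a2 b2 where f: "pair_f a b = Some (a2, b2)" "us = P @ a2 # b2 # Q"
    using assms(3) by (auto simp: f_op_split)
  have "sorted_wrt (<) a" "sorted_wrt (<) b" "inv_reduced (concat P @ a @ b @ concat Q)"
    using assms(1) ws by (auto simp: crystal_X_iff)
  then have "letter_move a b a2 b2" using pair_f_Some f(1) by blast
  then show ?thesis by (rule that[OF ws(1) f(2) ws(2)])
qed

lemma f_op_e_op:
  assumes "ws \<in> crystal_X n" "i \<in> {1..<n}" "f_op i ws = Some us"
  shows "us \<in> crystal_X n \<and> e_op i us = Some ws"
proof -
  obtain P a b a2 b2 Q where "ws = P @ a # b # Q" "us = P @ a2 # b2 # Q" "i = Suc (length P)" "letter_move a b a2 b2"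
    using f_op_Some[OF assms] .
  then show ?thesis using letter_move_crystal(1) assms(1) pair_e_of_move by (auto simp: e_op_split)
qed

lemma e_op_f_op:
  assumes "ws \<in> crystal_X n" "i \<in> {1..<n}" "e_op i ws = Some us"
  shows "us \<in> crystal_X n \<and> f_op i us = Some ws"
proof -
  obtain P a b Q where ws: "ws = P @ a # b # Q" "i = Suc (length P)" using crystal_split[OF assms(1,2)] .
  then obtain a2 b2 where e: "pair_e a b = Some (a2, b2)" "us = P @ a2 # b2 # Q"
    using assms(3) by (auto simp: e_op_split)
  moreover have "sorted_wrt (<) a" "sorted_wrt (<) b" "inv_reduced (concat P @ a @ b @ concat Q)"
    using assms(1) ws by (auto simp: crystal_X_iff)
  ultimately have "letter_move a2 b2 a b" using pair_e_Some by blast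
  then show ?thesis using letter_move_crystal(1) assms(1) pair_f_of_move ws e by (auto simp: f_op_split)
qed

lemma crystal_split2:
  assumes "ws \<in> crystal_X n" "2 \<le> n"
  obtains a b Q where "ws = a # b # Q"
  using assms that by (cases ws; cases "tl ws") (auto simp: crystal_X_iff)

lemma f_bar1_split: "f_bar1 (a # b # Q) =
   (if a \<noteq> [] \<and> (\<forall>z\<in>set b. hd a < z) then Some (tl a # (hd a # b) # Q) else None)"
  by (simp add: f_bar1_def)

lemma e_bar1_split: "e_bar1 (a # b # Q) =
   (if b \<noteq> [] \<and> (\<forall>z\<in>set a. hd b < z) then Some ((hd b # a) # tl b # Q) else None)"
  by (simp add: e_bar1_def)

lemma bar_crystal:
  assumes "\<forall>z\<in>set a. x < z" "\<forall>z\<in>set b. x < z"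
  shows "(x # a) # b # Q \<in> crystal_X n \<longleftrightarrow> a # (x # b) # Q \<in> crystal_X n"
proof -
  have "inv_reduced (concat ((x # a) # b # Q)) = inv_reduced (concat (a # (x # b) # Q))" if "sorted_wrt (<) a"
    using bar_path_reduced[of "length a" "x # a @ b @ concat Q"] bar_path_shift[of x a "b @ concat Q"] assms that by simp
  then show ?thesis using assms by (auto simp: crystal_X_iff)
qed

lemma f_bar1_e_bar1:
  assumes "ws \<in> crystal_X n" "2 \<le> n" "f_bar1 ws = Some us"
  shows "us \<in> crystal_X n \<and> e_bar1 us = Some ws"
proof -
  obtain a b Q where ws: "ws = a # b # Q" using crystal_split2[OF assms(1,2)] .
  then obtain x a' where a: "a = x # a'" "us = a' # (x # b) # Q" "\<forall>z\<in>set b. x < z"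
    using assms(3) by (cases a) (auto simp: f_bar1_split split: if_splits)
  moreover have "\<forall>z\<in>set a'. x < z" using assms(1) ws a by (simp add: crystal_X_iff)
  ultimately show ?thesis using bar_crystal[of a' x b Q n] assms(1) ws by (simp add: e_bar1_split)
qed

lemma e_bar1_f_bar1:
  assumes "ws \<in> crystal_X n" "2 \<le> n" "e_bar1 ws = Some us"
  shows "us \<in> crystal_X n \<and> f_bar1 us = Some ws"
proof -
  obtain a b Q where ws: "ws = a # b # Q" using crystal_split2[OF assms(1,2)] .
  then obtain x b' where b: "b = x # b'" "us = (x # a) # b' # Q" "\<forall>z\<in>set a. x < z"
    using assms(3) by (cases b) (auto simp: e_bar1_split split: if_splits)
  moreover have "\<forall>z\<in>set b'. x < z" using assms(1) ws b by (simp add: crystal_X_iff)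
  ultimately show ?thesis using bar_crystal[of a x b' Q n] assms(1) ws by (simp add: f_bar1_split)
qed

section \<open>Compatibility of the bump with the crystal operators\<close>

context
  fixes \<pi> :: "int \<Rightarrow> int"
  assumes pi: "\<pi> \<in> I_Z"
begin

lemma ib_T0: assumes "inv_reduced w" shows "ib \<pi> (T0 w) = T0 (ib \<pi> w)"
proof (cases w rule: T0.cases)
  case (1 x y C)
  then show ?thesis using ib_init_swap[OF pi, of x y C] assms by auto
next
  case "2_1"
  then show ?thesis using length_ib[OF pi assms] by simp
next
  case ("2_2" x)
  then have "length (ib \<pi> w) = 1" using length_ib[OF pi assms] by simp
  then show ?thesis using "2_2" by (cases "ib \<pi> w" rule: T0.cases) auto
qed

lemma ib_bar_path: "inv_reduced w \<Longrightarrow> ib \<pi> (bar_path m w) = bar_path m (ib \<pi> w)"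
  by (induction m w rule: bar_path.induct) (auto simp: ib_T0 ib_T[OF pi])

lemma ib_fact_props:
  assumes "ws \<in> crystal_X n"
  shows "map length (ib_fact \<pi> ws) = map length ws" "concat (ib_fact \<pi> ws) = ib \<pi> (concat ws)"
    "ib_fact \<pi> ws \<in> crystal_X n"
proof -
  have red: "inv_reduced (concat ws)" using assms by (simp add: crystal_X_iff)
  have l: "sum_list (map length ws) = length (ib \<pi> (concat ws))"
    using length_ib[OF pi red] by (simp add: length_concat)
  show 1: "map length (ib_fact \<pi> ws) = map length ws" and 2: "concat (ib_fact \<pi> ws) = ib \<pi> (concat ws)"
    using split_lens_props[OF l] by (simp_all add: ib_fact_def)
  have "\<forall>v\<in>set (ib_fact \<pi> ws). sorted_wrt (<) v"
    by (rule sorted_factors_transfer[of ws]) (use 1 2 ib_ascent_iff[OF pi red] assms in \<open>auto simp: crystal_X_iff\<close>)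
  moreover have "length (ib_fact \<pi> ws) = n" using arg_cong[OF 1, of length] assms by (simp add: crystal_X_iff)
  ultimately show "ib_fact \<pi> ws \<in> crystal_X n" using ib_reduced[OF pi red] 2 by (simp add: crystal_X_iff)
qed

lemma ib_fact_bij: "bij_betw (ib_fact \<pi>) (crystal_X n) (crystal_X n)"
proof -
  have inj: "inj_on (ib \<pi>) {w. inv_reduced w}" and im: "ib \<pi> ` {w. inv_reduced w} = {w. inv_reduced w}"
    using ib_bij[OF pi] by (auto simp: bij_betw_def)
  have "inj_on (ib_fact \<pi>) (crystal_X n)"
  proof (rule inj_onI)
    fix us ws assume X: "us \<in> crystal_X n" "ws \<in> crystal_X n" and eq: "ib_fact \<pi> us = ib_fact \<pi> ws"
    have "concat us = concat ws"
      using X eq inj ib_fact_props(2)[OF X(1)] ib_fact_props(2)[OF X(2)] by (auto simp: crystal_X_iff inj_on_def)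
    then show "us = ws"
      using factorization_eqI ib_fact_props(1)[OF X(1)] ib_fact_props(1)[OF X(2)] eq by metis
  qed
  moreover have "vs \<in> ib_fact \<pi> ` crystal_X n" if vs: "vs \<in> crystal_X n" for vs
  proof -
    have "inv_reduced (concat vs)" using vs by (simp add: crystal_X_iff)
    then obtain w where w: "inv_reduced w" "ib \<pi> w = concat vs" using im by (metis imageE mem_Collect_eq)
    define ws where "ws = split_lens (map length vs) w"
    have l: "sum_list (map length vs) = length w"
      using length_ib[OF pi w(1)] w(2) by (simp add: length_concat)
    have 1: "map length ws = map length vs" "concat ws = w" using split_lens_props[OF l] by (simp_all add: ws_def)
    have "\<forall>u\<in>set ws. sorted_wrt (<) u"
      by (rule sorted_factors_transfer[of vs])
        (use 1 w vs ib_ascent_iff[OF pi w(1)] length_ib[OF pi w(1)] in \<open>auto simp: crystal_X_iff\<close>)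
    moreover have "length ws = n" using arg_cong[OF 1(1), of length] vs by (simp add: crystal_X_iff)
    ultimately have "ws \<in> crystal_X n" using 1 w by (simp add: crystal_X_iff)
    moreover have "ib_fact \<pi> ws = vs" using 1 w by (simp add: ib_fact_def)
    ultimately show ?thesis by blast
  qed
  ultimately show ?thesis using ib_fact_props(3) by (auto simp: bij_betw_def)
qed

text \<open>For partial maps inverse to each other, commutation passes from \<open>f\<close> to
  \<open>e\<close>. If \<open>e\<close> were defined only after the bump, surjectivity would give
  its value a preimage, and \<open>f\<close> would lead from there back to
  \<open>ws\<close>.\<close>

lemma inverse_commute:
  assumes f: "\<And>us. us \<in> crystal_X n \<Longrightarrow> f (ib_fact \<pi> us) = map_option (ib_fact \<pi>) (f us)"
    and fX: "\<And>us ws. us \<in> crystal_X n \<Longrightarrow> f us = Some ws \<Longrightarrow> ws \<in> crystal_X n \<and> e ws = Some us"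
    and eX: "\<And>us ws. ws \<in> crystal_X n \<Longrightarrow> e ws = Some us \<Longrightarrow> us \<in> crystal_X n \<and> f us = Some ws"
    and ws: "ws \<in> crystal_X n"
  shows "e (ib_fact \<pi> ws) = map_option (ib_fact \<pi>) (e ws)"
proof (cases "e ws")
  case (Some us)
  then have "us \<in> crystal_X n" "f (ib_fact \<pi> us) = Some (ib_fact \<pi> ws)" using eX[OF ws] f by auto
  then show ?thesis using fX ib_fact_props(3) Some by auto
next
  case None
  have "e (ib_fact \<pi> ws) = None"
  proof (rule ccontr)
    assume "e (ib_fact \<pi> ws) \<noteq> None"
    then obtain vs where "e (ib_fact \<pi> ws) = Some vs" by blast
    then have vs: "vs \<in> crystal_X n" "f vs = Some (ib_fact \<pi> ws)" using eX ib_fact_props(3)[OF ws] by blast+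
    then obtain us where us: "us \<in> crystal_X n" "vs = ib_fact \<pi> us"
      using ib_fact_bij[of n] unfolding bij_betw_def by blast
    then obtain ws' where ws': "f us = Some ws'" "ib_fact \<pi> ws' = ib_fact \<pi> ws" using f vs by auto
    then have "e ws' = Some us" "ws' \<in> crystal_X n" using fX us by blast+
    moreover have "ws' = ws" using ws' calculation(2) ws ib_fact_bij[of n] unfolding bij_betw_def inj_on_def by blast
    ultimately show False using None by simp
  qed
  then show ?thesis using None by simp
qed

text \<open>The insertion counts before and after the bump agree, which settles definedness. When
  both sides are defined, the two candidates for the moved word are compared after
  rectification.\<close>

lemma f_op_commute:
  assumes X: "ws \<in> crystal_X n" and i: "i \<in> {1..<n}"
  shows "f_op i (ib_fact \<pi> ws) = map_option (ib_fact \<pi>) (f_op i ws)"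
proof -
  let ?vs = "ib_fact \<pi> ws"
  note vs = ib_fact_props[OF X]
  obtain P a b Q where ws: "ws = P @ a # b # Q" "i = Suc (length P)" using crystal_split[OF X i] .
  obtain P' a' b' Q' where v: "?vs = P' @ a' # b' # Q'" "i = Suc (length P')" using crystal_split[OF vs(3) i] .
  have lens: "map length P' = map length P" "length a' = length a" "length b' = length b" "map length Q' = map length Q"
    using vs(1) ws v by (auto simp: append_eq_append_conv)
  have lP: "length (concat P') = length (concat P)" using lens(1) by (simp add: length_concat)
  have red: "inv_reduced (concat ws)" using X by (simp add: crystal_X_iff)
  have s: "sorted_wrt (<) a" "sorted_wrt (<) b" "inv_reduced (concat P @ a @ b @ concat Q)"
    using X ws by (auto simp: crystal_X_iff)
  have s': "sorted_wrt (<) a'" "sorted_wrt (<) b'" "inv_reduced (concat P' @ a' @ b' @ concat Q')"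
    using vs(3) v by (auto simp: crystal_X_iff)
  have R: "rectify (length b') (length (concat P')) (length a') (concat ?vs)
     = apsnd (ib \<pi>) (rectify (length b) (length (concat P)) (length a) (concat ws))"
    unfolding vs(2) lens lP by (rule rectify_ib[OF pi red]) (simp add: ws)
  show ?thesis
  proof (cases "f_op i ws")
    case None
    then have "pair_f a b = None" using ws by (simp add: f_op_split)
    then have "\<forall>z. S (set a) (set b) z \<le> int 0" using pair_f_None_iff[OF s(1,2)] by simp
    then have r: "length a \<le> fst (rectify (length b) (length (concat P)) (length a) (concat ws))"
      using rectify_count[OF s, of 0] ws by (simp del: rectify.simps)
    have "f_op i ?vs = None"
    proof (rule ccontr)
      assume "f_op i ?vs \<noteq> None"
      then obtain a2' b2' where "pair_f a' b' = Some (a2', b2')" using v by (auto simp: f_op_split)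
      then have "letter_move a' b' a2' b2'" using pair_f_Some s' by blast
      then have "fst (rectify (length b') (length (concat P')) (length a') (concat ?vs)) < length a'"
        using letter_move_crystal(5) vs(3) v by metis
      then show False using R r lens by simp
    qed
    then show ?thesis using None by simp
  next
    case (Some us)
    then obtain a2 b2 where us: "pair_f a b = Some (a2, b2)" "us = P @ a2 # b2 # Q" using ws by (auto simp: f_op_split)
    then have mv: "letter_move a b a2 b2" using pair_f_Some s by blast
    have usX: "us \<in> crystal_X n" using letter_move_crystal(1)[OF mv] X ws us by blast
    have "fst (rectify (length b) (length (concat P)) (length a) (concat ws)) < length a"
      using letter_move_crystal(5)[OF mv] X ws by blast
    then have "\<not> length a' \<le> fst (rectify (length b') (length (concat P')) (length a') (concat ?vs))"
      using R lens by simp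
    then have "pair_f a' b' \<noteq> None"
      using rectify_count[OF s', of 0] pair_f_None_iff[OF s'(1,2)] v by (auto simp del: rectify.simps)
    then obtain a2' b2' where us': "pair_f a' b' = Some (a2', b2')" by auto
    then have mv': "letter_move a' b' a2' b2'" using pair_f_Some s' by blast
    let ?us' = "P' @ a2' # b2' # Q'"
    have la: "length a2' = length a2" "length b2' = length b2"
      using letter_move_crystal(2,3)[OF mv] letter_move_crystal(2,3)[OF mv'] lens by simp_all
    \<comment> \<open>The same fuel, position and row length serve both words because the bump keeps
      factor lengths; \<open>rectify_inject\<close> needs exactly this.\<close>
    have "rectify (Suc (length b)) (length (concat P)) (length a2) (concat ?us')
       = rectify (length b') (length (concat P')) (length a') (concat ?vs)"
      using letter_move_crystal(4)[OF mv', of P' Q' n] vs(3) v lens lP la by (simp del: rectify.simps)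
    also have "\<dots> = apsnd (ib \<pi>) (rectify (Suc (length b)) (length (concat P)) (length a2) (concat us))"
      using letter_move_crystal(4)[OF mv, of P Q n] X ws us R by (simp del: rectify.simps)
    also have "\<dots> = rectify (Suc (length b)) (length (concat P)) (length a2) (ib \<pi> (concat us))"
      by (rule rectify_ib[OF pi, symmetric])
        (use usX letter_move_crystal(2)[OF mv] us in \<open>simp_all add: crystal_X_iff\<close>)
    finally have "concat ?us' = ib \<pi> (concat us)" by (rule rectify_inject)
    moreover have "map length ?us' = map length us" using lens la us by simp
    ultimately have "?us' = ib_fact \<pi> us"
      using ib_fact_props(1,2)[OF usX] by (intro factorization_eqI) simp_all
    then show ?thesis using Some us' v by (simp add: f_op_split)
  qed
qed

text \<open>The bar path is followed whether or not the operator is defined. Definedness is an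
  ascent of the resulting word at the factor boundary, hence preserved by the bump.\<close>

lemma f_bar1_commute:
  assumes X: "ws \<in> crystal_X n" and n: "2 \<le> n"
  shows "f_bar1 (ib_fact \<pi> ws) = map_option (ib_fact \<pi>) (f_bar1 ws)"
proof -
  let ?vs = "ib_fact \<pi> ws"
  note vs = ib_fact_props[OF X]
  obtain a b Q where ws: "ws = a # b # Q" using crystal_split2[OF X n] .
  obtain c d Q' where v: "?vs = c # d # Q'" using crystal_split2[OF vs(3) n] .
  have lens: "length c = length a" "length d = length b" "map length Q' = map length Q" using vs(1) ws v by auto
  show ?thesis
  proof (cases a)
    case Nil
    then show ?thesis using lens ws v by (simp add: f_bar1_split)
  next
    case (Cons x a')
    then obtain y c' where c: "c = y # c'" and lc: "length c' = length a'" using lens by (cases c) auto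
    have s: "sorted_wrt (<) (x # a')" "sorted_wrt (<) b" "sorted_wrt (<) (y # c')" "sorted_wrt (<) d"
      and red: "inv_reduced (concat ws)"
      using X vs(3) ws v Cons c by (auto simp: crystal_X_iff)
    define u where "u = a' @ x # b @ concat Q"
    have u: "u = bar_path (length a') (concat ws)"
      using bar_path_shift[OF s(1), of "b @ concat Q"] ws Cons by (simp add: u_def)
    have ru: "inv_reduced u" using red u by simp
    have iu: "ib \<pi> u = c' @ y # d @ concat Q'"
      using ib_bar_path[OF red, of "length a'"] bar_path_shift[OF s(3), of "d @ concat Q'"] vs(2) v c lc u by simp
    have cond: "(\<forall>z\<in>set d. y < z) \<longleftrightarrow> (\<forall>z\<in>set b. x < z)"
    proof (cases b)
      case Nil
      then show ?thesis using lens by simp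
    next
      case b: (Cons \<beta> b')
      then obtain \<delta> d' where d: "d = \<delta> # d'" using lens by (cases d) auto
      have "ib \<pi> u ! length a' < ib \<pi> u ! Suc (length a') \<longleftrightarrow> u ! length a' < u ! Suc (length a')"
        by (rule ib_ascent_iff[OF pi ru]) (simp add: u_def b)
      moreover have "ib \<pi> u ! length a' = y" "ib \<pi> u ! Suc (length a') = \<delta>"
        unfolding iu lc[symmetric] by (simp_all add: nth_append d)
      moreover have "u ! length a' = x" "u ! Suc (length a') = \<beta>"
        by (simp_all add: u_def nth_append b)
      ultimately have "y < \<delta> \<longleftrightarrow> x < \<beta>" by simp
      then show ?thesis using s(2,4) b d by auto
    qed
    show ?thesis
    proof (cases "\<forall>z\<in>set b. x < z")
      case False
      then have "f_bar1 ?vs = None" unfolding v c f_bar1_split using cond by auto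
      moreover have "f_bar1 ws = None" unfolding ws Cons f_bar1_split using False by auto
      ultimately show ?thesis by simp
    next
      case True
      let ?us = "a' # (x # b) # Q"
      have usX: "?us \<in> crystal_X n" using f_bar1_e_bar1[OF X n, of ?us] True ws Cons by (simp add: f_bar1_split)
      have "c' # (y # d) # Q' = ib_fact \<pi> ?us"
      proof (rule factorization_eqI)
        show "map length (c' # (y # d) # Q') = map length (ib_fact \<pi> ?us)"
          using ib_fact_props(1)[OF usX] lens lc by simp
        show "concat (c' # (y # d) # Q') = concat (ib_fact \<pi> ?us)"
          using ib_fact_props(2)[OF usX] iu by (simp add: u_def)
      qed
      moreover have "f_bar1 ?vs = Some (c' # (y # d) # Q')" unfolding v c f_bar1_split using cond True by auto
      moreover have "f_bar1 ws = Some ?us" unfolding ws Cons f_bar1_split using True by auto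
      ultimately show ?thesis by simp
    qed
  qed
qed

end

theorem theorem4p17:
  fixes n :: nat and \<pi> :: "int \<Rightarrow> int"
  assumes "0 < n" and "\<pi> \<in> I_Z"
  shows "bij_betw (ib_fact \<pi>) (crystal_X n) (crystal_X n)
    \<and> (\<forall>ws \<in> crystal_X n. weight (ib_fact \<pi> ws) = weight ws)
    \<and> (\<forall>ws \<in> crystal_X n. \<forall>i \<in> {1..<n}.
          f_op i (ib_fact \<pi> ws) = map_option (ib_fact \<pi>) (f_op i ws)
        \<and> e_op i (ib_fact \<pi> ws) = map_option (ib_fact \<pi>) (e_op i ws))
    \<and> (2 \<le> n \<longrightarrow> (\<forall>ws \<in> crystal_X n.
          f_bar1 (ib_fact \<pi> ws) = map_option (ib_fact \<pi>) (f_bar1 ws)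
        \<and> e_bar1 (ib_fact \<pi> ws) = map_option (ib_fact \<pi>) (e_bar1 ws)))"
proof (intro conjI ballI impI)
  show "bij_betw (ib_fact \<pi>) (crystal_X n) (crystal_X n)" by (rule ib_fact_bij[OF assms(2)])
  fix ws assume X: "ws \<in> crystal_X n"
  show "weight (ib_fact \<pi> ws) = weight ws" using ib_fact_props(1)[OF assms(2) X] by (simp add: weight_def)
  show "f_op i (ib_fact \<pi> ws) = map_option (ib_fact \<pi>) (f_op i ws)" if "i \<in> {1..<n}" for i
    by (rule f_op_commute[OF assms(2) X that])
  show "e_op i (ib_fact \<pi> ws) = map_option (ib_fact \<pi>) (e_op i ws)" if "i \<in> {1..<n}" for i
    by (rule inverse_commute[OF assms(2) f_op_commute[OF assms(2) _ that] f_op_e_op[OF _ that]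
          e_op_f_op[OF _ that] X])
  assume n: "2 \<le> n"
  show "f_bar1 (ib_fact \<pi> ws) = map_option (ib_fact \<pi>) (f_bar1 ws)"
    by (rule f_bar1_commute[OF assms(2) X n])
  show "e_bar1 (ib_fact \<pi> ws) = map_option (ib_fact \<pi>) (e_bar1 ws)"
    by (rule inverse_commute[OF assms(2) f_bar1_commute[OF assms(2) _ n] f_bar1_e_bar1[OF _ n]
          e_bar1_f_bar1[OF _ n] X])
qed

end
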